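(* A Segal space $X$ is a Bousfield-Segal space if and only if its associated homotopy category $\mathrm{Ho}(X)$ is a groupoid.
   Context: For a bisimplicial set $X\colon\Delta^{op}\times\Delta^{op}\to\mathrm{Set}$, $X_{nm}=X([n],[m])$, write $X_n=X_{n\bullet}$ for the $n$-th column, a simplicial set; $d_i,s_i$ denote the horizontal structure maps between columns. $X$ is $v$-fibrant if it is fibrant in the Reedy (equivalently injective) model structure on simplicial objects $n\mapsto X_n$ in simplicial sets with the Kan-Quillen model structure. For a simplicial set $A$, $A\setminus X$ is the simplicial set with $(A\setminus X)_m=\mathrm{Hom}(A\mathbin{\Box}\Delta^m,X)$, where $(A\mathbin{\Box}B)_{nm}=A_n\times B_m$; thus $\Delta^n\setminus X\cong X_n$. Let $c_n\colon C_n\hookrightarrow\Delta^n$ be the inclusion of the union of the edges $\{0,i\}$, $0<i\le n$, and $\mathrm{sp}_n\colon\mathrm{Sp}_n\hookrightarrow\Delta^n$ the inclusion of the spine (union of the edges $\{i,i+1\}$). A $v$-fibrant $X$ is a Bousfield-Segal space if the Bousfield maps $\beta_n=c_n\setminus X\colon X_n\to C_n\setminus X=X_1\times^B_{X_0}\dots\times^B_{X_0}X_1$ (fibre product along $d_1$) are weak homotopy equivalences for all $n\ge 2$, and a Segal space if the Segal maps $\xi_n=\mathrm{sp}_n\setminus X\colon X_n\to\mathrm{Sp}_n\setminus X= X_1\times^S_{X_0}\dots\times^S_{X_0}X_1$ are weak homotopy equivalences for all $n\geq 2$. For vertices $x,y\in X_{00}$, $X_1(x,y)$ is the fibre of $(d_1,d_0)\colon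 X_1\to X_0\times X_0$ over $(x,y)$, and $1_x:=s_0x$. The homotopy category $\mathrm{Ho}(X)$ of a Segal space $X$ (Rezk) has object set $X_{00}$, hom-sets $\pi_0X_1(x,y)$, identities $[1_x]$, and composition $[g]\circ[f]:=[d_1\eta_2(f,g)]$, where $\eta_2$ is a section of the acyclic fibration $\xi_2\colon X_2\to X_1\times^S_{X_0}X_1$, $\sigma\mapsto(d_2\sigma,d_0\sigma)$. *)

theory Defs
  imports Main "HOL-Library.FuncSet"
begin

section \<open>The simplex category\<close>

text \<open>A morphism $\theta\colon[m]\to[n]$ of $\Delta$ is encoded by its list of values
  $[\theta(0),\dots,\theta(m)]$. The list determines the source but not the target, so the actions
  below take the target dimension as an extra argument.\<close>

definition ops :: "nat \<Rightarrow> nat \<Rightarrow> nat list set" where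
  "ops m n = {\<theta>. length \<theta> = Suc m \<and> sorted \<theta> \<and> set \<theta> \<subseteq> {..n}}"

definition idop :: "nat \<Rightarrow> nat list" where
  "idop n = [0..<Suc n]"

definition ocomp :: "nat list \<Rightarrow> nat list \<Rightarrow> nat list" where
  "ocomp \<theta> \<phi> = map (\<lambda>i. \<theta> ! i) \<phi>"

text \<open>\<open>coface n i\<close> is the injection $[n-1]\to[n]$ omitting \<open>i\<close> (for $n \ge 1$), and
  \<open>collapse m\<close> is the unique map $[m]\to[0]$.\<close>

definition coface :: "nat \<Rightarrow> nat \<Rightarrow> nat list" where
  "coface n i = filter (\<lambda>j. j \<noteq> i) [0..<Suc n]"

definition collapse :: "nat \<Rightarrow> nat list" where
  "collapse m = replicate (Suc m) 0"


section \<open>Simplicial sets\<close>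

text \<open>\<open>act A n \<theta>\<close> is $\theta^*\colon A_n\to A_m$ for $\theta\colon[m]\to[n]$.\<close>

record 'a sset =
  cells :: "nat \<Rightarrow> 'a set"
  act :: "nat \<Rightarrow> nat list \<Rightarrow> 'a \<Rightarrow> 'a"

definition simplicial_set :: "'a sset \<Rightarrow> bool" where
  "simplicial_set A \<longleftrightarrow>
     (\<forall>m n. \<forall>\<theta>\<in>ops m n. \<forall>x\<in>cells A n. act A n \<theta> x \<in> cells A m) \<and>
     (\<forall>n. \<forall>x\<in>cells A n. act A n (idop n) x = x) \<and>
     (\<forall>l m n. \<forall>\<phi>\<in>ops l m. \<forall>\<theta>\<in>ops m n. \<forall>x\<in>cells A n.
        act A m \<phi> (act A n \<theta> x) = act A n (ocomp \<theta> \<phi>) x)"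

text \<open>Components of simplicial maps are extensional, so that equality of maps is equality of
  functions.\<close>

definition sset_hom :: "'a sset \<Rightarrow> 'b sset \<Rightarrow> (nat \<Rightarrow> 'a \<Rightarrow> 'b) set" where
  "sset_hom A B = {f. (\<forall>n. f n \<in> cells A n \<rightarrow>\<^sub>E cells B n) \<and>
     (\<forall>m n. \<forall>\<theta>\<in>ops m n. \<forall>x\<in>cells A n. f m (act A n \<theta> x) = act B n \<theta> (f n x))}"

definition face :: "'a sset \<Rightarrow> nat \<Rightarrow> nat \<Rightarrow> 'a \<Rightarrow> 'a" where
  "face A n i = act A n (coface n i)"

text \<open>\<open>const_simplex A a m\<close> is the totally degenerate \<open>m\<close>-simplex on the vertex \<open>a\<close>.\<close>

definition const_simplex :: "'a sset \<Rightarrow> 'a \<Rightarrow> nat \<Rightarrow> 'a" where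
  "const_simplex A a m = act A 0 (collapse m) a"

definition simplex :: "nat \<Rightarrow> nat list sset" where
  "simplex n = \<lparr>cells = (\<lambda>m. ops m n), act = (\<lambda>m \<theta> x. ocomp x \<theta>)\<rparr>"

definition boundary :: "nat \<Rightarrow> nat list sset" where
  "boundary n = (simplex n)\<lparr>cells := (\<lambda>m. {x \<in> ops m n. set x \<noteq> {..n}})\<rparr>"

definition horn :: "nat \<Rightarrow> nat \<Rightarrow> nat list sset" where
  "horn n k = (simplex n)\<lparr>cells := (\<lambda>m. {x \<in> ops m n. \<not> {..n} - {k} \<subseteq> set x})\<rparr>"

text \<open>The union $C_n$ of the edges $\{0,i\}$, and the spine $\mathrm{Sp}_n$.\<close>

definition corolla :: "nat \<Rightarrow> nat list sset" where
  "corolla n = (simplex n)\<lparr>cells := (\<lambda>m. {x \<in> ops m n. \<exists>i. 0 < i \<and> i \<le> n \<and> set x \<subseteq> {0, i}})\<rparr>"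

definition spine :: "nat \<Rightarrow> nat list sset" where
  "spine n = (simplex n)\<lparr>cells := (\<lambda>m. {x \<in> ops m n. \<exists>i<n. set x \<subseteq> {i, Suc i}})\<rparr>"


section \<open>Kan fibrations and weak homotopy equivalences\<close>

definition kan_fibration :: "'a sset \<Rightarrow> 'b sset \<Rightarrow> (nat \<Rightarrow> 'a \<Rightarrow> 'b) \<Rightarrow> bool" where
  "kan_fibration E B p \<longleftrightarrow> p \<in> sset_hom E B \<and>
     (\<forall>n k. 1 \<le> n \<longrightarrow> k \<le> n \<longrightarrow>
       (\<forall>u \<in> sset_hom (horn n k) E. \<forall>v \<in> sset_hom (simplex n) B.
          (\<forall>m. \<forall>x \<in> cells (horn n k) m. p m (u m x) = v m x) \<longrightarrow>
          (\<exists>w \<in> sset_hom (simplex n) E.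
             (\<forall>m. \<forall>x \<in> cells (horn n k) m. w m x = u m x) \<and>
             (\<forall>m. \<forall>x \<in> cells (simplex n) m. p m (w m x) = v m x))))"

text \<open>$\pi_0$ is the quotient of the vertices by the equivalence relation generated by the
  edges.\<close>

definition pi0_rel :: "'a sset \<Rightarrow> ('a \<times> 'a) set" where
  "pi0_rel A = (let E = {(face A 1 1 e, face A 1 0 e) | e. e \<in> cells A 1}
                in (E \<union> E\<inverse>)\<^sup>* \<inter> (cells A 0 \<times> cells A 0))"

definition pi0 :: "'a sset \<Rightarrow> 'a set set" where
  "pi0 A = cells A 0 // pi0_rel A"

text \<open>For $n\ge 1$, $\pi_n(A,a)$ is the set of \<open>n\<close>-simplices all of whose faces are constant at
  \<open>a\<close>, modulo the usual combinatorial homotopy relation for Kan complexes: $x\sim y$ if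
  some $z\in A_{n+1}$ has $d_nz=x$, $d_{n+1}z=y$ and constant remaining faces.\<close>

definition spheres :: "nat \<Rightarrow> 'a sset \<Rightarrow> 'a \<Rightarrow> 'a set" where
  "spheres n A a = {x \<in> cells A n. \<forall>i\<le>n. face A n i x = const_simplex A a (n - 1)}"

definition pi_rel :: "nat \<Rightarrow> 'a sset \<Rightarrow> 'a \<Rightarrow> ('a \<times> 'a) set" where
  "pi_rel n A a = {(x, y). x \<in> spheres n A a \<and> y \<in> spheres n A a \<and>
     (\<exists>z \<in> cells A (Suc n). face A (Suc n) n z = x \<and> face A (Suc n) (Suc n) z = y \<and>
        (\<forall>i<n. face A (Suc n) i z = const_simplex A a n))}"

definition pi_n :: "nat \<Rightarrow> 'a sset \<Rightarrow> 'a \<Rightarrow> 'a set set" where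
  "pi_n n A a = spheres n A a // pi_rel n A a"

text \<open>The definition through simplicial homotopy groups, valid for maps between Kan complexes.
  It is applied below only to \<open>c\<^sub>n \ X\<close> and \<open>sp\<^sub>n \ X\<close> for v-fibrant \<open>X\<close>, whose
  sources and targets are Kan complexes. A class \<open>K\<close> is sent to the class containing its
  image; the induced maps on $\pi_n$ are automatically homomorphisms, so bijectivity suffices.\<close>

definition weak_homotopy_equivalence ::
    "'a sset \<Rightarrow> 'b sset \<Rightarrow> (nat \<Rightarrow> 'a \<Rightarrow> 'b) \<Rightarrow> bool" where
  "weak_homotopy_equivalence A B f \<longleftrightarrow> f \<in> sset_hom A B \<and>
     bij_betw (\<lambda>K. pi0_rel B `` (f 0 ` K)) (pi0 A) (pi0 B) \<and>
     (\<forall>n\<ge>1. \<forall>a \<in> cells A 0.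
        bij_betw (\<lambda>K. pi_rel n B (f 0 a) `` (f n ` K)) (pi_n n A a) (pi_n n B (f 0 a)))"


section \<open>Bisimplicial sets\<close>

text \<open>\<open>bact X n m \<theta> \<phi>\<close> is $(\theta,\phi)^*\colon X_{nm}\to X_{n'm'}$ for $\theta\colon[n']\to[n]$
  (horizontal) and $\phi\colon[m']\to[m]$ (vertical).\<close>

record 'a bisset =
  bcells :: "nat \<Rightarrow> nat \<Rightarrow> 'a set"
  bact :: "nat \<Rightarrow> nat \<Rightarrow> nat list \<Rightarrow> nat list \<Rightarrow> 'a \<Rightarrow> 'a"

definition bisimplicial_set :: "'a bisset \<Rightarrow> bool" where
  "bisimplicial_set X \<longleftrightarrow>
     (\<forall>n m n' m'. \<forall>\<theta>\<in>ops n' n. \<forall>\<phi>\<in>ops m' m. \<forall>x\<in>bcells X n m.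
        bact X n m \<theta> \<phi> x \<in> bcells X n' m') \<and>
     (\<forall>n m. \<forall>x\<in>bcells X n m. bact X n m (idop n) (idop m) x = x) \<and>
     (\<forall>n m n' m' n'' m''. \<forall>\<theta>\<in>ops n' n. \<forall>\<phi>\<in>ops m' m. \<forall>\<theta>'\<in>ops n'' n'. \<forall>\<phi>'\<in>ops m'' m'.
        \<forall>x\<in>bcells X n m.
          bact X n' m' \<theta>' \<phi>' (bact X n m \<theta> \<phi> x) = bact X n m (ocomp \<theta> \<theta>') (ocomp \<phi> \<phi>') x)"

definition bisset_hom :: "'a bisset \<Rightarrow> 'b bisset \<Rightarrow> (nat \<Rightarrow> nat \<Rightarrow> 'a \<Rightarrow> 'b) set" where
  "bisset_hom Y X = {f. (\<forall>n m. f n m \<in> bcells Y n m \<rightarrow>\<^sub>E bcells X n m) \<and>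
     (\<forall>n m n' m'. \<forall>\<theta>\<in>ops n' n. \<forall>\<phi>\<in>ops m' m. \<forall>y\<in>bcells Y n m.
        f n' m' (bact Y n m \<theta> \<phi> y) = bact X n m \<theta> \<phi> (f n m y))}"

definition box :: "'a sset \<Rightarrow> 'b sset \<Rightarrow> ('a \<times> 'b) bisset" where
  "box A B = \<lparr>bcells = (\<lambda>n m. cells A n \<times> cells B m),
              bact = (\<lambda>n m \<theta> \<phi>. map_prod (act A n \<theta>) (act B m \<phi>))\<rparr>"

text \<open>$A\setminus X$: an operator $\phi\colon[l]\to[m]$ acts on $\mathrm{Hom}(A\Box\Delta^m,X)$ by
  precomposition with $A\Box\phi_*\colon A\Box\Delta^l\to A\Box\Delta^m$.\<close>

type_synonym ('a, 'b) ldiv_cell = "nat \<Rightarrow> nat \<Rightarrow> 'b \<times> nat list \<Rightarrow> 'a"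

definition ldiv :: "'b sset \<Rightarrow> 'a bisset \<Rightarrow> ('a, 'b) ldiv_cell sset" where
  "ldiv A X =
     \<lparr>cells = (\<lambda>m. bisset_hom (box A (simplex m)) X),
      act = (\<lambda>m \<phi> f n k. \<lambda>(a, y) \<in> bcells (box A (simplex (length \<phi> - 1))) n k.
               f n k (a, ocomp \<phi> y))\<rparr>"

text \<open>$j\setminus X\colon B\setminus X\to A\setminus X$ for the inclusion \<open>j\<close> of a subcomplex
  $A\subseteq B$.\<close>

definition ldiv_incl ::
    "'b sset \<Rightarrow> 'b sset \<Rightarrow> 'a bisset \<Rightarrow> nat \<Rightarrow> ('a, 'b) ldiv_cell \<Rightarrow> ('a, 'b) ldiv_cell" where
  "ldiv_incl A B X m = (\<lambda>f \<in> cells (ldiv B X) m. \<lambda>n k. restrict (f n k) (bcells (box A (simplex m)) n k))"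

text \<open>Reedy fibrancy: the \<open>n\<close>-th matching map is $\Delta^n\setminus X\to\partial\Delta^n\setminus X$.\<close>

definition v_fibrant :: "'a bisset \<Rightarrow> bool" where
  "v_fibrant X \<longleftrightarrow> bisimplicial_set X \<and>
     (\<forall>n. kan_fibration (ldiv (simplex n) X) (ldiv (boundary n) X)
                        (ldiv_incl (boundary n) (simplex n) X))"

text \<open>The Bousfield and Segal maps have source $\Delta^n\setminus X\cong X_n$.\<close>

definition bousfield_segal_space :: "'a bisset \<Rightarrow> bool" where
  "bousfield_segal_space X \<longleftrightarrow> v_fibrant X \<and>
     (\<forall>n\<ge>2. weak_homotopy_equivalence (ldiv (simplex n) X) (ldiv (corolla n) X)
                                        (ldiv_incl (corolla n) (simplex n) X))"

definition segal_space :: "'a bisset \<Rightarrow> bool" where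
  "segal_space X \<longleftrightarrow> v_fibrant X \<and>
     (\<forall>n\<ge>2. weak_homotopy_equivalence (ldiv (simplex n) X) (ldiv (spine n) X)
                                        (ldiv_incl (spine n) (simplex n) X))"


section \<open>The homotopy category of a Segal space\<close>

definition column :: "'a bisset \<Rightarrow> nat \<Rightarrow> 'a sset" where
  "column X n = \<lparr>cells = bcells X n, act = (\<lambda>m \<phi>. bact X n m (idop n) \<phi>)\<rparr>"

text \<open>The horizontal face $d_i\colon X_n\to X_{n-1}$ at vertical level \<open>m\<close>.\<close>

definition hface :: "'a bisset \<Rightarrow> nat \<Rightarrow> nat \<Rightarrow> nat \<Rightarrow> 'a \<Rightarrow> 'a" where
  "hface X n i m = bact X n m (coface n i) (idop m)"

definition mapping_space :: "'a bisset \<Rightarrow> 'a \<Rightarrow> 'a \<Rightarrow> 'a sset" where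
  "mapping_space X x y = (column X 1)\<lparr>cells := (\<lambda>m. {e \<in> bcells X 1 m.
     hface X 1 1 m e = const_simplex (column X 0) x m \<and> hface X 1 0 m e = const_simplex (column X 0) y m})\<rparr>"

definition unit_arrow :: "'a bisset \<Rightarrow> 'a \<Rightarrow> 'a" where
  "unit_arrow X x = bact X 0 0 (collapse 1) (idop 0) x"

text \<open>The fibre product $X_1\times^S_{X_0}X_1$, and
  $\xi_2\colon X_2\to X_1\times^S_{X_0}X_1$, $\sigma\mapsto(d_2\sigma,d_0\sigma)$.\<close>

definition segal_product :: "'a bisset \<Rightarrow> ('a \<times> 'a) sset" where
  "segal_product X =
     \<lparr>cells = (\<lambda>m. {(f, g). f \<in> bcells X 1 m \<and> g \<in> bcells X 1 m \<and> hface X 1 0 m f = hface X 1 1 m g}),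
      act = (\<lambda>m \<phi>. map_prod (act (column X 1) m \<phi>) (act (column X 1) m \<phi>))\<rparr>"

definition xi2 :: "'a bisset \<Rightarrow> nat \<Rightarrow> 'a \<Rightarrow> 'a \<times> 'a" where
  "xi2 X m = (\<lambda>s \<in> bcells X 2 m. (hface X 2 2 m s, hface X 2 0 m s))"

definition xi2_section :: "'a bisset \<Rightarrow> (nat \<Rightarrow> 'a \<times> 'a \<Rightarrow> 'a) \<Rightarrow> bool" where
  "xi2_section X \<eta> \<longleftrightarrow> \<eta> \<in> sset_hom (segal_product X) (column X 2) \<and>
     (\<forall>m. \<forall>p \<in> cells (segal_product X) m. xi2 X m (\<eta> m p) = p)"

definition eta2 :: "'a bisset \<Rightarrow> nat \<Rightarrow> 'a \<times> 'a \<Rightarrow> 'a" where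
  "eta2 X = (SOME \<eta>. xi2_section X \<eta>)"

text \<open>\<open>Comp C x y z g f\<close> is $g\circ f$ for $f\colon x\to y$ and $g\colon y\to z$.\<close>

record ('o, 'm) cat =
  Obj :: "'o set"
  Hom :: "'o \<Rightarrow> 'o \<Rightarrow> 'm set"
  Ident :: "'o \<Rightarrow> 'm"
  Comp :: "'o \<Rightarrow> 'o \<Rightarrow> 'o \<Rightarrow> 'm \<Rightarrow> 'm \<Rightarrow> 'm"

definition category :: "('o, 'm) cat \<Rightarrow> bool" where
  "category C \<longleftrightarrow>
     (\<forall>x\<in>Obj C. Ident C x \<in> Hom C x x) \<and>
     (\<forall>x\<in>Obj C. \<forall>y\<in>Obj C. \<forall>z\<in>Obj C. \<forall>f\<in>Hom C x y. \<forall>g\<in>Hom C y z.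
        Comp C x y z g f \<in> Hom C x z) \<and>
     (\<forall>x\<in>Obj C. \<forall>y\<in>Obj C. \<forall>f\<in>Hom C x y.
        Comp C x x y f (Ident C x) = f \<and> Comp C x y y (Ident C y) f = f) \<and>
     (\<forall>w\<in>Obj C. \<forall>x\<in>Obj C. \<forall>y\<in>Obj C. \<forall>z\<in>Obj C.
        \<forall>f\<in>Hom C w x. \<forall>g\<in>Hom C x y. \<forall>h\<in>Hom C y z.
          Comp C w y z h (Comp C w x y g f) = Comp C w x z (Comp C x y z h g) f)"

definition groupoid :: "('o, 'm) cat \<Rightarrow> bool" where
  "groupoid C \<longleftrightarrow> category C \<and>
     (\<forall>x\<in>Obj C. \<forall>y\<in>Obj C. \<forall>f\<in>Hom C x y. \<exists>g\<in>Hom C y x.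
        Comp C x y x g f = Ident C x \<and> Comp C y x y f g = Ident C y)"

text \<open>Composition takes the union of the classes $[d_1\eta_2(f,g)]$ over all representatives of the
  two arguments; these all coincide when \<open>X\<close> is a Segal space.\<close>

definition Ho :: "'a bisset \<Rightarrow> ('a, 'a set) cat" where
  "Ho X =
     \<lparr>Obj = bcells X 0 0,
      Hom = (\<lambda>x y. pi0 (mapping_space X x y)),
      Ident = (\<lambda>x. pi0_rel (mapping_space X x x) `` {unit_arrow X x}),
      Comp = (\<lambda>x y z G F. \<Union>f\<in>F. \<Union>g\<in>G.
                pi0_rel (mapping_space X x z) `` {hface X 2 1 0 (eta2 X 0 (f, g))})\<rparr>"

end

theory Submission
  imports Defs
begin

text \<open>
  Restriction along an inclusion of complexes $A\subseteq B$ in $\Delta^n$ gives a Kan fibration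
  $B\setminus X\to A\setminus X$, and such a fibration is a weak equivalence iff it lifts against all
  boundary inclusions. Inclusions with the latter property are closed under pushout and composition and
  satisfy right cancellation. Hence in a Segal space all of the Bousfield maps are equivalences as soon
  as $\beta_2$ is one. If vertices lift along $\beta_2$, then lifting $(f,1_x)$ gives a left inverse of $f$.
  Conversely, a lifting problem against $\beta_2$ is pushed step by step towards the last vertex until it
  becomes a sphere over a constant simplex; if the edge 01 of its base point is invertible, composing with
  an inverse inside inner 3-dimensional horns contracts this sphere.
\<close>

section \<open>Simplicial identities\<close>

text \<open>Invertibility in Ho(X) concerns only vertices of X_1, while acyclicity of beta_2 is a
  condition in every vertical dimension. Spheres bridge the gap: such a problem sits at a single
  vertex s of X_2, so one inverse of its edge f, inserted as a constant simplex, serves all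
  dimensions at once. One 3-dimensional horn is not enough. A 3-simplex over y, x, y, z contracts
  the sphere with edge 01 kept constant, but edge 02 then moves through a sphere k at h. A 3-simplex
  over x, y, x, z realises every such k as the 02-edge of a sphere at s with edge 01 constant at f,
  and subtracting that sphere repairs edge 02. These are the two halves of an exact-sequence
  argument, carried out on explicit horns instead of homotopy groups. In the passage from beta_2 to
  beta_n with n = m+1, the triangle {0,m,n} is attached to Delta^m and the edge {0,n} along its
  outer horn at 0. Apart from the induction hypothesis, this is the only place where beta_2 enters;
  the rest is the Segal condition.\<close>

lemma opsD:
  assumes "\<theta> \<in> ops m n"
  shows "length \<theta> = Suc m" "sorted \<theta>" "set \<theta> \<subseteq> {..n}" "\<And>i. i \<le> m \<Longrightarrow> \<theta> ! i \<le> n" "\<theta> \<noteq> []"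
  using assms by (auto simp: ops_def) (metis atMost_iff le_imp_less_Suc nth_mem subsetD)

lemma sorted_nth_mono': "\<theta> \<in> ops m n \<Longrightarrow> i \<le> j \<Longrightarrow> j \<le> m \<Longrightarrow> \<theta> ! i \<le> \<theta> ! j"
  by (auto simp: ops_def intro!: sorted_nth_mono)

lemma ocomp_ops:
  assumes "\<theta> \<in> ops m n" "\<phi> \<in> ops l m"
  shows "ocomp \<theta> \<phi> \<in> ops l n"
proof -
  have "sorted (ocomp \<theta> \<phi>)"
    using assms opsD[OF assms(2)] unfolding sorted_iff_nth_mono ocomp_def
    by (auto intro!: sorted_nth_mono'[OF assms(1)] sorted_nth_mono'[OF assms(2)])
  then show ?thesis using opsD[OF assms(2)] opsD[OF assms(1)] by (auto simp: ops_def ocomp_def)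
qed

lemma ocomp_assoc:
  assumes "set \<phi> \<subseteq> {..<length \<theta>}"
  shows "ocomp (ocomp a \<theta>) \<phi> = ocomp a (ocomp \<theta> \<phi>)"
  using assms by (auto simp: ocomp_def)

lemma length_ocomp [simp]: "length (ocomp a \<theta>) = length \<theta>" by (simp add: ocomp_def)

lemma idop_ops [simp]: "idop n \<in> ops n n" by (auto simp: idop_def ops_def simp del: upt_Suc)
lemma length_idop [simp]: "length (idop n) = Suc n" by (simp add: idop_def)

lemma ocomp_idop [simp]: "length a = Suc n \<Longrightarrow> ocomp a (idop n) = a"
  unfolding ocomp_def idop_def by (metis map_nth)

lemma idop_ocomp [simp]: "\<theta> \<in> ops m n \<Longrightarrow> ocomp (idop n) \<theta> = \<theta>"
  unfolding ocomp_def idop_def by (rule map_idI) (auto simp: ops_def nth_append simp del: upt_Suc)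

text \<open>Presenting operators by value functions turns equality of composites into pointwise
  arithmetic (\<open>mk_eq_iff\<close>), which settles the simplicial identities below by
  cases.\<close>

definition op_of :: "nat \<Rightarrow> (nat \<Rightarrow> nat) \<Rightarrow> nat list" where "op_of m g = map g [0..<Suc m]"

lemma mk_ops: "(\<And>i j. i \<le> j \<Longrightarrow> j \<le> m \<Longrightarrow> g i \<le> g j) \<Longrightarrow> g m \<le> n \<Longrightarrow> op_of m g \<in> ops m n"
  unfolding op_of_def ops_def sorted_iff_nth_mono
  by (auto simp: less_Suc_eq_le simp del: upt_Suc) (meson order.refl order.trans)

lemma ocomp_mk: "(\<And>j. j \<le> l \<Longrightarrow> h j \<le> m) \<Longrightarrow> ocomp (op_of m g) (op_of l h) = op_of l (\<lambda>j. g (h j))"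
  unfolding ocomp_def op_of_def by (auto simp del: upt_Suc simp: less_Suc_eq_le)

lemma ocomp_mk_left: "\<theta> \<in> ops l m \<Longrightarrow> ocomp (op_of m g) \<theta> = map g \<theta>"
  unfolding ocomp_def op_of_def by (auto simp del: upt_Suc simp: less_Suc_eq_le ops_def)

lemma mk_eq_iff: "op_of m g = op_of m h \<longleftrightarrow> (\<forall>j\<le>m. g j = h j)"
  unfolding op_of_def by (auto simp del: upt_Suc)

lemma ops_mk: "\<theta> \<in> ops m n \<Longrightarrow> \<theta> = op_of m ((!) \<theta>)"
  unfolding op_of_def using opsD(1) map_nth by metis

lemma idop_mk: "idop n = op_of n (\<lambda>j. j)" by (simp add: op_of_def idop_def)

text \<open>\<open>up i\<close> and \<open>dn i\<close> are the value functions of the coface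
  omitting \<open>i\<close> and of the codegeneracy attaining \<open>i\<close> twice.\<close>

definition up :: "nat \<Rightarrow> nat \<Rightarrow> nat" where "up i j = (if j < i then j else Suc j)"
definition dn :: "nat \<Rightarrow> nat \<Rightarrow> nat" where "dn i j = (if j \<le> i then j else j - 1)"

lemma coface_mk: "i \<le> Suc p \<Longrightarrow> coface (Suc p) i = op_of p (up i)"
proof -
  assume i: "i \<le> Suc p"
  have "[0..<Suc (Suc p)] = [0..<i] @ i # [Suc i..<Suc (Suc p)]"
    using i by (metis le0 le_imp_less_Suc upt_add_eq_append upt_conv_Cons le_add_diff_inverse less_imp_le)
  then have "coface (Suc p) i = [0..<i] @ [Suc i..<Suc (Suc p)]"
    by (simp add: coface_def del: upt_Suc) 
  also have "\<dots> = op_of p (up i)"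
    by (rule nth_equalityI) (use i in \<open>auto simp: op_of_def up_def nth_append simp del: upt_Suc\<close>)
  finally show ?thesis .
qed

lemma up_le: "j \<le> p \<Longrightarrow> up i j \<le> Suc p" by (simp add: up_def)
lemma dn_le: "i \<le> p \<Longrightarrow> j \<le> Suc p \<Longrightarrow> dn i j \<le> p" by (auto simp: dn_def)

definition codeg :: "nat \<Rightarrow> nat \<Rightarrow> nat list" where "codeg p i = op_of (Suc p) (dn i)"

lemma coface_ops: "i \<le> Suc p \<Longrightarrow> coface (Suc p) i \<in> ops p (Suc p)"
  by (auto simp: coface_mk up_def intro!: mk_ops)
lemma codeg_ops: "i \<le> p \<Longrightarrow> codeg p i \<in> ops (Suc p) p"
  by (auto simp: codeg_def dn_def intro!: mk_ops)
lemma collapse_mk: "collapse m = op_of m (\<lambda>_. 0)" 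
  by (simp add: collapse_def op_of_def map_replicate_const del: replicate_Suc upt_Suc)
lemma collapse_ops [simp]: "collapse m \<in> ops m 0" by (auto simp: collapse_mk intro!: mk_ops)

definition deg :: "'a sset \<Rightarrow> nat \<Rightarrow> nat \<Rightarrow> 'a \<Rightarrow> 'a" where "deg A p i = act A p (codeg p i)"

locale ss =
  fixes A :: "'a sset"
  assumes act_in: "\<And>m n \<theta> x. \<theta> \<in> ops m n \<Longrightarrow> x \<in> cells A n \<Longrightarrow> act A n \<theta> x \<in> cells A m"
    and act_id: "\<And>n x. x \<in> cells A n \<Longrightarrow> act A n (idop n) x = x"
    and act_act: "\<And>l m n \<phi> \<theta> x. \<phi> \<in> ops l m \<Longrightarrow> \<theta> \<in> ops m n \<Longrightarrow> x \<in> cells A n \<Longrightarrow>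
        act A m \<phi> (act A n \<theta> x) = act A n (ocomp \<theta> \<phi>) x"

context ss
begin

lemma act2:
  assumes "\<phi> \<in> ops l m" "\<theta> \<in> ops m n" "\<phi>' \<in> ops l m'" "\<theta>' \<in> ops m' n" "x \<in> cells A n"
    and "ocomp \<theta> \<phi> = ocomp \<theta>' \<phi>'"
  shows "act A m \<phi> (act A n \<theta> x) = act A m' \<phi>' (act A n \<theta>' x)"
  using assms by (metis act_act)

lemma face_in: "i \<le> Suc p \<Longrightarrow> x \<in> cells A (Suc p) \<Longrightarrow> face A (Suc p) i x \<in> cells A p"
  unfolding face_def by (rule act_in[OF coface_ops])
lemma deg_in: "i \<le> p \<Longrightarrow> x \<in> cells A p \<Longrightarrow> deg A p i x \<in> cells A (Suc p)"
  unfolding deg_def by (rule act_in[OF codeg_ops])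
lemma const_in: "a \<in> cells A 0 \<Longrightarrow> const_simplex A a m \<in> cells A m"
  unfolding const_simplex_def by (rule act_in[OF collapse_ops])

lemma face_face:
  assumes "x \<in> cells A (Suc (Suc p))" "i < j" "j \<le> Suc (Suc p)"
  shows "face A (Suc p) i (face A (Suc (Suc p)) j x) = face A (Suc p) (j - 1) (face A (Suc (Suc p)) i x)"
proof -
  have "ocomp (coface (Suc (Suc p)) j) (coface (Suc p) i) = ocomp (coface (Suc (Suc p)) i) (coface (Suc p) (j - 1))"
    using assms by (simp add: coface_mk ocomp_mk up_le mk_eq_iff) (auto simp: up_def split: if_splits)
  then show ?thesis unfolding face_def using assms by (intro act2[where l=p] coface_ops) auto
qed

lemma face_deg_lt:
  assumes "x \<in> cells A (Suc p)" "i < j" "j \<le> Suc p"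
  shows "face A (Suc (Suc p)) i (deg A (Suc p) j x) = deg A p (j - 1) (face A (Suc p) i x)"
proof -
  have "ocomp (codeg (Suc p) j) (coface (Suc (Suc p)) i) = ocomp (coface (Suc p) i) (codeg p (j - 1))"
    using assms by (simp add: coface_mk ocomp_mk up_le dn_le mk_eq_iff codeg_def) (auto simp: up_def dn_def split: if_splits)
  then show ?thesis unfolding face_def deg_def using assms by (intro act2[where l="Suc p"] coface_ops codeg_ops) auto
qed

lemma face_deg_eq:
  assumes "x \<in> cells A p" "i = j \<or> i = Suc j" "j \<le> p"
  shows "face A (Suc p) i (deg A p j x) = x"
proof -
  have "ocomp (codeg p j) (coface (Suc p) i) = idop p"
    using assms by (auto simp: coface_mk ocomp_mk up_le dn_le mk_eq_iff codeg_def idop_mk) (auto simp: up_def dn_def split: if_splits)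
  moreover have "coface (Suc p) i \<in> ops p (Suc p)" "codeg p j \<in> ops (Suc p) p"
    using assms by (auto intro: coface_ops codeg_ops)
  ultimately show ?thesis unfolding face_def deg_def using assms act_act act_id by metis
qed

lemma face_deg_gt:
  assumes "x \<in> cells A (Suc p)" "Suc j < i" "i \<le> Suc (Suc p)"
  shows "face A (Suc (Suc p)) i (deg A (Suc p) j x) = deg A p j (face A (Suc p) (i - 1) x)"
proof -
  have "ocomp (codeg (Suc p) j) (coface (Suc (Suc p)) i) = ocomp (coface (Suc p) (i - 1)) (codeg p j)"
    using assms by (simp add: coface_mk ocomp_mk up_le dn_le mk_eq_iff codeg_def) (auto simp: up_def dn_def split: if_splits)
  then show ?thesis unfolding face_def deg_def using assms by (intro act2[where l="Suc p"] coface_ops codeg_ops) auto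
qed

lemma deg_deg:
  assumes "x \<in> cells A p" "i \<le> j" "j \<le> p"
  shows "deg A (Suc p) i (deg A p j x) = deg A (Suc p) (Suc j) (deg A p i x)"
proof -
  have "ocomp (codeg p j) (codeg (Suc p) i) = ocomp (codeg p i) (codeg (Suc p) (Suc j))"
    using assms by (simp add: ocomp_mk dn_le mk_eq_iff codeg_def) (auto simp: dn_def)
  then show ?thesis unfolding deg_def using assms by (intro act2[where l="Suc (Suc p)"] codeg_ops) auto
qed

lemma act_const: 
  assumes "a \<in> cells A 0" "\<theta> \<in> ops l m" shows "act A m \<theta> (const_simplex A a m) = const_simplex A a l"
proof -
  have "ocomp (collapse m) \<theta> = collapse l" using opsD[OF assms(2)]
    by (subst ops_mk[OF assms(2)], subst collapse_mk, subst ocomp_mk) (auto simp: collapse_mk mk_eq_iff)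
  then show ?thesis using assms act_act[OF assms(2) collapse_ops] by (simp add: const_simplex_def)
qed

lemma face_const: "a \<in> cells A 0 \<Longrightarrow> i \<le> Suc p \<Longrightarrow> face A (Suc p) i (const_simplex A a (Suc p)) = const_simplex A a p"
  unfolding face_def by (rule act_const[OF _ coface_ops])
lemma deg_const: "a \<in> cells A 0 \<Longrightarrow> i \<le> p \<Longrightarrow> deg A p i (const_simplex A a p) = const_simplex A a (Suc p)"
  unfolding deg_def by (rule act_const[OF _ codeg_ops])
lemma const_0: "a \<in> cells A 0 \<Longrightarrow> const_simplex A a 0 = a"
proof -
  have "collapse 0 = idop 0" by (simp add: collapse_def idop_def)
  then show "a \<in> cells A 0 \<Longrightarrow> ?thesis" by (simp add: const_simplex_def act_id)
qed

end

text \<open>A simplicial map without the extensionality demanded by \<open>sset_hom\<close>, so that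
  plain composites and identities qualify without being restricted.\<close>

definition smap :: "'a sset \<Rightarrow> 'b sset \<Rightarrow> (nat \<Rightarrow> 'a \<Rightarrow> 'b) \<Rightarrow> bool" where
  "smap E B f \<longleftrightarrow> (\<forall>n. \<forall>x\<in>cells E n. f n x \<in> cells B n) \<and>
     (\<forall>m n. \<forall>\<theta>\<in>ops m n. \<forall>x\<in>cells E n. f m (act E n \<theta> x) = act B n \<theta> (f n x))"

lemma sset_hom_smap: "f \<in> sset_hom E B \<Longrightarrow> smap E B f"
  unfolding sset_hom_def smap_def by (auto simp: PiE_def)

lemma smap_comp: "smap A B f \<Longrightarrow> smap B C g \<Longrightarrow> smap A C (\<lambda>n x. g n (f n x))"
  unfolding smap_def by auto

lemma smap_in: "smap E B f \<Longrightarrow> x \<in> cells E n \<Longrightarrow> f n x \<in> cells B n" unfolding smap_def by auto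
lemma smap_act: "smap E B f \<Longrightarrow> \<theta> \<in> ops m n \<Longrightarrow> x \<in> cells E n \<Longrightarrow> f m (act E n \<theta> x) = act B n \<theta> (f n x)"
  unfolding smap_def by auto
lemma smap_d: "smap E B f \<Longrightarrow> i \<le> Suc p \<Longrightarrow> x \<in> cells E (Suc p) \<Longrightarrow> f p (face E (Suc p) i x) = face B (Suc p) i (f (Suc p) x)"
  unfolding face_def by (rule smap_act[OF _ coface_ops])
lemma smap_s: "smap E B f \<Longrightarrow> i \<le> p \<Longrightarrow> x \<in> cells E p \<Longrightarrow> f (Suc p) (deg E p i x) = deg B p i (f p x)"
  unfolding deg_def by (rule smap_act[OF _ codeg_ops])
lemma smap_c: "smap E B f \<Longrightarrow> a \<in> cells E 0 \<Longrightarrow> f m (const_simplex E a m) = const_simplex B (f 0 a) m"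
  unfolding const_simplex_def by (rule smap_act[OF _ collapse_ops])

section \<open>Lifting properties\<close>

text \<open>A compatible family of $p$-simplices is a map out of the union of the faces $d_i$, $i\in I$, of
  $\Delta^{p+1}$; \<open>lift\<close> is lifting against the inclusion of this union. Faces of vertices are junk,
  hence the guard \<open>0 < p\<close>.\<close>

definition compat :: "'a sset \<Rightarrow> nat \<Rightarrow> nat set \<Rightarrow> (nat \<Rightarrow> 'a) \<Rightarrow> bool" where
  "compat A p I w \<longleftrightarrow> (\<forall>i\<in>I. w i \<in> cells A p) \<and>
     (\<forall>i\<in>I. \<forall>j\<in>I. i < j \<longrightarrow> 0 < p \<longrightarrow> face A p i (w j) = face A p (j - 1) (w i))"

definition lift :: "'a sset \<Rightarrow> 'b sset \<Rightarrow> (nat \<Rightarrow> 'a \<Rightarrow> 'b) \<Rightarrow> nat \<Rightarrow> nat set \<Rightarrow> bool" where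
  "lift E B f p I \<longleftrightarrow> (\<forall>w v. compat E p I w \<longrightarrow> v \<in> cells B (Suc p) \<longrightarrow>
      (\<forall>i\<in>I. f p (w i) = face B (Suc p) i v) \<longrightarrow>
      (\<exists>e\<in>cells E (Suc p). f (Suc p) e = v \<and> (\<forall>i\<in>I. face E (Suc p) i e = w i)))"

definition kan_fib :: "'a sset \<Rightarrow> 'b sset \<Rightarrow> (nat \<Rightarrow> 'a \<Rightarrow> 'b) \<Rightarrow> bool" where
  "kan_fib E B f \<longleftrightarrow> smap E B f \<and> (\<forall>p. \<forall>k\<le>Suc p. lift E B f p ({..Suc p} - {k}))"

text \<open>Lifting against the empty boundary of Delta^0. It stands apart because
  \<open>lift\<close> speaks of simplices of dimension \<open>Suc p\<close>.\<close>

definition surj_vertices :: "'a sset \<Rightarrow> 'b sset \<Rightarrow> (nat \<Rightarrow> 'a \<Rightarrow> 'b) \<Rightarrow> bool" where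
  "surj_vertices E B f \<longleftrightarrow> (\<forall>b\<in>cells B 0. \<exists>e\<in>cells E 0. f 0 e = b)"

definition acyclic_fib :: "'a sset \<Rightarrow> 'b sset \<Rightarrow> (nat \<Rightarrow> 'a \<Rightarrow> 'b) \<Rightarrow> bool" where
  "acyclic_fib E B f \<longleftrightarrow> smap E B f \<and> surj_vertices E B f \<and> (\<forall>p. lift E B f p {..Suc p})"

definition kan_complex :: "'a sset \<Rightarrow> bool" where
  "kan_complex A \<longleftrightarrow> (\<forall>p. \<forall>k\<le>Suc p. \<forall>w. compat A p ({..Suc p} - {k}) w \<longrightarrow>
      (\<exists>e\<in>cells A (Suc p). \<forall>i\<in>{..Suc p} - {k}. face A (Suc p) i e = w i))"

lemma compatI:
  assumes "\<And>i. i \<in> I \<Longrightarrow> w i \<in> cells A p"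
    and "\<And>i j. i \<in> I \<Longrightarrow> j \<in> I \<Longrightarrow> i < j \<Longrightarrow> 0 < p \<Longrightarrow> face A p i (w j) = face A p (j - 1) (w i)"
  shows "compat A p I w"
  using assms by (auto simp: compat_def)

lemma compat_in: "compat A p I w \<Longrightarrow> i \<in> I \<Longrightarrow> w i \<in> cells A p" by (auto simp: compat_def)
lemma compat_eq: "compat A (Suc p) I w \<Longrightarrow> i \<in> I \<Longrightarrow> j \<in> I \<Longrightarrow> i < j \<Longrightarrow> face A (Suc p) i (w j) = face A (Suc p) (j - 1) (w i)"
  by (auto simp: compat_def)
lemma compat_mono: "compat A p I w \<Longrightarrow> J \<subseteq> I \<Longrightarrow> compat A p J w" unfolding compat_def by blast

lemma smap_compat:
  assumes "smap E B f" "compat E p I w" "I \<subseteq> {..Suc p}" "ss E"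
  shows "compat B p I (\<lambda>i. f p (w i))"
proof (rule compatI)
  fix i assume "i \<in> I" then show "f p (w i) \<in> cells B p" using assms by (auto intro: smap_in compat_in)
next
  fix i j assume *: "i \<in> I" "j \<in> I" "i < j" "0 < p"
  then obtain q where q: "p = Suc q" by (cases p) auto
  show "face B p i (f p (w j)) = face B p (j - 1) (f p (w i))"
    using * assms(2,3) smap_d[OF assms(1), of _ q, symmetric] compat_eq[of E q I w i j] compat_in[OF assms(2)]
    unfolding q by (auto simp: subset_iff)
qed

lemma liftD:
  assumes "lift E B f p I" "compat E p I w" "v \<in> cells B (Suc p)"
    "\<And>i. i \<in> I \<Longrightarrow> f p (w i) = face B (Suc p) i v"
  obtains e where "e \<in> cells E (Suc p)" "f (Suc p) e = v" "\<And>i. i \<in> I \<Longrightarrow> face E (Suc p) i e = w i"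
  using assms unfolding lift_def by blast

lemma liftI:
  assumes "\<And>w v. compat E p I w \<Longrightarrow> v \<in> cells B (Suc p) \<Longrightarrow>
    (\<And>i. i \<in> I \<Longrightarrow> f p (w i) = face B (Suc p) i v) \<Longrightarrow>
      \<exists>e\<in>cells E (Suc p). f (Suc p) e = v \<and> (\<forall>i\<in>I. face E (Suc p) i e = w i)"
  shows "lift E B f p I"
  using assms unfolding lift_def by blast

text \<open>The square with top \<open>\<phi>\<close> and bottom \<open>\<psi>\<close> is cartesian.\<close>

definition pullback_square :: "'a sset \<Rightarrow> 'b sset \<Rightarrow> (nat \<Rightarrow> 'a \<Rightarrow> 'b) \<Rightarrow> 'c sset \<Rightarrow> 'd sset \<Rightarrow> (nat \<Rightarrow> 'c \<Rightarrow> 'd) \<Rightarrow>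
   (nat \<Rightarrow> 'a \<Rightarrow> 'c) \<Rightarrow> (nat \<Rightarrow> 'b \<Rightarrow> 'd) \<Rightarrow> bool" where
  "pullback_square E' B' f' E B f \<phi> \<psi> \<longleftrightarrow> smap E' B' f' \<and> smap E B f \<and> smap E' E \<phi> \<and> smap B' B \<psi> \<and>
    (\<forall>n. \<forall>x\<in>cells E' n. f n (\<phi> n x) = \<psi> n (f' n x)) \<and>
    (\<forall>n. \<forall>b\<in>cells B' n. \<forall>e\<in>cells E n. f n e = \<psi> n b \<longrightarrow> (\<exists>x\<in>cells E' n. \<phi> n x = e \<and> f' n x = b)) \<and>
    (\<forall>n. \<forall>x\<in>cells E' n. \<forall>y\<in>cells E' n. \<phi> n x = \<phi> n y \<longrightarrow> f' n x = f' n y \<longrightarrow> x = y)"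

text \<open>The problem is solved after mapping it to the right-hand side. The cartesian property
  brings the solution back over \<open>v\<close>, and its faces are recognised because
  \<open>\<phi>\<close> and \<open>f'\<close> are jointly injective.\<close>

lemma lift_pullback:
  assumes pb: "pullback_square E' B' f' E B f \<phi> \<psi>" and E': "ss E'" and L: "lift E B f p I" and I: "I \<subseteq> {..Suc p}"
  shows "lift E' B' f' p I"
proof (rule liftI)
  fix w v assume w: "compat E' p I w" and v: "v \<in> cells B' (Suc p)" and fw: "\<And>i. i \<in> I \<Longrightarrow> f' p (w i) = face B' (Suc p) i v"
  have sm: "smap E' B' f'" "smap E B f" "smap E' E \<phi>" "smap B' B \<psi>"
    and comm: "\<And>n x. x \<in> cells E' n \<Longrightarrow> f n (\<phi> n x) = \<psi> n (f' n x)"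
    using pb unfolding pullback_square_def by auto
  have "\<exists>e\<in>cells E (Suc p). f (Suc p) e = \<psi> (Suc p) v \<and> (\<forall>i\<in>I. face E (Suc p) i e = \<phi> p (w i))"
    using L smap_compat[OF sm(3) w I E'] smap_in[OF sm(4) v]
      comm[OF compat_in[OF w]] fw smap_d[OF sm(4) _ v] I unfolding lift_def by (simp add: subset_iff)
  then obtain e where e: "e\<in>cells E (Suc p)" "f (Suc p) e = \<psi> (Suc p) v" "\<And>i. i\<in>I \<Longrightarrow> face E (Suc p) i e = \<phi> p (w i)"
    by auto
  then obtain x where x: "x \<in> cells E' (Suc p)" "\<phi> (Suc p) x = e" "f' (Suc p) x = v"
    using pb v unfolding pullback_square_def by meson
  have "face E' (Suc p) i x = w i" if i: "i \<in> I" for i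
  proof -
    have "i \<le> Suc p" using i I by auto
    then have "\<phi> p (face E' (Suc p) i x) = \<phi> p (w i)" "f' p (face E' (Suc p) i x) = f' p (w i)"
      using smap_d[OF sm(3) _ x(1)] smap_d[OF sm(1) _ x(1)] x e(3)[OF i] fw[OF i] by auto
    moreover have "face E' (Suc p) i x \<in> cells E' p" "w i \<in> cells E' p"
      using ss.face_in[OF E' \<open>i \<le> Suc p\<close> x(1)] compat_in[OF w i] by auto
    ultimately show ?thesis using pb unfolding pullback_square_def by meson
  qed
  then show "\<exists>e\<in>cells E' (Suc p). f' (Suc p) e = v \<and> (\<forall>i\<in>I. face E' (Suc p) i e = w i)"
    using x by auto
qed

lemma kan_fib_pullback: "pullback_square E' B' f' E B f \<phi> \<psi> \<Longrightarrow> ss E' \<Longrightarrow> kan_fib E B f \<Longrightarrow> kan_fib E' B' f'"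
  unfolding kan_fib_def by (auto intro: lift_pullback) (simp add: pullback_square_def)

lemma acyclic_fib_pullback: 
  assumes pb: "pullback_square E' B' f' E B f \<phi> \<psi>" and "ss E'" and a: "acyclic_fib E B f" shows "acyclic_fib E' B' f'"
proof -
  have "surj_vertices E' B' f'" unfolding surj_vertices_def
  proof
    fix b assume b: "b \<in> cells B' 0"
    then have "\<psi> 0 b \<in> cells B 0" using pb unfolding pullback_square_def smap_def by blast
    then obtain e where "e \<in> cells E 0" "f 0 e = \<psi> 0 b" using a unfolding acyclic_fib_def surj_vertices_def by auto
    then show "\<exists>e\<in>cells E' 0. f' 0 e = b" using pb b unfolding pullback_square_def by meson
  qed
  then show ?thesis using a lift_pullback[OF pb assms(2)] pb unfolding acyclic_fib_def pullback_square_def by auto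
qed

definition sset_iso :: "'a sset \<Rightarrow> 'b sset \<Rightarrow> (nat \<Rightarrow> 'a \<Rightarrow> 'b) \<Rightarrow> bool" where
  "sset_iso A B f \<longleftrightarrow> smap A B f \<and> (\<forall>n. bij_betw (f n) (cells A n) (cells B n))"

lemma sset_iso_inv:
  assumes "sset_iso A B f" "ss A"
  shows "sset_iso B A (\<lambda>n. the_inv_into (cells A n) (f n))"
proof -
  have bij: "\<And>n. bij_betw (f n) (cells A n) (cells B n)" and sm: "smap A B f" using assms unfolding sset_iso_def by auto
  have inj: "\<And>n. inj_on (f n) (cells A n)" and im: "\<And>n. f n ` cells A n = cells B n"
    using bij by (auto simp: bij_betw_def)
  let ?g = "\<lambda>n. the_inv_into (cells A n) (f n)"
  have g: "?g n y \<in> cells A n" "f n (?g n y) = y" if "y \<in> cells B n" for n y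
    using that im[of n] by (auto intro: the_inv_into_into[OF inj] f_the_inv_into_f[OF inj])
  have gf: "?g n (f n x) = x" if "x \<in> cells A n" for n x using that by (rule the_inv_into_f_f[OF inj])
  have "?g m (act B n \<theta> y) = act A n \<theta> (?g n y)" if "\<theta> \<in> ops m n" "y \<in> cells B n" for m n \<theta> y
    using gf[OF ss.act_in[OF assms(2) that(1) g(1)[OF that(2)]]] smap_act[OF sm that(1) g(1)[OF that(2)]] g(2)[OF that(2)]
    by simp
  then show ?thesis unfolding sset_iso_def smap_def using g bij_betw_the_inv_into[OF bij] by blast
qed

text \<open>Isomorphisms enter through the pullback lemmas, so lifting properties need no separate
  transport along them.\<close>

lemma sset_iso_pullback:
  assumes "sset_iso E' E \<phi>" "sset_iso B' B \<psi>" "smap E' B' f'" "smap E B f"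
    "\<And>n x. x \<in> cells E' n \<Longrightarrow> f n (\<phi> n x) = \<psi> n (f' n x)"
  shows "pullback_square E' B' f' E B f \<phi> \<psi>"
proof -
  have *: "\<exists>x\<in>cells E' n. \<phi> n x = e \<and> f' n x = b" if h: "b \<in> cells B' n" "e \<in> cells E n" "f n e = \<psi> n b" for n b e
  proof -
    obtain x where x: "x \<in> cells E' n" "\<phi> n x = e" using assms(1) h(2) unfolding sset_iso_def bij_betw_def by (metis imageE)
    then have "\<psi> n (f' n x) = \<psi> n b" using assms(5)[of x n] h by auto
    then have "f' n x = b" using assms(2) h(1) smap_in[OF assms(3) x(1)] unfolding sset_iso_def bij_betw_def inj_on_def by blast
    then show ?thesis using x by auto
  qed
  moreover have "\<forall>n. \<forall>x\<in>cells E' n. \<forall>y\<in>cells E' n. \<phi> n x = \<phi> n y \<longrightarrow> f' n x = f' n y \<longrightarrow> x = y"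
    using assms(1) unfolding sset_iso_def bij_betw_def inj_on_def by blast
  ultimately show ?thesis using assms unfolding pullback_square_def sset_iso_def by blast
qed

text \<open>The same square read backwards. The pullback lemmas carry a property from the second map
  to the first only, so both directions are recorded.\<close>

lemma sset_iso_pullback':
  assumes i: "sset_iso E' E \<phi>" "sset_iso B' B \<psi>" and sm: "smap E' B' f'" "smap E B f"
    and c: "\<And>n x. x \<in> cells E' n \<Longrightarrow> f n (\<phi> n x) = \<psi> n (f' n x)" and ss: "ss E'" "ss B'"
  shows "pullback_square E B f E' B' f' (\<lambda>n. the_inv_into (cells E' n) (\<phi> n)) (\<lambda>n. the_inv_into (cells B' n) (\<psi> n))"
proof (rule sset_iso_pullback[OF sset_iso_inv[OF i(1) ss(1)] sset_iso_inv[OF i(2) ss(2)] sm(2) sm(1)])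
  fix n y assume "y \<in> cells E n"
  then obtain x where x: "x \<in> cells E' n" "y = \<phi> n x" using i(1) unfolding sset_iso_def bij_betw_def by (metis imageE)
  have "the_inv_into (cells E' n) (\<phi> n) y = x" unfolding x(2)
    using i(1) x(1) unfolding sset_iso_def bij_betw_def by (auto intro: the_inv_into_f_f)
  moreover have "the_inv_into (cells B' n) (\<psi> n) (f n y) = f' n x"
    using i(2) smap_in[OF sm(1) x(1)] unfolding x(2) c[OF x(1)] sset_iso_def bij_betw_def by (auto intro: the_inv_into_f_f)
  ultimately show "f' n (the_inv_into (cells E' n) (\<phi> n) y) = the_inv_into (cells B' n) (\<psi> n) (f n y)" by simp
qed

lemma surj_vertices_comp: "surj_vertices A B f \<Longrightarrow> surj_vertices B C g \<Longrightarrow> surj_vertices A C (\<lambda>n x. g n (f n x))"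
  unfolding surj_vertices_def by metis

lemma lift_comp:
  assumes f: "smap A B f" "lift A B f p I" and g: "lift B C g p I" and I: "I \<subseteq> {..Suc p}" and A: "ss A"
  shows "lift A C (\<lambda>n x. g n (f n x)) p I"
proof (rule liftI)
  fix w v assume w: "compat A p I w" and v: "v \<in> cells C (Suc p)" and gw: "\<And>i. i \<in> I \<Longrightarrow> g p (f p (w i)) = face C (Suc p) i v"
  obtain e where "e \<in> cells B (Suc p)" "g (Suc p) e = v" "\<And>i. i\<in>I \<Longrightarrow> face B (Suc p) i e = f p (w i)"
    by (rule liftD[OF g smap_compat[OF f(1) w I A] v gw]) auto
  then obtain e' where "e' \<in> cells A (Suc p)" "f (Suc p) e' = e" "\<And>i. i\<in>I \<Longrightarrow> face A (Suc p) i e' = w i"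
    using liftD[OF f(2) w] by (metis)
  then show "\<exists>e\<in>cells A (Suc p). g (Suc p) (f (Suc p) e) = v \<and> (\<forall>i\<in>I. face A (Suc p) i e = w i)"
    using \<open>g (Suc p) e = v\<close> by auto
qed

lemma acyclic_fib_comp: "acyclic_fib A B f \<Longrightarrow> acyclic_fib B C g \<Longrightarrow> ss A \<Longrightarrow> acyclic_fib A C (\<lambda>n x. g n (f n x))"
  unfolding acyclic_fib_def by (auto intro: smap_comp surj_vertices_comp lift_comp)
lemma kan_fib_comp: "kan_fib A B f \<Longrightarrow> kan_fib B C g \<Longrightarrow> ss A \<Longrightarrow> kan_fib A C (\<lambda>n x. g n (f n x))"
  unfolding kan_fib_def by (auto intro: smap_comp lift_comp)

lemma kan_complex_kan_fib:
  assumes "kan_fib E B f" "kan_complex B" "ss E"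
  shows "kan_complex E"
  unfolding kan_complex_def
proof (intro allI impI)
  fix p k w assume k: "k \<le> Suc p" and w: "compat E p ({..Suc p} - {k}) w"
  have sm: "smap E B f" and l: "lift E B f p ({..Suc p} - {k})" using assms k unfolding kan_fib_def by auto
  have "compat B p ({..Suc p} - {k}) (\<lambda>i. f p (w i))" by (rule smap_compat[OF sm w _ assms(3)]) auto
  then obtain v where "v \<in> cells B (Suc p)" "\<And>i. i \<in> {..Suc p} - {k} \<Longrightarrow> face B (Suc p) i v = f p (w i)"
    using assms(2) k unfolding kan_complex_def by meson
  then show "\<exists>e\<in>cells E (Suc p). \<forall>i\<in>{..Suc p} - {k}. face E (Suc p) i e = w i"
    using liftD[OF l w] by (metis)
qed

lemma kan_fibD:
  assumes "kan_fib E B f" "compat E p ({..Suc p} - {k}) w" "k \<le> Suc p" "v \<in> cells B (Suc p)"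
    "\<And>i. i \<le> Suc p \<Longrightarrow> i \<noteq> k \<Longrightarrow> f p (w i) = face B (Suc p) i v"
  obtains e where "e \<in> cells E (Suc p)" "f (Suc p) e = v" "\<And>i. i \<le> Suc p \<Longrightarrow> i \<noteq> k \<Longrightarrow> face E (Suc p) i e = w i"
proof -
  have "lift E B f p ({..Suc p} - {k})" using assms unfolding kan_fib_def by auto
  then obtain e where "e \<in> cells E (Suc p)" "f (Suc p) e = v" "\<And>i. i \<in> {..Suc p} - {k} \<Longrightarrow> face E (Suc p) i e = w i"
    by (rule liftD[OF _ assms(2,4)]) (use assms(5) in auto)
  then show thesis by (intro that) auto
qed

lemma acyclic_fibD:
  assumes "acyclic_fib E B f" "compat E p {..Suc p} w" "v \<in> cells B (Suc p)"
    "\<And>i. i \<le> Suc p \<Longrightarrow> f p (w i) = face B (Suc p) i v"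
  obtains e where "e \<in> cells E (Suc p)" "f (Suc p) e = v" "\<And>i. i \<le> Suc p \<Longrightarrow> face E (Suc p) i e = w i"
proof -
  have "lift E B f p {..Suc p}" using assms unfolding acyclic_fib_def by auto
  then obtain e where "e \<in> cells E (Suc p)" "f (Suc p) e = v" "\<And>i. i \<in> {..Suc p} \<Longrightarrow> face E (Suc p) i e = w i"
    by (rule liftD[OF _ assms(2,3)]) (use assms(4) in auto)
  then show thesis by (intro that) auto
qed

lemma kan_complexD:
  assumes "kan_complex A" "compat A p ({..Suc p} - {k}) w" "k \<le> Suc p"
  obtains e where "e \<in> cells A (Suc p)" "\<And>i. i \<le> Suc p \<Longrightarrow> i \<noteq> k \<Longrightarrow> face A (Suc p) i e = w i"
proof -
  obtain e where "e \<in> cells A (Suc p)" "\<forall>i\<in>{..Suc p} - {k}. face A (Suc p) i e = w i"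
    using assms unfolding kan_complex_def by blast
  then show thesis by (intro that) auto
qed

lemma compat_cong: "(\<And>i. i \<in> I \<Longrightarrow> w i = w' i) \<Longrightarrow> compat A p I w = compat A p I w'"
  unfolding compat_def by auto

lemma surj_verticesD: "surj_vertices E B f \<Longrightarrow> b \<in> cells B 0 \<Longrightarrow> \<exists>e\<in>cells E 0. f 0 e = b" unfolding surj_vertices_def by auto
lemma acyclic_fib_smap: "acyclic_fib E B f \<Longrightarrow> smap E B f" and acyclic_fib_surj_vertices: "acyclic_fib E B f \<Longrightarrow> surj_vertices E B f" unfolding acyclic_fib_def by auto
lemma kan_fib_smap: "kan_fib E B f \<Longrightarrow> smap E B f" unfolding kan_fib_def by auto

text \<open>The faces of a homotopy relative to the boundary from \<open>x\<close> to \<open>y\<close>, where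
  \<open>x\<close> and \<open>y\<close> have dimension \<open>m\<close> and the same boundary.\<close>

definition htpy_faces :: "'a sset \<Rightarrow> nat \<Rightarrow> 'a \<Rightarrow> 'a \<Rightarrow> nat \<Rightarrow> 'a" where
  "htpy_faces A m x y i = (if i < m then deg A (m - 1) (m - 1) (face A m i x) else if i = m then x else y)"

context ss begin

lemma htpy_faces_in: "x \<in> cells A m \<Longrightarrow> y \<in> cells A m \<Longrightarrow> htpy_faces A m x y i \<in> cells A m"
  unfolding htpy_faces_def by (cases m) (auto simp: deg_in face_in)

lemma compat_htpy_faces:
  assumes x: "x \<in> cells A m" and y: "y \<in> cells A m"
    and eq: "\<And>i. 0 < m \<Longrightarrow> i \<le> m \<Longrightarrow> face A m i x = face A m i y"
  shows "compat A m {..Suc m} (htpy_faces A m x y)"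
proof (rule compatI[OF htpy_faces_in[OF x y]])
  fix i j assume ij: "i \<in> {..Suc m}" "j \<in> {..Suc m}" "i < j" "0 < m"
  obtain r where m: "m = Suc r" using ij(4) by (cases m) auto
  have xm: "x \<in> cells A (Suc r)" "y \<in> cells A (Suc r)" using x y m by auto
  show "face A m i (htpy_faces A m x y j) = face A m (j - 1) (htpy_faces A m x y i)"
  proof (cases "j < m")
    case True
    then obtain r' where r: "r = Suc r'" using ij m by (cases r) auto
    have "face A (Suc r) i (deg A r r (face A (Suc r) j x)) = deg A r' r' (face A r i (face A (Suc r) j x))"
      using face_deg_lt[of "face A (Suc r) j x" r' i r] True ij m xm unfolding r by (auto simp: face_in)
    also have "face A r i (face A (Suc r) j x) = face A r (j - 1) (face A (Suc r) i x)"
      using face_face[of x r' i j] xm True ij m unfolding r by auto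
    also have "deg A r' r' \<dots> = face A (Suc r) (j - 1) (deg A r r (face A (Suc r) i x))"
      using face_deg_lt[of "face A (Suc r) i x" r' "j - 1" r, symmetric] True ij m xm unfolding r by (auto simp: face_in)
    finally show ?thesis using True ij m by (simp add: htpy_faces_def)
  next
    case False
    show ?thesis
    proof (cases "i = m")
      case True
      moreover from True have "j = Suc m" using ij by auto
      ultimately show ?thesis using ij eq[of m] by (auto simp: htpy_faces_def)
    next
      case i: False
      then have im: "i < Suc r" using ij m by auto
      have "face A (Suc r) (j - 1) (deg A r r (face A (Suc r) i x)) = face A (Suc r) i x"
        by (rule face_deg_eq) (use xm im ij m False in \<open>auto simp: face_in\<close>)
      then show ?thesis using ij im m False eq[of i] by (auto simp: htpy_faces_def)
    qed
  qed
qed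

text \<open>Thus the degeneracy $s_m v$ is the constant homotopy on \<open>v\<close>.\<close>

lemma htpy_faces_deg:
  assumes v: "v \<in> cells A m" and i: "i \<le> Suc m"
  shows "htpy_faces A m v v i = face A (Suc m) i (deg A m m v)"
proof (cases "i < m")
  case True
  then obtain r where "m = Suc r" by (cases m) auto
  then show ?thesis using True face_deg_lt[of v r i m] v by (auto simp: htpy_faces_def)
next
  case False
  then have "i = m \<or> i = Suc m" using i by auto
  then show ?thesis using face_deg_eq[of v m i m] v False by (auto simp: htpy_faces_def)
qed

end

lemma smap_htpy_faces:
  assumes "smap E B f" "x \<in> cells E m" "ss E"
  shows "f m (htpy_faces E m x y i) = htpy_faces B m (f m x) (f m y) i"
proof (cases "i < m")
  case True
  then obtain r where m: "m = Suc r" by (cases m) auto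
  have "face E m i x \<in> cells E r" using True m assms by (auto simp: ss.face_in)
  then show ?thesis using True assms m smap_d[of E B f i r x] smap_s[of E B f r r "face E m i x"]
    by (auto simp: htpy_faces_def)
qed (auto simp: htpy_faces_def)

text \<open>A lift \<open>v'\<close> of \<open>q v\<close> differs from a lift of \<open>v\<close> by a homotopy in \<open>B\<close> relative to
  the boundary; lifting one horn of it corrects \<open>v'\<close>.\<close>

lemma acyclic_fib_cancel:
  assumes p: "kan_fib C B p" and q: "acyclic_fib B A q" and qp: "acyclic_fib C A (\<lambda>n x. q n (p n x))"
    and C: "ss C" and B: "ss B" and A: "ss A"
  shows "acyclic_fib C B p"
proof -
  have sp: "smap C B p" and sq: "smap B A q" using p q by (auto intro: kan_fib_smap acyclic_fib_smap)
  have fix': "\<exists>e\<in>cells C m. p m e = v \<and> (\<forall>i\<le>m. 0 < m \<longrightarrow> face C m i e = face C m i v')"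
    if v: "v \<in> cells B m" and v': "v' \<in> cells C m" and eq: "q m (p m v') = q m v"
      and bd: "\<And>i. 0 < m \<Longrightarrow> i \<le> m \<Longrightarrow> face B m i (p m v') = face B m i v" for m v v'
  proof -
    have pv': "p m v' \<in> cells B m" using sp v' by (rule smap_in)
    have qv: "q m v \<in> cells A m" using sq v by (rule smap_in)
    obtain z where z: "z \<in> cells B (Suc m)" "\<And>i. i \<le> Suc m \<Longrightarrow> face B (Suc m) i z = htpy_faces B m (p m v') v i"
    proof (rule acyclic_fibD[OF q ss.compat_htpy_faces[OF B pv' v bd] ss.deg_in[OF A order.refl qv]])
      fix i assume i: "i \<le> Suc m"
      show "q m (htpy_faces B m (p m v') v i) = face A (Suc m) i (deg A m m (q m v))"
        using smap_htpy_faces[OF sq pv' B] ss.htpy_faces_deg[OF A qv i] eq by simp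
    qed auto
    \<comment> \<open>The omitted face is the end of the homotopy, so filling this horn over
      \<open>z\<close> produces the corrected lift there.\<close>
    have cp: "compat C m ({..Suc m} - {Suc m}) (htpy_faces C m v' v')"
      by (rule compat_mono[OF ss.compat_htpy_faces[OF C v' v']]) auto
    obtain t where t: "t \<in> cells C (Suc m)" "p (Suc m) t = z" "\<And>i. i \<le> Suc m \<Longrightarrow> i \<noteq> Suc m \<Longrightarrow> face C (Suc m) i t = htpy_faces C m v' v' i"
    proof (rule kan_fibD[OF p cp order.refl z(1)])
      fix i assume i: "i \<le> Suc m" "i \<noteq> Suc m"
      have "p m (htpy_faces C m v' v' i) = htpy_faces B m (p m v') (p m v') i" by (rule smap_htpy_faces[OF sp v' C])
      also have "\<dots> = htpy_faces B m (p m v') v i" using i by (auto simp: htpy_faces_def)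
      finally show "p m (htpy_faces C m v' v' i) = face B (Suc m) i z" using z(2)[OF i(1)] by simp
    qed auto
    let ?e = "face C (Suc m) (Suc m) t"
    have "p m ?e = face B (Suc m) (Suc m) z" using smap_d[OF sp _ t(1)] t(2) by auto
    then have "p m ?e = v" using z(2)[of "Suc m"] by (auto simp: htpy_faces_def)
    moreover have "face C m i ?e = face C m i v'" if i: "i \<le> m" "0 < m" for i
    proof -
      obtain r where m: "m = Suc r" using i by (cases m) auto
      have "face C m i ?e = face C m m (face C (Suc m) i t)" 
        using ss.face_face[OF C, of t r i "Suc m"] i t(1) unfolding m by auto
      also have "face C (Suc m) i t = htpy_faces C m v' v' i" using t(3) i by auto
      also have "face C m m (htpy_faces C m v' v' i) = face C m i v'"
      proof (cases "i = m")
        case False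
        have "face C (Suc r) m (deg C r r (face C (Suc r) i v')) = face C (Suc r) i v'"
          by (rule ss.face_deg_eq[OF C]) (use v' m i in \<open>auto simp: ss.face_in[OF C]\<close>)
        then show ?thesis using m i False by (auto simp: htpy_faces_def)
      qed (auto simp: htpy_faces_def)
      finally show ?thesis .
    qed
    ultimately show ?thesis using ss.face_in[OF C _ t(1)] by auto
  qed
  have "surj_vertices C B p" unfolding surj_vertices_def
  proof
    fix b assume b: "b \<in> cells B 0"
    obtain c where "c \<in> cells C 0" "q 0 (p 0 c) = q 0 b"
      using surj_verticesD[OF acyclic_fib_surj_vertices[OF qp] smap_in[OF sq b]] by auto
    then show "\<exists>e\<in>cells C 0. p 0 e = b" using fix'[of b 0 c] b by auto
  qed
  moreover have "lift C B p r {..Suc r}" for r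
  proof (rule liftI)
    fix w v assume w: "compat C r {..Suc r} w" and v: "v \<in> cells B (Suc r)"
      and pw: "\<And>i. i \<in> {..Suc r} \<Longrightarrow> p r (w i) = face B (Suc r) i v"
    obtain v' where v': "v' \<in> cells C (Suc r)" "q (Suc r) (p (Suc r) v') = q (Suc r) v"
      "\<And>i. i \<le> Suc r \<Longrightarrow> face C (Suc r) i v' = w i"
      by (rule acyclic_fibD[OF qp w smap_in[OF sq v]]) (use pw smap_d[OF sq _ v] in auto)
    have "face B (Suc r) i (p (Suc r) v') = face B (Suc r) i v" if "i \<le> Suc r" for i
      using smap_d[OF sp that v'(1)] v'(3)[OF that] pw that by auto
    then show "\<exists>e\<in>cells C (Suc r). p (Suc r) e = v \<and> (\<forall>i\<in>{..Suc r}. face C (Suc r) i e = w i)"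
      using fix'[OF v v'(1,2)] v'(3) by auto
  qed
  ultimately show ?thesis unfolding acyclic_fib_def using sp by auto
qed

section \<open>Reduction of lifting problems to spheres\<close>

text \<open>Triviality of the fibre over each \<open>f 0 a\<close> in dimension \<open>p\<close>: a
  sphere at \<open>a\<close> inside the fibre bounds inside the fibre. For \<open>p = 0\<close> the
  sphere is a vertex of the fibre, and it must be joined to \<open>a\<close> there.\<close>

definition spheres_null :: "'a sset \<Rightarrow> 'b sset \<Rightarrow> (nat \<Rightarrow> 'a \<Rightarrow> 'b) \<Rightarrow> nat \<Rightarrow> bool" where
  "spheres_null E B f p \<longleftrightarrow> (\<forall>a\<in>cells E 0. \<forall>x\<in>cells E p.
     (0 < p \<longrightarrow> (\<forall>i\<le>p. face E p i x = const_simplex E a (p - 1))) \<longrightarrow>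
     f p x = const_simplex B (f 0 a) p \<longrightarrow>
     (\<exists>z\<in>cells E (Suc p). f (Suc p) z = const_simplex B (f 0 a) (Suc p) \<and> face E (Suc p) (Suc p) z = x \<and>
        (\<forall>i\<le>p. face E (Suc p) i z = const_simplex E a p)))"

definition fillable :: "'a sset \<Rightarrow> 'b sset \<Rightarrow> (nat \<Rightarrow> 'a \<Rightarrow> 'b) \<Rightarrow> nat \<Rightarrow> (nat \<Rightarrow> 'a) \<Rightarrow> 'b \<Rightarrow> bool" where
  "fillable E B f p w v \<longleftrightarrow> (\<exists>e\<in>cells E (Suc p). f (Suc p) e = v \<and> (\<forall>i\<le>Suc p. face E (Suc p) i e = w i))"

text \<open>A shift by one is $s_{m-1} d_0$, a step of the contraction of a simplex onto its last
  vertex; \<open>m\<close> such steps reach the constant simplex there. The count \<open>r\<close>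
  is the induction variable of the reduction to spheres.\<close>

definition shift_op :: "nat \<Rightarrow> nat \<Rightarrow> nat list" where "shift_op m r = op_of m (\<lambda>i. min (i + r) m)"

lemma shift_ops: "shift_op m r \<in> ops m m"
  unfolding shift_op_def by (rule mk_ops) auto

context ss begin

lemma act_shift_shift: "y \<in> cells A m \<Longrightarrow> act A m (shift_op m r) (act A m (shift_op m 1) y) = act A m (shift_op m (Suc r)) y"
proof -
  have "ocomp (shift_op m 1) (shift_op m r) = shift_op m (Suc r)"
    unfolding shift_op_def by (subst ocomp_mk) (auto simp: mk_eq_iff)
  then show "y \<in> cells A m \<Longrightarrow> ?thesis" by (simp add: act_act[OF shift_ops shift_ops])
qed

lemma act_shift_0: "y \<in> cells A m \<Longrightarrow> act A m (shift_op m 0) y = y"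
proof -
  have "shift_op m 0 = idop m" unfolding shift_op_def idop_mk by (auto simp: mk_eq_iff)
  then show "y \<in> cells A m \<Longrightarrow> ?thesis" by (simp add: act_id)
qed

lemma deg_face_0: "y \<in> cells A (Suc p) \<Longrightarrow> deg A p p (face A (Suc p) 0 y) = act A (Suc p) (shift_op (Suc p) 1) y"
proof -
  have "ocomp (coface (Suc p) 0) (codeg p p) = shift_op (Suc p) 1"
    unfolding shift_op_def coface_mk[OF le0] codeg_def by (subst ocomp_mk) (auto simp: mk_eq_iff dn_def up_def)
  then show "y \<in> cells A (Suc p) \<Longrightarrow> ?thesis" unfolding deg_def face_def
    by (simp add: act_act[OF codeg_ops coface_ops])
qed

lemma htpy_faces_0: 
  assumes "y \<in> cells A p"
  shows "htpy_faces A p y x 0 = act A p (shift_op p 1) y"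
proof (cases p)
  case 0
  have "shift_op 0 1 = idop 0" by (simp add: shift_op_def op_of_def idop_def)
  then show ?thesis using 0 act_id assms by (simp add: htpy_faces_def)
next
  case (Suc q)
  then show ?thesis using deg_face_0[of y q] assms by (auto simp: htpy_faces_def)
qed

lemma last_ops: "[p] \<in> ops 0 p" by (auto simp: ops_def)

lemma act_shift_last: 
  assumes "y \<in> cells A m" "m \<le> r" 
  shows "act A m (shift_op m r) y = const_simplex A (act A m [m] y) m"
proof -
  have "ocomp [m] (collapse m) = shift_op m r"
    using assms by (auto simp: ocomp_def collapse_def shift_op_def op_of_def min_absorb2 map_replicate_const simp del: upt_Suc replicate_Suc)
  then show ?thesis unfolding const_simplex_def using act_act[OF collapse_ops last_ops assms(1), of m] by simp
qed

lemma last_face_0: "y \<in> cells A (Suc p) \<Longrightarrow> act A p [p] (face A (Suc p) 0 y) = act A (Suc p) [Suc p] y"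
proof -
  have "ocomp (coface (Suc p) 0) [p] = [Suc p]"
    by (simp add: coface_mk ocomp_def op_of_def up_def del: upt_Suc)
  then show "y \<in> cells A (Suc p) \<Longrightarrow> ?thesis" unfolding face_def
    by (simp add: act_act[OF last_ops coface_ops])
qed

end

text \<open>Filling all but the 0-th face reduces a lifting problem to one between two simplices with the same
  boundary, whose target and last faces are moved one step towards the last vertex.\<close>

lemma fillable_step:
  assumes f: "kan_fib E B f" and E: "ss E" and B: "ss B"
    and w: "compat E p {..Suc p} w" and v: "v \<in> cells B (Suc p)"
    and fw: "\<And>i. i \<le> Suc p \<Longrightarrow> f p (w i) = face B (Suc p) i v"
  obtains x where "x \<in> cells E p" "\<And>i. 0 < p \<Longrightarrow> i \<le> p \<Longrightarrow> face E p i (w 0) = face E p i x"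
    "f p x = face B (Suc p) 0 v"
    "fillable E B f p (htpy_faces E p (w 0) x) (deg B p p (face B (Suc p) 0 v)) \<Longrightarrow> fillable E B f p w v"
proof -
  have sf: "smap E B f" using f by (rule kan_fib_smap)
  obtain e where e: "e \<in> cells E (Suc p)" "f (Suc p) e = v" "\<And>i. i \<le> Suc p \<Longrightarrow> i \<noteq> 0 \<Longrightarrow> face E (Suc p) i e = w i"
    by (rule kan_fibD[OF f compat_mono[OF w] _ v fw, where k=0]) auto
  define x where "x = face E (Suc p) 0 e"
  have x: "x \<in> cells E p" unfolding x_def using e(1) by (simp add: ss.face_in[OF E])
  have y: "w 0 \<in> cells E p" using compat_in[OF w] by auto
  have bd: "face E p i (w 0) = face E p i x" if i: "0 < p" "i \<le> p" for i
  proof -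
    obtain r where p: "p = Suc r" using i by (cases p) auto
    have "face E p i x = face E p 0 (face E (Suc p) (Suc i) e)" unfolding x_def p
      using ss.face_face[OF E, of e r 0 "Suc i"] e(1) i p by auto
    also have "\<dots> = face E p i (w 0)" using e(3)[of "Suc i"] i compat_eq[of E r "{..Suc p}" w 0 "Suc i"] w p by auto
    finally show ?thesis by simp
  qed
  have fx: "f p x = face B (Suc p) 0 v" unfolding x_def using smap_d[OF sf _ e(1)] e(2) by auto
  have "fillable E B f p w v" if fil: "fillable E B f p (htpy_faces E p (w 0) x) (deg B p p (face B (Suc p) 0 v))"
  proof -
    obtain z where z: "z \<in> cells E (Suc p)" "f (Suc p) z = deg B p p (face B (Suc p) 0 v)"
       "\<And>i. i \<le> Suc p \<Longrightarrow> face E (Suc p) i z = htpy_faces E p (w 0) x i" using fil unfolding fillable_def by auto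
    \<comment> \<open>\<open>T\<close> is the boundary of the constant homotopy on \<open>e\<close>
      with its 0-th face replaced by \<open>z\<close>. The face \<open>Suc p\<close> of the filler
      is then a copy of \<open>e\<close> whose wrong 0-th face \<open>x\<close> has become
      \<open>w 0\<close>.\<close>
    define T where "T i = (if i = 0 then z else htpy_faces E (Suc p) e e i)" for i
    have Hc: "compat E (Suc p) {..Suc (Suc p)} (htpy_faces E (Suc p) e e)" by (rule ss.compat_htpy_faces[OF E e(1) e(1)]) simp
    have T: "compat E (Suc p) ({..Suc (Suc p)} - {Suc p}) T"
    proof (rule compatI)
      fix i assume "i \<in> {..Suc (Suc p)} - {Suc p}"
      then show "T i \<in> cells E (Suc p)" using z(1) compat_in[OF Hc] by (auto simp: T_def)
    next
      fix i j assume ij: "i \<in> {..Suc (Suc p)} - {Suc p}" "j \<in> {..Suc (Suc p)} - {Suc p}" "i < j"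
      show "face E (Suc p) i (T j) = face E (Suc p) (j - 1) (T i)"
      proof (cases "i = 0")
        case False
        then show ?thesis using compat_eq[OF Hc _ _ ij(3)] ij by (auto simp: T_def)
      next
        case i: True
        show ?thesis
        proof (cases "j = Suc (Suc p)")
          case True
          then show ?thesis using i z(3)[of "Suc p"] by (auto simp: T_def htpy_faces_def x_def)
        next
          case False
          then have j: "0 < j" "j \<le> p" using ij by auto
          then obtain r where p: "p = Suc r" by (cases p) auto
          have wj: "w j \<in> cells E (Suc r)" using compat_in[OF w, of j] j p by auto
          have "face E (Suc p) 0 (T j) = face E (Suc p) 0 (deg E p p (w j))"
            using j e(3)[of j] by (auto simp: T_def htpy_faces_def)
          also have "\<dots> = deg E r r (face E p 0 (w j))"
            using ss.face_deg_lt[OF E wj, of 0 p] p by auto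
          also have "face E p 0 (w j) = face E p (j - 1) (w 0)" using compat_eq[of E r "{..Suc p}" w 0 j] w j p by auto
          also have "deg E r r \<dots> = face E (Suc p) (j - 1) z"
            using z(3)[of "j - 1"] j p by (auto simp: htpy_faces_def)
          finally show ?thesis using i by (simp add: T_def)
        qed
      qed
    qed
    obtain t where t: "t \<in> cells E (Suc (Suc p))" "f (Suc (Suc p)) t = deg B (Suc p) (Suc p) v"
      "\<And>i. i \<le> Suc (Suc p) \<Longrightarrow> i \<noteq> Suc p \<Longrightarrow> face E (Suc (Suc p)) i t = T i"
    proof (rule kan_fibD[OF f T _ ss.deg_in[OF B order.refl v]])
      fix i assume i: "i \<le> Suc (Suc p)" "i \<noteq> Suc p"
      show "f (Suc p) (T i) = face B (Suc (Suc p)) i (deg B (Suc p) (Suc p) v)"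
      proof (cases "i = 0")
        case True
        then show ?thesis using z(2) ss.face_deg_lt[OF B v, of 0 "Suc p"] by (simp add: T_def)
      next
        case False
        then show ?thesis using smap_htpy_faces[OF sf e(1) E, of e i] e(2) ss.htpy_faces_deg[OF B v i(1)] by (simp add: T_def)
      qed
    qed auto
    let ?e = "face E (Suc (Suc p)) (Suc p) t"
    have "f (Suc p) ?e = v" using smap_d[OF sf _ t(1), of "Suc p"] t(2) ss.face_deg_eq[OF B v] by auto
    moreover have "face E (Suc p) i ?e = w i" if i: "i \<le> Suc p" for i
    proof -
      consider "i = Suc p" | "i = 0" | "0 < i" "i \<le> p" using i by linarith
      then show ?thesis
      proof cases
        case 1
        have "face E (Suc p) (Suc p) ?e = face E (Suc p) (Suc p) (face E (Suc (Suc p)) (Suc (Suc p)) t)"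
          using ss.face_face[OF E t(1), of "Suc p" "Suc (Suc p)"] by auto
        then show ?thesis using 1 t(3)[of "Suc (Suc p)"] e(3)[of "Suc p"] by (auto simp: T_def htpy_faces_def)
      next
        case 2
        have "face E (Suc p) 0 ?e = face E (Suc p) p (face E (Suc (Suc p)) 0 t)"
          using ss.face_face[OF E t(1), of 0 "Suc p"] by auto
        then show ?thesis using 2 t(3)[of 0] z(3)[of p] by (auto simp: T_def htpy_faces_def)
      next
        case 3
        have "face E (Suc p) i ?e = face E (Suc p) p (face E (Suc (Suc p)) i t)"
          using ss.face_face[OF E t(1), of i "Suc p"] 3 by auto
        also have "\<dots> = face E (Suc p) p (deg E p p (w i))" using 3 t(3)[of i] e(3)[of i] by (auto simp: T_def htpy_faces_def)
        also have "\<dots> = w i" using ss.face_deg_eq[OF E, of "w i" p p p] compat_in[OF w, of i] 3 by auto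
        finally show ?thesis .
      qed
    qed
    ultimately show ?thesis unfolding fillable_def using ss.face_in[OF E _ t(1)] by auto
  qed
  with x bd fx that show thesis by blast
qed

text \<open>The induction is on the number \<open>r\<close> of shifts that make the target and the
  0-th face constant at \<open>a\<close> and \<open>f 0 a\<close>; \<open>fillable_step\<close>
  lowers it by one. At \<open>r = 0\<close> the same step leaves a sphere over a constant simplex,
  which bounds by hypothesis.\<close>

theorem acyclic_fib_if_spheres_null:
  assumes f: "kan_fib E B f" and s: "surj_vertices E B f" and N: "\<And>p. spheres_null E B f p" and E: "ss E" and B: "ss B"
  shows "acyclic_fib E B f"
proof -
  have sf: "smap E B f" using f by (rule kan_fib_smap)
  have main: "fillable E B f p w v" 
    if "compat E p {..Suc p} w" "v \<in> cells B (Suc p)" "\<And>i. i \<le> Suc p \<Longrightarrow> f p (w i) = face B (Suc p) i v"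
      "a \<in> cells E 0" "act E p (shift_op p r) (w 0) = const_simplex E a p"
      "act B (Suc p) (shift_op (Suc p) r) v = const_simplex B (f 0 a) (Suc p)" for p r a w v
    using that
  proof (induction r arbitrary: w v)
    case 0
    have w0: "w 0 = const_simplex E a p" using 0 ss.act_shift_0[OF E] compat_in[OF 0(1)] by auto
    have v: "v = const_simplex B (f 0 a) (Suc p)" using 0 ss.act_shift_0[OF B] by auto
    have fa: "f 0 a \<in> cells B 0" using 0(4) smap_in[OF sf] by auto
    have c: "const_simplex E a p \<in> cells E p" using ss.const_in[OF E 0(4)] .
    have d0v: "face B (Suc p) 0 v = const_simplex B (f 0 a) p" unfolding v using ss.face_const[OF B fa] by simp
    obtain x where x: "x \<in> cells E p" "\<And>i. 0 < p \<Longrightarrow> i \<le> p \<Longrightarrow> face E p i (w 0) = face E p i x"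
      "f p x = face B (Suc p) 0 v"
      "fillable E B f p (htpy_faces E p (w 0) x) (deg B p p (face B (Suc p) 0 v)) \<Longrightarrow> fillable E B f p w v"
      using fillable_step[OF f E B 0(1,2,3)] by metis
    have bx: "face E p i x = const_simplex E a (p - 1)" if i: "0 < p" "i \<le> p" for i
    proof -
      obtain q where "p = Suc q" using i by (cases p) auto
      then show ?thesis using x(2)[OF i] ss.face_const[OF E 0(4), of i q] i w0 by simp
    qed
    obtain z where z: "z\<in>cells E (Suc p)" "f (Suc p) z = const_simplex B (f 0 a) (Suc p)" "face E (Suc p) (Suc p) z = x"
        "\<And>i. i\<le>p \<Longrightarrow> face E (Suc p) i z = const_simplex E a p"
      using N[of p] 0(4) x(1) bx x(3) d0v unfolding spheres_null_def by metis
    have "face E (Suc p) i z = htpy_faces E p (w 0) x i" if i: "i \<le> Suc p" for i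
    proof (cases "i = Suc p")
      case False
      have "htpy_faces E p (w 0) x i = htpy_faces E p (w 0) (w 0) i" using False i by (auto simp: htpy_faces_def)
      also have "\<dots> = const_simplex E a p"
        unfolding w0 ss.htpy_faces_deg[OF E c i] ss.deg_const[OF E 0(4) order.refl] using ss.face_const[OF E 0(4)] i by simp
      finally show ?thesis using z(4)[of i] False i by simp
    qed (use z in \<open>auto simp: htpy_faces_def\<close>)
    then have "fillable E B f p (htpy_faces E p (w 0) x) (deg B p p (face B (Suc p) 0 v))"
      unfolding fillable_def using z d0v ss.deg_const[OF B fa order.refl] by auto
    then show ?case by (rule x(4))
  next
    case (Suc r)
    note pr = Suc.prems
    have w0: "w 0 \<in> cells E p" using compat_in[OF pr(1)] by auto
    obtain x where x: "x \<in> cells E p" "\<And>i. 0 < p \<Longrightarrow> i \<le> p \<Longrightarrow> face E p i (w 0) = face E p i x"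
      "f p x = face B (Suc p) 0 v"
      "fillable E B f p (htpy_faces E p (w 0) x) (deg B p p (face B (Suc p) 0 v)) \<Longrightarrow> fillable E B f p w v"
      using fillable_step[OF f E B pr(1-3)] by metis
    let ?v = "deg B p p (face B (Suc p) 0 v)"
    have dv: "face B (Suc p) 0 v \<in> cells B p" using pr(2) by (simp add: ss.face_in[OF B])
    have "fillable E B f p (htpy_faces E p (w 0) x) ?v"
    proof (rule Suc.IH[OF ss.compat_htpy_faces[OF E w0 x(1,2)] _ _ pr(4)])
      show "?v \<in> cells B (Suc p)" using dv by (simp add: ss.deg_in[OF B])
      show "f p (htpy_faces E p (w 0) x i) = face B (Suc p) i ?v" if "i \<le> Suc p" for i
        unfolding smap_htpy_faces[OF sf w0 E] x(3) pr(3)[OF le0] using ss.htpy_faces_deg[OF B dv that] .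
      show "act E p (shift_op p r) (htpy_faces E p (w 0) x 0) = const_simplex E a p"
        using ss.htpy_faces_0[OF E w0] ss.act_shift_shift[OF E w0] pr(5) by simp
      show "act B (Suc p) (shift_op (Suc p) r) ?v = const_simplex B (f 0 a) (Suc p)"
        using ss.deg_face_0[OF B pr(2)] ss.act_shift_shift[OF B pr(2)] pr(6) by simp
    qed auto
    then show ?case by (rule x(4))
  qed
  have "lift E B f p {..Suc p}" for p
  proof (rule liftI)
    fix w v assume w: "compat E p {..Suc p} w" and v: "v \<in> cells B (Suc p)" 
      and fw: "\<And>i. i \<in> {..Suc p} \<Longrightarrow> f p (w i) = face B (Suc p) i v"
    have w0: "w 0 \<in> cells E p" using compat_in[OF w] by auto
    \<comment> \<open>The base point is the last vertex of \<open>w 0\<close>. It lies over the last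
      vertex of \<open>v\<close>, because dropping vertex 0 keeps the last one, and
      \<open>Suc p\<close> shifts reach both.\<close>
    let ?a = "act E p [p] (w 0)"
    have "f 0 ?a = act B (Suc p) [Suc p] v"
      using smap_act[OF sf ss.last_ops[OF E] w0] fw[of 0] ss.last_face_0[OF B v] by simp
    then have "fillable E B f p w v"
      using ss.act_shift_last[OF E w0, of "Suc p"] ss.act_shift_last[OF B v, of "Suc p"] fw 
      by (intro main[OF w v _ ss.act_in[OF E ss.last_ops[OF E] w0], of "Suc p"]) auto
    then show "\<exists>e\<in>cells E (Suc p). f (Suc p) e = v \<and> (\<forall>i\<in>{..Suc p}. face E (Suc p) i e = w i)"
      unfolding fillable_def by auto
  qed
  then show ?thesis unfolding acyclic_fib_def using sf s by auto
qed

section \<open>Homotopy groups and acyclic fibrations\<close>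

text \<open>Since \<open>gR\<close> makes the image of a class independent of representatives,
  bijectivity on sets of homotopy classes can be tested on representatives.\<close>

lemma bij_betw_quotients_iff:
  assumes R: "equiv A R" and S: "equiv B S" and g: "\<And>x. x \<in> A \<Longrightarrow> g x \<in> B"
    and gR: "\<And>x y. (x, y) \<in> R \<Longrightarrow> (g x, g y) \<in> S"
  shows "bij_betw (\<lambda>K. S `` (g ` K)) (A // R) (B // S) \<longleftrightarrow>
    (\<forall>x\<in>A. \<forall>y\<in>A. (g x, g y) \<in> S \<longrightarrow> (x, y) \<in> R) \<and> (\<forall>b\<in>B. \<exists>a\<in>A. (g a, b) \<in> S)"
proof -
  have im: "S `` (g ` (R `` {x})) = S `` {g x}" if x: "x \<in> A" for x
  proof
    show "S `` (g ` (R `` {x})) \<subseteq> S `` {g x}"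
      using gR S by (auto simp: equiv_def dest: transD)
    have "(x, x) \<in> R" using R x by (auto simp: equiv_def refl_on_def)
    then show "S `` {g x} \<subseteq> S `` (g ` (R `` {x}))" by auto
  qed
  have inj: "inj_on (\<lambda>K. S `` (g ` K)) (A // R) \<longleftrightarrow> (\<forall>x\<in>A. \<forall>y\<in>A. (g x, g y) \<in> S \<longrightarrow> (x, y) \<in> R)"
  proof
    assume i: "inj_on (\<lambda>K. S `` (g ` K)) (A // R)"
    show "\<forall>x\<in>A. \<forall>y\<in>A. (g x, g y) \<in> S \<longrightarrow> (x, y) \<in> R"
    proof (intro ballI impI)
      fix x y assume xy: "x \<in> A" "y \<in> A" "(g x, g y) \<in> S"
      have "S `` (g ` (R `` {x})) = S `` (g ` (R `` {y}))"
        unfolding im[OF xy(1)] im[OF xy(2)] by (rule equiv_class_eq[OF S xy(3)])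
      then have "R `` {x} = R `` {y}" using i xy by (auto simp: inj_on_def quotient_def)
      then show "(x, y) \<in> R" using eq_equiv_class[OF _ R xy(2)] by blast
    qed
  next
    assume i: "\<forall>x\<in>A. \<forall>y\<in>A. (g x, g y) \<in> S \<longrightarrow> (x, y) \<in> R"
    show "inj_on (\<lambda>K. S `` (g ` K)) (A // R)"
    proof (rule inj_onI)
      fix K L assume "K \<in> A // R" "L \<in> A // R" and e: "S `` (g ` K) = S `` (g ` L)"
      then obtain x y where x: "x \<in> A" "y \<in> A" "K = R `` {x}" "L = R `` {y}" by (auto simp: quotient_def)
      then have "S `` {g x} = S `` {g y}" using e im by simp
      then have "(g x, g y) \<in> S" using eq_equiv_class[OF _ S g[OF x(2)]] by blast
      then have "(x, y) \<in> R" using i x by blast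
      then show "K = L" using equiv_class_eq[OF R] x by blast
    qed
  qed
  have "(\<lambda>K. S `` (g ` K)) ` (A // R) = (\<lambda>x. S `` {g x}) ` A"
    unfolding quotient_def using im by (auto simp: image_iff)
  moreover have "(\<lambda>x. S `` {g x}) ` A = B // S \<longleftrightarrow> (\<forall>b\<in>B. \<exists>a\<in>A. (g a, b) \<in> S)"
  proof
    assume e: "(\<lambda>x. S `` {g x}) ` A = B // S"
    show "\<forall>b\<in>B. \<exists>a\<in>A. (g a, b) \<in> S"
    proof
      fix b assume b: "b \<in> B"
      then have "S `` {b} \<in> (\<lambda>x. S `` {g x}) ` A" unfolding e by (rule quotientI)
      then obtain a where "a \<in> A" "S `` {g a} = S `` {b}" by auto
      then show "\<exists>a\<in>A. (g a, b) \<in> S" using eq_equiv_class[OF _ S b] by blast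
    qed
  next
    assume s: "\<forall>b\<in>B. \<exists>a\<in>A. (g a, b) \<in> S"
    show "(\<lambda>x. S `` {g x}) ` A = B // S"
    proof (intro equalityI subsetI)
      fix K assume "K \<in> (\<lambda>x. S `` {g x}) ` A" then show "K \<in> B // S" using g by (auto intro: quotientI)
    next
      fix K assume "K \<in> B // S"
      then obtain b where b: "b \<in> B" "K = S `` {b}" by (auto simp: quotient_def)
      then obtain a where "a \<in> A" "(g a, b) \<in> S" using s by auto
      then show "K \<in> (\<lambda>x. S `` {g x}) ` A" using equiv_class_eq[OF S] b by auto
    qed
  qed
  ultimately show ?thesis unfolding bij_betw_def inj by simp
qed

definition edge_rel :: "'a sset \<Rightarrow> ('a \<times> 'a) set" where
  "edge_rel A = {(face A 1 1 e, face A 1 0 e) | e. e \<in> cells A 1}"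

lemma edge_relI: "e \<in> cells A 1 \<Longrightarrow> face A 1 1 e = x \<Longrightarrow> face A 1 0 e = y \<Longrightarrow> (x, y) \<in> edge_rel A"
  unfolding edge_rel_def by blast

lemma pi0_rel_edge: "pi0_rel A = (edge_rel A \<union> (edge_rel A)\<inverse>)\<^sup>* \<inter> (cells A 0 \<times> cells A 0)"
  by (simp add: pi0_rel_def edge_rel_def Let_def)

lemma pi0_equiv: "equiv (cells A 0) (pi0_rel A)"
proof -
  have "sym ((edge_rel A \<union> (edge_rel A)\<inverse>)\<^sup>*)" by (intro sym_rtrancl sym_Un_converse)
  moreover have "trans ((edge_rel A \<union> (edge_rel A)\<inverse>)\<^sup>*)" by (rule trans_rtrancl)
  moreover have "sym (cells A 0 \<times> cells A 0)" "trans (cells A 0 \<times> cells A 0)" by (auto simp: sym_def trans_def)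
  ultimately show ?thesis unfolding pi0_rel_edge
    by (intro equivI sym_Int trans_Int) (auto simp: refl_on_def)
qed

lemma smap_edge: "smap E B f \<Longrightarrow> (x, y) \<in> edge_rel E \<Longrightarrow> (f 0 x, f 0 y) \<in> edge_rel B"
  unfolding edge_rel_def using smap_d[of E B f _ 0] smap_in[of E B f _ 1] by fastforce

lemma smap_pi0: 
  assumes "smap E B f" "(x, y) \<in> pi0_rel E" shows "(f 0 x, f 0 y) \<in> pi0_rel B"
proof -
  have "(x, y) \<in> (edge_rel E \<union> (edge_rel E)\<inverse>)\<^sup>*" using assms unfolding pi0_rel_edge by auto
  then have "(f 0 x, f 0 y) \<in> (edge_rel B \<union> (edge_rel B)\<inverse>)\<^sup>*"
    by induction (auto dest!: smap_edge[OF assms(1)] intro: rtrancl_into_rtrancl)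
  then show ?thesis using assms smap_in[OF assms(1)] unfolding pi0_rel_edge by auto
qed

lemma pi_relI:
  assumes "x \<in> spheres (Suc p) A a" "y \<in> spheres (Suc p) A a" "z \<in> cells A (Suc (Suc p))"
    "face A (Suc (Suc p)) (Suc p) z = x" "face A (Suc (Suc p)) (Suc (Suc p)) z = y"
    "\<And>i. i < Suc p \<Longrightarrow> face A (Suc (Suc p)) i z = const_simplex A a (Suc p)"
  shows "(x, y) \<in> pi_rel (Suc p) A a"
  using assms unfolding pi_rel_def by blast

context ss begin

lemma edge_refl: assumes "x \<in> cells A 0" shows "(x, x) \<in> edge_rel A"
proof -
  have "face A 1 1 (deg A 0 0 x) = x" "face A 1 0 (deg A 0 0 x) = x" using face_deg_eq[of x 0 _ 0] assms by auto
  moreover have "deg A 0 0 x \<in> cells A 1" using deg_in[of 0 0 x] assms by simp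
  ultimately show ?thesis unfolding edge_rel_def by force
qed

lemma edge_cells: "(x, y) \<in> edge_rel A \<Longrightarrow> x \<in> cells A 0 \<and> y \<in> cells A 0"
  unfolding edge_rel_def using face_in[of _ 0] by auto

text \<open>The two edges out of \<open>x\<close> form a horn missing face 0, and that face of a
  filler joins \<open>y\<close> to \<open>w\<close>. With reflexivity this one property yields
  symmetry and transitivity together.\<close>

lemma edge_euclid:
  assumes K: "kan_complex A" and "(x, y) \<in> edge_rel A" "(x, w) \<in> edge_rel A"
  shows "(y, w) \<in> edge_rel A"
proof -
  obtain e e' where e: "e \<in> cells A 1" "x = face A 1 1 e" "y = face A 1 0 e"
    and e': "e' \<in> cells A 1" "x = face A 1 1 e'" "w = face A 1 0 e'" using assms(2,3) unfolding edge_rel_def by auto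
  have "compat A 1 ({..Suc 1} - {0}) (\<lambda>i. if i = 2 then e else e')"
    by (rule compatI) (use e e' in \<open>auto simp: numeral_2_eq_2 le_Suc_eq\<close>)
  then obtain t where t: "t \<in> cells A 2" "\<And>i. i \<le> 2 \<Longrightarrow> i \<noteq> 0 \<Longrightarrow> face A 2 i t = (if i = 2 then e else e')"
    using kan_complexD[OF K, of 1 0] by (auto simp: numeral_2_eq_2)
  have "face A 1 1 (face A 2 0 t) = y" using face_face[of t 0 0 2] t e by (auto simp: numeral_2_eq_2)
  moreover have "face A 1 0 (face A 2 0 t) = w" using face_face[of t 0 0 1] t e' by (auto simp: numeral_2_eq_2)
  moreover have "face A 2 0 t \<in> cells A 1" using face_in[of 0 1 t] t by (auto simp: numeral_2_eq_2)
  ultimately show ?thesis unfolding edge_rel_def by blast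
qed

lemma pi0_kan: 
  assumes K: "kan_complex A" shows "pi0_rel A = edge_rel A"
proof -
  have sy: "(y, x) \<in> edge_rel A" if "(x, y) \<in> edge_rel A" for x y
    using edge_euclid[OF K that edge_refl] edge_cells[OF that] by auto
  have tr: "(x, w) \<in> edge_rel A" if "(x, y) \<in> edge_rel A" "(y, w) \<in> edge_rel A" for x y w
    using edge_euclid[OF K sy[OF that(1)] that(2)] .
  have "(x, y) \<in> edge_rel A" if "(x, y) \<in> (edge_rel A \<union> (edge_rel A)\<inverse>)\<^sup>*" "x \<in> cells A 0" for x y
    using that by (induction) (auto intro: edge_refl tr sy)
  then show ?thesis unfolding pi0_rel_edge using edge_cells by (auto; blast)
qed

lemma sphere_htpy:
  assumes x: "x \<in> spheres (Suc p) A a" and a: "a \<in> cells A 0"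
  shows "htpy_faces A (Suc p) x y i = (if i < Suc p then const_simplex A a (Suc p) else if i = Suc p then x else y)"
  using x deg_const[OF a, of p p] by (auto simp: htpy_faces_def spheres_def)

lemma pi_refl: "x \<in> spheres (Suc p) A a \<Longrightarrow> a \<in> cells A 0 \<Longrightarrow> (x, x) \<in> pi_rel (Suc p) A a"
proof -
  assume x: "x \<in> spheres (Suc p) A a" and a: "a \<in> cells A 0"
  let ?z = "deg A (Suc p) (Suc p) x"
  have xc: "x \<in> cells A (Suc p)" using x by (auto simp: spheres_def)
  have "face A (Suc (Suc p)) i ?z = htpy_faces A (Suc p) x x i" if "i \<le> Suc (Suc p)" for i
    using htpy_faces_deg[OF xc that] by simp
  then show ?thesis using deg_in[OF order.refl xc] sphere_htpy[OF x a] by (intro pi_relI[OF x x, of ?z]) auto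
qed

text \<open>The argument of \<open>edge_euclid\<close> in higher dimension: \<open>z\<close> and
  \<open>z'\<close> share the face \<open>x\<close>, constant simplices complete a horn missing its
  last face, and that face of a filler is a homotopy from \<open>y\<close> to
  \<open>w\<close>.\<close>

lemma pi_euclid:
  assumes K: "kan_complex A" and a: "a \<in> cells A 0" and xy: "(x, y) \<in> pi_rel (Suc p) A a" and xw: "(x, w) \<in> pi_rel (Suc p) A a"
  shows "(y, w) \<in> pi_rel (Suc p) A a"
proof -
  let ?c = "const_simplex A a"
  obtain z where z: "z \<in> cells A (Suc (Suc p))" "face A (Suc (Suc p)) (Suc p) z = x" "face A (Suc (Suc p)) (Suc (Suc p)) z = y"
    "\<And>i. i < Suc p \<Longrightarrow> face A (Suc (Suc p)) i z = ?c (Suc p)" and sp: "x \<in> spheres (Suc p) A a" "y \<in> spheres (Suc p) A a"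
    using xy unfolding pi_rel_def by auto
  obtain z' where z': "z' \<in> cells A (Suc (Suc p))" "face A (Suc (Suc p)) (Suc p) z' = x" "face A (Suc (Suc p)) (Suc (Suc p)) z' = w"
    "\<And>i. i < Suc p \<Longrightarrow> face A (Suc (Suc p)) i z' = ?c (Suc p)" and sw: "w \<in> spheres (Suc p) A a"
    using xw unfolding pi_rel_def by auto
  define T where "T i = (if i < Suc p then ?c (Suc (Suc p)) else if i = Suc p then z else z')" for i
  have "compat A (Suc (Suc p)) ({..Suc (Suc (Suc p))} - {Suc (Suc (Suc p))}) T"
  proof (rule compatI)
    fix i show "T i \<in> cells A (Suc (Suc p))" using z(1) z'(1) const_in[OF a] by (auto simp: T_def)
  next
    fix i j assume ij: "i \<in> {..Suc (Suc (Suc p))} - {Suc (Suc (Suc p))}" "j \<in> {..Suc (Suc (Suc p))} - {Suc (Suc (Suc p))}" "i < j"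
    then consider "i < Suc p" | "i = Suc p" "j = Suc (Suc p)" by fastforce
    then show "face A (Suc (Suc p)) i (T j) = face A (Suc (Suc p)) (j - 1) (T i)"
    proof cases
      case 1
      then show ?thesis using ij z(4) z'(4) face_const[OF a, of _ "Suc p"] by (auto simp: T_def)
    next
      case 2
      then show ?thesis using z z' by (simp add: T_def)
    qed
  qed
  then obtain t where t: "t \<in> cells A (Suc (Suc (Suc p)))" "\<And>i. i \<le> Suc (Suc p) \<Longrightarrow> face A (Suc (Suc (Suc p))) i t = T i"
    using kan_complexD[OF K _ order.refl] by (metis le_Suc_eq Suc_n_not_le_n)
  let ?u = "face A (Suc (Suc (Suc p))) (Suc (Suc (Suc p))) t"
  have u: "face A (Suc (Suc p)) i ?u = face A (Suc (Suc p)) (Suc (Suc p)) (T i)" if "i \<le> Suc (Suc p)" for i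
    using face_face[OF t(1), of i "Suc (Suc (Suc p))"] t(2) that by auto
  have "face A (Suc (Suc p)) i ?u = ?c (Suc p)" if "i < Suc p" for i
    using u[of i] that face_const[OF a] by (simp add: T_def)
  moreover have "face A (Suc (Suc p)) (Suc p) ?u = y" "face A (Suc (Suc p)) (Suc (Suc p)) ?u = w"
    using u[of "Suc p"] u[of "Suc (Suc p)"] z z' by (auto simp: T_def)
  moreover have "?u \<in> cells A (Suc (Suc p))" using face_in[OF _ t(1)] by simp
  ultimately show ?thesis by (intro pi_relI[OF sp(2) sw, of ?u])
qed

lemma pi_equiv:
  assumes K: "kan_complex A" and a: "a \<in> cells A 0"
  shows "equiv (spheres (Suc p) A a) (pi_rel (Suc p) A a)"
proof (rule equivI)
  show "pi_rel (Suc p) A a \<subseteq> spheres (Suc p) A a \<times> spheres (Suc p) A a" unfolding pi_rel_def by auto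
  show "refl_on (spheres (Suc p) A a) (pi_rel (Suc p) A a)"
    using pi_refl[OF _ a] by (auto simp: refl_on_def)
  have sy: "(y, x) \<in> pi_rel (Suc p) A a" if "(x, y) \<in> pi_rel (Suc p) A a" for x y
    by (rule pi_euclid[OF K a that pi_refl[OF _ a]]) (use that in \<open>auto simp: pi_rel_def\<close>)
  then show "sym (pi_rel (Suc p) A a)" by (auto simp: sym_def)
  show "trans (pi_rel (Suc p) A a)" using pi_euclid[OF K a sy] unfolding trans_def by blast
qed

end

lemma smap_sphere: 
  assumes f: "smap E B f" and a: "a \<in> cells E 0" and x: "x \<in> spheres (Suc p) E a"
  shows "f (Suc p) x \<in> spheres (Suc p) B (f 0 a)"
  using smap_in[OF f] x smap_d[OF f, of _ p x, symmetric] smap_c[OF f a] unfolding spheres_def by auto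

lemma smap_pi:
  assumes f: "smap E B f" and a: "a \<in> cells E 0" and xy: "(x, y) \<in> pi_rel (Suc p) E a"
  shows "(f (Suc p) x, f (Suc p) y) \<in> pi_rel (Suc p) B (f 0 a)"
proof -
  obtain z where z: "z \<in> cells E (Suc (Suc p))" "face E (Suc (Suc p)) (Suc p) z = x" "face E (Suc (Suc p)) (Suc (Suc p)) z = y"
    "\<And>i. i < Suc p \<Longrightarrow> face E (Suc (Suc p)) i z = const_simplex E a (Suc p)" and sp: "x \<in> spheres (Suc p) E a" "y \<in> spheres (Suc p) E a"
    using xy unfolding pi_rel_def by auto
  have "face B (Suc (Suc p)) i (f (Suc (Suc p)) z) = f (Suc p) (face E (Suc (Suc p)) i z)" if "i \<le> Suc (Suc p)" for i
    using smap_d[OF f that z(1)] by simp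
  then show ?thesis using z smap_c[OF f a]
    by (intro pi_relI[OF smap_sphere[OF f a sp(1)] smap_sphere[OF f a sp(2)] smap_in[OF f z(1)]]) auto
qed

text \<open>For Kan complexes the relations on vertices and on spheres are already equivalences
  witnessed by single simplices, so a weak equivalence becomes a list of statements about individual
  edges and homotopies.\<close>

lemma whe_iff:
  assumes f: "smap E B f" and E: "ss E" "kan_complex E" and B: "ss B" "kan_complex B"
  shows "weak_homotopy_equivalence E B f \<longleftrightarrow> f \<in> sset_hom E B \<and>
    (\<forall>x\<in>cells E 0. \<forall>y\<in>cells E 0. (f 0 x, f 0 y) \<in> edge_rel B \<longrightarrow> (x, y) \<in> edge_rel E) \<and>
    (\<forall>b\<in>cells B 0. \<exists>x\<in>cells E 0. (f 0 x, b) \<in> edge_rel B) \<and>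
    (\<forall>p. \<forall>a\<in>cells E 0.
      (\<forall>x\<in>spheres (Suc p) E a. \<forall>y\<in>spheres (Suc p) E a.
        (f (Suc p) x, f (Suc p) y) \<in> pi_rel (Suc p) B (f 0 a) \<longrightarrow> (x, y) \<in> pi_rel (Suc p) E a) \<and>
      (\<forall>b\<in>spheres (Suc p) B (f 0 a). \<exists>x\<in>spheres (Suc p) E a. (f (Suc p) x, b) \<in> pi_rel (Suc p) B (f 0 a)))"
proof -
  have 0: "bij_betw (\<lambda>K. pi0_rel B `` (f 0 ` K)) (pi0 E) (pi0 B) \<longleftrightarrow> 
     (\<forall>x\<in>cells E 0. \<forall>y\<in>cells E 0. (f 0 x, f 0 y) \<in> edge_rel B \<longrightarrow> (x, y) \<in> edge_rel E) \<and>
     (\<forall>b\<in>cells B 0. \<exists>x\<in>cells E 0. (f 0 x, b) \<in> edge_rel B)"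
    using bij_betw_quotients_iff[of "cells E 0" "pi0_rel E" "cells B 0" "pi0_rel B" "f 0",
        OF pi0_equiv pi0_equiv smap_in[OF f] smap_pi0[OF f]]
    unfolding pi0_def ss.pi0_kan[OF E] ss.pi0_kan[OF B] .
  have n: "bij_betw (\<lambda>K. pi_rel (Suc p) B (f 0 a) `` (f (Suc p) ` K)) (pi_n (Suc p) E a) (pi_n (Suc p) B (f 0 a)) \<longleftrightarrow>
     (\<forall>x\<in>spheres (Suc p) E a. \<forall>y\<in>spheres (Suc p) E a.
        (f (Suc p) x, f (Suc p) y) \<in> pi_rel (Suc p) B (f 0 a) \<longrightarrow> (x, y) \<in> pi_rel (Suc p) E a) \<and>
      (\<forall>b\<in>spheres (Suc p) B (f 0 a). \<exists>x\<in>spheres (Suc p) E a. (f (Suc p) x, b) \<in> pi_rel (Suc p) B (f 0 a))"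
    if a: "a \<in> cells E 0" for p a
    unfolding pi_n_def
    by (rule bij_betw_quotients_iff[OF ss.pi_equiv[OF E a] ss.pi_equiv[OF B smap_in[OF f a]] smap_sphere[OF f a] smap_pi[OF f a]])
  have split: "(\<forall>n\<ge>1. P n) \<longleftrightarrow> (\<forall>p. P (Suc p))" for P :: "nat \<Rightarrow> bool"
    by (metis One_nat_def Suc_le_D le_add1 plus_1_eq_Suc)
  show ?thesis unfolding weak_homotopy_equivalence_def split 0 using n by (simp cong: ball_cong)
qed

text \<open>Subtraction of the class of \<open>y\<close> from \<open>z\<close> without a group
  structure: the simplices \<open>y\<close> and \<open>z\<close> fill positions \<open>p\<close> and
  \<open>Suc p\<close> of a horn, and lifting it over \<open>h\<close> gives \<open>u\<close> in the
  last position. Its boundary is that of \<open>z\<close>, while its image is dictated by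
  \<open>h\<close>; a suitable \<open>h\<close> makes this image constant.\<close>

lemma sphere_subtract:
  assumes f: "kan_fib E B f" and E: "ss E" and a: "a \<in> cells E 0"
    and y: "y \<in> spheres (Suc p) E a"
    and z: "z \<in> cells E (Suc p)" "\<And>i. i \<le> p \<Longrightarrow> face E (Suc p) i z = const_simplex E a p"
    and h: "h \<in> cells B (Suc (Suc p))" "\<And>i. i < p \<Longrightarrow> face B (Suc (Suc p)) i h = const_simplex B (f 0 a) (Suc p)"
      "face B (Suc (Suc p)) p h = f (Suc p) y" "face B (Suc (Suc p)) (Suc p) h = f (Suc p) z"
  obtains u where "u \<in> cells E (Suc p)" "f (Suc p) u = face B (Suc (Suc p)) (Suc (Suc p)) h"
    "face E (Suc p) (Suc p) u = face E (Suc p) (Suc p) z" "\<And>i. i \<le> p \<Longrightarrow> face E (Suc p) i u = const_simplex E a p"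
proof -
  let ?c = "const_simplex E a"
  have sf: "smap E B f" using f by (rule kan_fib_smap)
  have yc: "y \<in> cells E (Suc p)" "\<And>i. i \<le> Suc p \<Longrightarrow> face E (Suc p) i y = ?c p" using y by (auto simp: spheres_def)
  define T where "T i = (if i < p then ?c (Suc p) else if i = p then y else z)" for i
  have T: "compat E (Suc p) ({..Suc (Suc p)} - {Suc (Suc p)}) T"
  proof (rule compatI)
    fix i show "T i \<in> cells E (Suc p)" using z(1) yc(1) ss.const_in[OF E a] by (auto simp: T_def)
  next
    fix i j assume ij: "i \<in> {..Suc (Suc p)} - {Suc (Suc p)}" "j \<in> {..Suc (Suc p)} - {Suc (Suc p)}" "i < j"
    then consider "i < p" | "i = p" "j = Suc p" by fastforce
    then show "face E (Suc p) i (T j) = face E (Suc p) (j - 1) (T i)"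
    proof cases
      case 1
      then show ?thesis using ij z(2) yc(2) ss.face_const[OF E a, of _ "p"] by (auto simp: T_def)
    next
      case 2
      then show ?thesis using yc z by (simp add: T_def)
    qed
  qed
  obtain t where t: "t \<in> cells E (Suc (Suc p))" "f (Suc (Suc p)) t = h" "\<And>i. i \<le> Suc (Suc p) \<Longrightarrow> i \<noteq> Suc (Suc p) \<Longrightarrow> face E (Suc (Suc p)) i t = T i"
  proof (rule kan_fibD[OF f T order.refl h(1)])
    fix i assume "i \<le> Suc (Suc p)" "i \<noteq> Suc (Suc p)"
    then consider "i < p" | "i = p" | "i = Suc p" by linarith
    then show "f (Suc p) (T i) = face B (Suc (Suc p)) i h"
      using h smap_c[OF sf a] by cases (auto simp: T_def)
  qed auto
  let ?u = "face E (Suc (Suc p)) (Suc (Suc p)) t"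
  have u: "face E (Suc p) i ?u = face E (Suc p) (Suc p) (T i)" if "i \<le> Suc p" for i
    using ss.face_face[OF E t(1), of i "Suc (Suc p)"] t(3) that by auto
  show thesis
  proof (rule that)
    show "?u \<in> cells E (Suc p)" using ss.face_in[OF E _ t(1)] by simp
    show "f (Suc p) ?u = face B (Suc (Suc p)) (Suc (Suc p)) h" using smap_d[OF sf _ t(1)] t(2) by simp
    show "face E (Suc p) (Suc p) ?u = face E (Suc p) (Suc p) z" using u[of "Suc p"] by (simp add: T_def)
    show "face E (Suc p) i ?u = ?c p" if "i \<le> p" for i 
      using u[of i] that yc(2)[of "Suc p"] ss.face_const[OF E a, of "Suc p" p] by (auto simp: T_def)
  qed
qed

text \<open>An exact-sequence argument reduced to spheres in a fibre. Such a sphere \<open>x\<close>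
  bounds some \<open>z\<close> in \<open>E\<close> by injectivity; the image of \<open>z\<close> is
  a sphere in \<open>B\<close>, which by surjectivity is homotopic to the image of a sphere
  \<open>y\<close>; subtracting \<open>y\<close> moves \<open>z\<close> into the fibre without
  changing its boundary.\<close>

theorem whe_kan_fib_acyclic_fib:
  assumes W: "weak_homotopy_equivalence E B f" and f: "kan_fib E B f" and E: "ss E" and B: "ss B" "kan_complex B"
  shows "acyclic_fib E B f"
proof -
  have sf: "smap E B f" using f by (rule kan_fib_smap)
  have KE: "kan_complex E" using kan_complex_kan_fib[OF f B(2) E] .
  note W = W[unfolded whe_iff[OF sf E KE B]]
  have inj0: "(x, y) \<in> edge_rel E" if "x\<in>cells E 0" "y\<in>cells E 0" "(f 0 x, f 0 y) \<in> edge_rel B" for x y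
    using W that by blast
  have sur0: "\<exists>x\<in>cells E 0. (f 0 x, b) \<in> edge_rel B" if "b \<in> cells B 0" for b using W that by blast
  have inj: "(x, y) \<in> pi_rel (Suc p) E a" if "a\<in>cells E 0" "x\<in>spheres (Suc p) E a" "y\<in>spheres (Suc p) E a"
        "(f (Suc p) x, f (Suc p) y) \<in> pi_rel (Suc p) B (f 0 a)" for x y p a using W that by blast
  have sur: "\<exists>x\<in>spheres (Suc p) E a. (f (Suc p) x, b) \<in> pi_rel (Suc p) B (f 0 a)"
    if "a\<in>cells E 0" "b \<in> spheres (Suc p) B (f 0 a)" for b p a using W that by blast
  have "surj_vertices E B f" unfolding surj_vertices_def
  proof
    fix b assume "b \<in> cells B 0"
    then obtain e l where e: "e \<in> cells E 0" "l \<in> cells B 1" "face B 1 1 l = f 0 e" "face B 1 0 l = b"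
      using sur0 unfolding edge_rel_def by force
    have "compat E 0 ({..Suc 0} - {0}) (\<lambda>_. e)" by (rule compatI) (use e in auto)
    then obtain t where t: "t \<in> cells E 1" "f 1 t = l"
      unfolding One_nat_def by (rule kan_fibD[OF f, of 0 0 "\<lambda>_. e" l]) (use e in \<open>auto simp: le_Suc_eq\<close>)
    have "f 0 (face E 1 0 t) = b" using smap_d[OF sf, of 0 0 t] t e by simp
    then show "\<exists>e\<in>cells E 0. f 0 e = b" using ss.face_in[OF E, of 0 0 t] t by auto
  qed
  moreover have "spheres_null E B f p" for p unfolding spheres_null_def
  proof (intro ballI impI)
    fix a x assume a: "a \<in> cells E 0" and x: "x \<in> cells E p" and bd: "0 < p \<longrightarrow> (\<forall>i\<le>p. face E p i x = const_simplex E a (p - 1))"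
      and fx: "f p x = const_simplex B (f 0 a) p"
    let ?c = "const_simplex E a" and ?b = "const_simplex B (f 0 a)"
    have fa: "f 0 a \<in> cells B 0" using smap_in[OF sf a] .
    obtain z where z: "z \<in> cells E (Suc p)" "\<And>i. i \<le> p \<Longrightarrow> face E (Suc p) i z = ?c p" "face E (Suc p) (Suc p) z = x"
    proof (cases p)
      case 0
      have "(x, a) \<in> edge_rel E" using inj0[of x a] x a fx ss.const_0[OF B(1) fa] ss.edge_refl[OF B(1) fa] 0 by auto
      then show thesis using that 0 ss.const_0[OF E a] unfolding edge_rel_def by auto
    next
      case (Suc r)
      have "x \<in> spheres (Suc r) E a" "?c p \<in> spheres (Suc r) E a" using x bd Suc ss.const_in[OF E a] ss.face_const[OF E a] by (auto simp: spheres_def)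
      moreover have "?b p \<in> spheres (Suc r) B (f 0 a)" using Suc ss.const_in[OF B(1) fa] ss.face_const[OF B(1) fa] by (auto simp: spheres_def)
      ultimately have "(?c p, x) \<in> pi_rel (Suc r) E a"
        using inj[OF a, of "?c p" r x] fx smap_c[OF sf a] ss.pi_refl[OF B(1) _ fa] Suc by auto
      then obtain z where z: "z \<in> cells E (Suc p)" "face E (Suc p) (Suc p) z = x" "face E (Suc p) p z = ?c p"
         "\<And>i. i < p \<Longrightarrow> face E (Suc p) i z = ?c p" unfolding pi_rel_def Suc by auto
      show thesis by (rule that[OF z(1) _ z(2)]) (use z(3,4) in \<open>auto simp: le_less\<close>)
    qed
    let ?P = "f (Suc p) z"
    have "?P \<in> spheres (Suc p) B (f 0 a)"
      using smap_in[OF sf z(1)] smap_d[OF sf _ z(1), symmetric] z(2,3) fx smap_c[OF sf a] unfolding spheres_def by (auto simp: le_Suc_eq)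
    then obtain y where y: "y \<in> spheres (Suc p) E a" "(f (Suc p) y, ?P) \<in> pi_rel (Suc p) B (f 0 a)" using sur[OF a] by blast
    let ?Q = "f (Suc p) y"
    have "(?P, ?Q) \<in> pi_rel (Suc p) B (f 0 a)" using y(2) ss.pi_equiv[OF B fa] by (meson equivE symD)
    then obtain h where h: "h \<in> cells B (Suc (Suc p))" "face B (Suc (Suc p)) (Suc p) h = ?P" "face B (Suc (Suc p)) (Suc (Suc p)) h = ?Q"
      "\<And>i. i \<le> p \<Longrightarrow> face B (Suc (Suc p)) i h = ?b (Suc p)" and sQ: "?Q \<in> spheres (Suc p) B (f 0 a)"
      unfolding pi_rel_def by auto
    have Q: "?Q \<in> cells B (Suc p)" "\<And>i. i \<le> Suc p \<Longrightarrow> face B (Suc p) i ?Q = ?b p" using sQ by (auto simp: spheres_def)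
    let ?s1 = "deg B (Suc p) (Suc p) ?Q" and ?s0 = "deg B (Suc p) p ?Q"
    have s1: "?s1 \<in> cells B (Suc (Suc p))" "\<And>i. i \<le> p \<Longrightarrow> face B (Suc (Suc p)) i ?s1 = ?b (Suc p)"
      "face B (Suc (Suc p)) (Suc p) ?s1 = ?Q" "face B (Suc (Suc p)) (Suc (Suc p)) ?s1 = ?Q"
      using ss.deg_in[OF B(1) _ Q(1)] ss.face_deg_lt[OF B(1) Q(1)] Q(2) ss.deg_const[OF B(1) fa, of p p] ss.face_deg_eq[OF B(1) Q(1)] by auto
    have s0: "?s0 \<in> cells B (Suc (Suc p))" "face B (Suc (Suc p)) p ?s0 = ?Q"
      "face B (Suc (Suc p)) (Suc p) ?s0 = ?Q" "face B (Suc (Suc p)) (Suc (Suc p)) ?s0 = ?b (Suc p)"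
      using ss.deg_in[OF B(1) _ Q(1)] ss.face_deg_eq[OF B(1) Q(1)] ss.face_deg_gt[OF B(1) Q(1)] Q(2) ss.deg_const[OF B(1) fa, of p p] by auto
    have s0': "face B (Suc (Suc p)) i ?s0 = ?b (Suc p)" if "i < p" for i
      using that ss.face_deg_lt[OF B(1) Q(1) that] Q(2) ss.deg_const[OF B(1) fa, of "p - 1" p] by auto
    \<comment> \<open>The relation between \<open>?P\<close> and \<open>?Q\<close> supplies
      \<open>h\<close> with these as its last two faces, whereas \<open>sphere_subtract\<close>
      wants them in positions \<open>Suc p\<close> and \<open>p\<close> with a constant last face.
      This horn makes the exchange.\<close>
    define T where "T i = (if i < p then ?b (Suc (Suc p)) else if i = p then ?s1 else if i = Suc p then h else ?s0)" for i
    have "compat B (Suc (Suc p)) ({..Suc (Suc (Suc p))} - {Suc (Suc p)}) T"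
    proof (rule compatI)
      fix i show "T i \<in> cells B (Suc (Suc p))" using s1(1) s0(1) h(1) ss.const_in[OF B(1) fa] by (auto simp: T_def)
    next
      fix i j assume ij: "i \<in> {..Suc (Suc (Suc p))} - {Suc (Suc p)}" "j \<in> {..Suc (Suc (Suc p))} - {Suc (Suc p)}" "i < j"
      then consider "i < p" | "i = p" "j = Suc p" | "i = p" "j = Suc (Suc (Suc p))" | "i = Suc p" "j = Suc (Suc (Suc p))" by fastforce
      then show "face B (Suc (Suc p)) i (T j) = face B (Suc (Suc p)) (j - 1) (T i)"
      proof cases
        case 1
        have jl: "j - 1 \<le> Suc (Suc p)" using ij by auto
        have "face B (Suc (Suc p)) (j - 1) (T i) = ?b (Suc p)" using 1 jl ss.face_const[OF B(1) fa, of "j - 1" "Suc p"] by (simp add: T_def)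
        moreover have "face B (Suc (Suc p)) i (T j) = ?b (Suc p)"
          using 1 ij h(4)[of i] s1(2)[of i] s0'[OF 1] ss.face_const[OF B(1) fa, of i "Suc p"] by (simp add: T_def)
        ultimately show ?thesis by simp
      qed (use s1 s0 h in \<open>simp_all add: T_def\<close>)
    qed
    then obtain t where t: "t \<in> cells B (Suc (Suc (Suc p)))" 
      "\<And>i. i \<le> Suc (Suc (Suc p)) \<Longrightarrow> i \<noteq> Suc (Suc p) \<Longrightarrow> face B (Suc (Suc (Suc p))) i t = T i"
      by (rule kan_complexD[OF B(2)]) auto
    let ?h = "face B (Suc (Suc (Suc p))) (Suc (Suc p)) t"
    have hf: "face B (Suc (Suc p)) i ?h = face B (Suc (Suc p)) (Suc p) (T i)" if "i < Suc (Suc p)" for i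
      using ss.face_face[OF B(1) t(1), of i "Suc (Suc p)"] t(2) that by auto
    have hl: "face B (Suc (Suc p)) (Suc (Suc p)) ?h = ?b (Suc p)"
      using ss.face_face[OF B(1) t(1), of "Suc (Suc p)" "Suc (Suc (Suc p))"] t(2)[of "Suc (Suc (Suc p))"] s0 by (simp add: T_def)
    obtain u where u: "u \<in> cells E (Suc p)" "f (Suc p) u = face B (Suc (Suc p)) (Suc (Suc p)) ?h"
    "face E (Suc p) (Suc p) u = face E (Suc p) (Suc p) z" "\<And>i. i \<le> p \<Longrightarrow> face E (Suc p) i u = ?c p"
    proof (rule sphere_subtract[OF f E a y(1) z(1,2)])
      show "?h \<in> cells B (Suc (Suc p))" using ss.face_in[OF B(1) _ t(1)] by simp
      show "face B (Suc (Suc p)) i ?h = ?b (Suc p)" if "i < p" for i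
        using hf[of i] that ss.face_const[OF B(1) fa, of "Suc p" "Suc p"] by (simp add: T_def)
      show "face B (Suc (Suc p)) p ?h = ?Q" using hf[of p] s1 by (simp add: T_def)
      show "face B (Suc (Suc p)) (Suc p) ?h = ?P" using hf[of "Suc p"] h by (simp add: T_def)
    qed auto
    then show "\<exists>z\<in>cells E (Suc p). f (Suc p) z = ?b (Suc p) \<and> face E (Suc p) (Suc p) z = x \<and>
        (\<forall>i\<le>p. face E (Suc p) i z = ?c p)" using hl z(3) by auto
  qed
  ultimately show ?thesis using acyclic_fib_if_spheres_null[OF f _ _ E B(1)] by blast
qed

text \<open>Each clause of \<open>whe_iff\<close> is one lifting problem: an edge or homotopy in
  \<open>B\<close> lifts with prescribed ends, and a sphere in \<open>B\<close> lifts with constant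
  boundary.\<close>

theorem acyclic_fib_whe:
  assumes f: "acyclic_fib E B f" and h: "f \<in> sset_hom E B" and E: "ss E" "kan_complex E" and B: "ss B" "kan_complex B"
  shows "weak_homotopy_equivalence E B f"
proof -
  have sf: "smap E B f" using f by (rule acyclic_fib_smap)
  show ?thesis unfolding whe_iff[OF sf E B]
  proof (intro conjI ballI allI impI)
    fix x y assume xy: "x \<in> cells E 0" "y \<in> cells E 0" "(f 0 x, f 0 y) \<in> edge_rel B"
    then obtain l where l: "l \<in> cells B 1" "face B 1 1 l = f 0 x" "face B 1 0 l = f 0 y" unfolding edge_rel_def by auto
    have "compat E 0 {..Suc 0} (\<lambda>i. if i = 0 then y else x)" by (rule compatI) (use xy in auto)
    then obtain t where t: "t \<in> cells E (Suc 0)" "\<And>i. i \<le> Suc 0 \<Longrightarrow> face E (Suc 0) i t = (if i = 0 then y else x)"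
      by (rule acyclic_fibD[OF f, of 0 _ l]) (use l in \<open>auto simp: le_Suc_eq\<close>)
    then show "(x, y) \<in> edge_rel E" using t(2)[of 0] t(2)[of 1] by (intro edge_relI[of t]) auto
  next
    fix b assume b: "b \<in> cells B 0"
    then show "\<exists>x\<in>cells E 0. (f 0 x, b) \<in> edge_rel B" using surj_verticesD[OF acyclic_fib_surj_vertices[OF f] b] ss.edge_refl[OF B(1) b] by auto
  next
    fix p a x y assume a: "a \<in> cells E 0" and xy: "x \<in> spheres (Suc p) E a" "y \<in> spheres (Suc p) E a"
        "(f (Suc p) x, f (Suc p) y) \<in> pi_rel (Suc p) B (f 0 a)"
    let ?T = "htpy_faces E (Suc p) x y"
    have xc: "x \<in> cells E (Suc p)" "y \<in> cells E (Suc p)" using xy by (auto simp: spheres_def)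
    obtain z where z: "z \<in> cells B (Suc (Suc p))" "face B (Suc (Suc p)) (Suc p) z = f (Suc p) x" "face B (Suc (Suc p)) (Suc (Suc p)) z = f (Suc p) y"
    "\<And>i. i < Suc p \<Longrightarrow> face B (Suc (Suc p)) i z = const_simplex B (f 0 a) (Suc p)" using xy(3) unfolding pi_rel_def by auto
    have T: "?T i = (if i < Suc p then const_simplex E a (Suc p) else if i = Suc p then x else y)" for i
      by (rule ss.sphere_htpy[OF E(1) xy(1) a])
    have "compat E (Suc p) {..Suc (Suc p)} ?T" 
      by (rule ss.compat_htpy_faces[OF E(1) xc]) (use xy in \<open>auto simp: spheres_def\<close>)
    then obtain t where t: "t \<in> cells E (Suc (Suc p))" "\<And>i. i \<le> Suc (Suc p) \<Longrightarrow> face E (Suc (Suc p)) i t = ?T i"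
    proof (rule acyclic_fibD[OF f _ z(1)])
      fix i assume "i \<le> Suc (Suc p)"
      then consider "i < Suc p" | "i = Suc p" | "i = Suc (Suc p)" by linarith
      then show "f (Suc p) (?T i) = face B (Suc (Suc p)) i z" unfolding T using z smap_c[OF sf a] by cases auto
    qed auto
    then show "(x, y) \<in> pi_rel (Suc p) E a" using T by (intro pi_relI[OF xy(1,2) t(1)]) auto
  next
    fix p a b assume a: "a \<in> cells E 0" and b: "b \<in> spheres (Suc p) B (f 0 a)"
    have "compat E p {..Suc p} (\<lambda>_. const_simplex E a p)"
      by (rule compatI) (use ss.const_in[OF E(1) a] ss.face_const[OF E(1) a, of _ "p - 1"] in auto)
    then obtain t where t: "t \<in> cells E (Suc p)" "f (Suc p) t = b" "\<And>i. i \<le> Suc p \<Longrightarrow> face E (Suc p) i t = const_simplex E a p"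
      by (rule acyclic_fibD[OF f, of p _ b]) (use b smap_c[OF sf a] in \<open>auto simp: spheres_def\<close>)
    then show "\<exists>x\<in>spheres (Suc p) E a. (f (Suc p) x, b) \<in> pi_rel (Suc p) B (f 0 a)"
      using ss.pi_refl[OF B(1) b smap_in[OF sf a]] by (auto simp: spheres_def intro!: bexI[of _ t])
  qed (rule h)
qed

section \<open>Sections of acyclic fibrations\<close>

text \<open>An omitted value splits off a coface, a repeated value splits off a codegeneracy, and
  otherwise the list is the identity. This trichotomy takes the place of the full epi-mono
  factorisation: each splitting lowers \<open>m + n\<close>, which is what the induction in
  \<open>smapI\<close> consumes.\<close>

lemma op_cases:
  assumes "\<theta> \<in> ops m n"
  obtains "m = n" "\<theta> = idop n"
  | n' i \<theta>' where "n = Suc n'" "i \<le> n" "\<theta>' \<in> ops m n'" "\<theta> = ocomp (coface n i) \<theta>'"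
  | m' i \<theta>' where "m = Suc m'" "i \<le> m'" "\<theta>' \<in> ops m' n" "\<theta> = ocomp \<theta>' (codeg m' i)"
proof -
  note th = opsD[OF assms]
  consider (a) i where "i \<le> n" "i \<notin> set \<theta>" | (b) i where "i < m" "\<theta> ! i = \<theta> ! Suc i"
    | (c) "set \<theta> = {..n}" "\<And>i. i < m \<Longrightarrow> \<theta> ! i \<noteq> \<theta> ! Suc i"
    using th(3) by blast
  then show thesis
  proof cases
    case a
    have "n \<noteq> 0" using a th(1,3) by (cases \<theta>) auto
    then obtain n' where n: "n = Suc n'" by (cases n) auto
    let ?g = "\<lambda>j. if j < i then j else j - 1"
    have e: "map ?g \<theta> \<in> ops m n'"
      using th(1,2,3) a n unfolding ops_def sorted_iff_nth_mono by fastforce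
    have "ocomp (coface n i) (map ?g \<theta>) = map (\<lambda>j. up i (?g j)) \<theta>"
      using ocomp_mk_left[OF e, of "up i"] a n by (simp add: coface_mk o_def)
    also have "\<dots> = \<theta>"
    proof (rule map_idI)
      fix j assume "j \<in> set \<theta>" then have "j \<noteq> i" using a(2) by auto
      then show "up i (?g j) = j" by (auto simp: up_def)
    qed
    finally show thesis using that(2)[OF n a(1) e] by simp
  next
    case b
    then obtain m' where m: "m = Suc m'" by (cases m) auto
    have e: "ocomp \<theta> (coface (Suc m') i) \<in> ops m' n" by (rule ocomp_ops[OF _ coface_ops]) (use assms m b in auto)
    have "\<theta> ! (up i (dn i j)) = \<theta> ! j" for j
      using b by (cases "j = Suc i") (auto simp: up_def dn_def)
    then have "op_of m (\<lambda>j. \<theta> ! up i (dn i j)) = \<theta>" using ops_mk[OF assms] by simp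
    moreover have "ocomp \<theta> (coface (Suc m') i) = op_of m' (\<lambda>j. \<theta> ! up i j)"
      using b m by (simp add: coface_mk ocomp_def op_of_def)
    ultimately have "ocomp (ocomp \<theta> (coface (Suc m') i)) (codeg m' i) = \<theta>"
      using b m ocomp_mk[of m "dn i" m' "\<lambda>j. \<theta> ! up i j"] by (simp add: codeg_def dn_le)
    then show thesis using that(3)[OF m _ e, of i] b m by simp
  next
    case c
    have "distinct \<theta>"
    proof -
      have "sorted_wrt (<) \<theta>" unfolding sorted_wrt_iff_nth_Suc_transp[OF transp_on_less]
        using c(2) th(1,2) by (auto simp: less_le sorted_iff_nth_Suc)
      then show ?thesis by (simp add: strict_sorted_iff)
    qed
    then have "\<theta> = idop n" using th(2) c(1)
      by (intro sorted_distinct_set_unique) (auto simp: idop_def simp del: upt_Suc)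
    then show thesis using that(1) th(1) by simp
  qed
qed

lemma smapI:
  assumes E: "ss E" and B: "ss B"
    and i: "\<And>n x. x \<in> cells E n \<Longrightarrow> f n x \<in> cells B n"
    and d: "\<And>n x i. x \<in> cells E (Suc n) \<Longrightarrow> i \<le> Suc n \<Longrightarrow> f n (face E (Suc n) i x) = face B (Suc n) i (f (Suc n) x)"
    and s: "\<And>n x i. x \<in> cells E n \<Longrightarrow> i \<le> n \<Longrightarrow> f (Suc n) (deg E n i x) = deg B n i (f n x)"
  shows "smap E B f"
proof -
  have "f m (act E n \<theta> x) = act B n \<theta> (f n x)" if "\<theta> \<in> ops m n" "x \<in> cells E n" for m n \<theta> x
    using that
  proof (induction "m + n" arbitrary: m n \<theta> x rule: less_induct)
    case less
    from less(2) show ?case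
    proof (cases rule: op_cases)
      case 1
      then show ?thesis using less(3) ss.act_id[OF E] ss.act_id[OF B] i by simp
    next
      case (2 n' j \<theta>')
      have x: "x \<in> cells E (Suc n')" "coface (Suc n') j \<in> ops n' (Suc n')" using less(3) 2 coface_ops by auto
      have "act E n \<theta> x = act E n' \<theta>' (face E (Suc n') j x)"
        unfolding face_def using ss.act_act[OF E 2(3) x(2,1)] 2 by simp
      moreover have "act B n \<theta> (f n x) = act B n' \<theta>' (face B (Suc n') j (f (Suc n') x))"
        unfolding face_def using ss.act_act[OF B 2(3) x(2) i[OF x(1)]] 2 by simp
      ultimately show ?thesis using less(1)[OF _ 2(3) ss.face_in[OF E _ x(1)]] d[OF x(1)] 2 by simp
    next
      case (3 m' j \<theta>')
      have c: "codeg m' j \<in> ops (Suc m') m'" using 3 codeg_ops by auto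
      have "act E n \<theta> x = deg E m' j (act E n \<theta>' x)"
        unfolding deg_def using ss.act_act[OF E c 3(3) less(3)] 3 by simp
      moreover have "act B n \<theta> (f n x) = deg B m' j (act B n \<theta>' (f n x))"
        unfolding deg_def using ss.act_act[OF B c 3(3) i[OF less(3)]] 3 by simp
      ultimately show ?thesis using less(1)[OF _ 3(3) less(3)] s[OF ss.act_in[OF E 3(3) less(3)], of j] 3 by simp
    qed
  qed
  then show ?thesis using i unfolding smap_def by blast
qed

definition partial_section :: "'a sset \<Rightarrow> 'b sset \<Rightarrow> (nat \<Rightarrow> 'a \<Rightarrow> 'b) \<Rightarrow> nat \<Rightarrow> (nat \<Rightarrow> 'b \<Rightarrow> 'a) \<Rightarrow> bool" where
  "partial_section E B f n g \<longleftrightarrow>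
     (\<forall>k\<le>n. \<forall>b\<in>cells B k. g k b \<in> cells E k \<and> f k (g k b) = b) \<and>
     (\<forall>k<n. \<forall>b\<in>cells B (Suc k). \<forall>i\<le>Suc k. face E (Suc k) i (g (Suc k) b) = g k (face B (Suc k) i b)) \<and>
     (\<forall>k<n. \<forall>b\<in>cells B k. \<forall>i\<le>k. g (Suc k) (deg B k i b) = deg E k i (g k b))"

lemma partial_section_cong:
  "\<lbrakk>partial_section E B f n g; \<And>k. k \<le> n \<Longrightarrow> g' k = g k\<rbrakk> \<Longrightarrow> partial_section E B f n g'"
  unfolding partial_section_def by simp

text \<open>Over a degenerate simplex the section is forced, and it is well defined because
  $s_ic=s_jc'$ with $i<j$ implies $c=s_{j-1}u$ and $c'=s_iu$ for a common $u$.\<close>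

lemma partial_section_extend:
  assumes f: "acyclic_fib E B f" and E: "ss E" and B: "ss B" and g: "partial_section E B f n g"
  obtains g' where "partial_section E B f (Suc n) g'" "\<And>k. k \<le> n \<Longrightarrow> g' k = g k"
proof -
  have sf: "smap E B f" using f by (rule acyclic_fib_smap)
  have g_in: "g k b \<in> cells E k" and fg: "f k (g k b) = b" if "k \<le> n" "b \<in> cells B k" for k b
    using g that unfolding partial_section_def by auto
  have gd: "face E (Suc k) i (g (Suc k) b) = g k (face B (Suc k) i b)" if "k < n" "b\<in>cells B (Suc k)" "i\<le>Suc k" for k b i
    using g that unfolding partial_section_def by auto
  have gs: "g (Suc k) (deg B k i b) = deg E k i (g k b)" if "k < n" "b\<in>cells B k" "i\<le>k" for k b i
    using g that unfolding partial_section_def by auto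
  have wd: "deg E n i (g n c) = deg E n j (g n c')"
    if c: "c \<in> cells B n" "c' \<in> cells B n" "i < j" "j \<le> n" "deg B n i c = deg B n j c'" for i j c c'
  proof -
    obtain m where n: "n = Suc m" using c by (cases n) auto
    have cm: "c \<in> cells B (Suc m)" "c' \<in> cells B (Suc m)" using c n by auto
    let ?u = "face B (Suc m) i c'"
    have u: "?u \<in> cells B m" using ss.face_in[OF B _ cm(2), of i] c n by simp
    have "c = face B (Suc n) i (deg B n i c)" using ss.face_deg_eq[OF B c(1), of i i] c by simp
    also have "\<dots> = deg B m (j - 1) ?u" unfolding c(5) n using ss.face_deg_lt[OF B cm(2) c(3)] c n by simp
    finally have c1: "c = deg B m (j - 1) ?u" .
    have "c' = face B (Suc n) (Suc j) (deg B n j c')" using ss.face_deg_eq[OF B c(2), of "Suc j" j] c by simp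
    also have "\<dots> = deg B m i (face B (Suc m) j c)" unfolding c(5)[symmetric] n using ss.face_deg_gt[OF B cm(1), of i "Suc j"] c n by simp
    also have "face B (Suc m) j c = ?u" using ss.face_deg_eq[OF B u, of j "j - 1"] c1 c n by simp
    finally have c2: "c' = deg B m i ?u" .
    have "g n c = deg E m (j - 1) (g m ?u)" using gs[of m ?u "j - 1"] u c c1 n by simp
    moreover have "g n c' = deg E m i (g m ?u)" using gs[of m ?u i] u c c2 n by simp
    ultimately show ?thesis using ss.deg_deg[OF E g_in[of m ?u], of i "j - 1"] u c n by simp
  qed
  have "\<exists>e\<in>cells E (Suc n). f (Suc n) e = b \<and> (\<forall>i\<le>Suc n. face E (Suc n) i e = g n (face B (Suc n) i b)) \<and>
      (\<forall>c\<in>cells B n. \<forall>i\<le>n. b = deg B n i c \<longrightarrow> e = deg E n i (g n c))" if b: "b \<in> cells B (Suc n)" for b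
  proof (cases "\<exists>c\<in>cells B n. \<exists>i\<le>n. b = deg B n i c")
    case True
    then obtain c i where c: "c \<in> cells B n" "i \<le> n" "b = deg B n i c" by auto
    let ?e = "deg E n i (g n c)"
    have gc: "g n c \<in> cells E n" using g_in c by auto
    have e: "?e \<in> cells E (Suc n)" using ss.deg_in[OF E c(2) gc] .
    have fe: "f (Suc n) ?e = b" using smap_s[OF sf c(2) gc] fg c by simp
    have "face E (Suc n) k ?e = g n (face B (Suc n) k b)" if k: "k \<le> Suc n" for k
    proof (cases "k = i \<or> k = Suc i")
      case True
      then show ?thesis using ss.face_deg_eq[OF E gc True c(2)] ss.face_deg_eq[OF B c(1) True c(2)] c by simp
    next
      case False
      then obtain m where n: "n = Suc m" using k c by (cases n) auto
      have cm: "c \<in> cells B (Suc m)" "g n c \<in> cells E (Suc m)" using c n gc by auto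
      show ?thesis
      proof (cases "k < i")
        case True
        have "face E (Suc n) k ?e = deg E m (i - 1) (face E n k (g n c))" using ss.face_deg_lt[OF E cm(2) True] c n by simp
        also have "\<dots> = g n (deg B m (i - 1) (face B n k c))"
          using gd[of m c k] gs[of m "face B n k c" "i - 1"] ss.face_in[OF B _ cm(1), of k] cm n c True by simp
        also have "deg B m (i - 1) (face B n k c) = face B (Suc n) k b" using ss.face_deg_lt[OF B cm(1) True] c n by simp
        finally show ?thesis .
      next
        case F: False
        have ki: "Suc i < k" using F False by auto
        have "face E (Suc n) k ?e = deg E m i (face E n (k - 1) (g n c))" using ss.face_deg_gt[OF E cm(2) ki] k n by simp
        also have "\<dots> = g n (deg B m i (face B n (k - 1) c))"
          using gd[of m c "k - 1"] gs[of m "face B n (k - 1) c" i] ss.face_in[OF B _ cm(1), of "k - 1"] cm n c ki k by simp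
        also have "deg B m i (face B n (k - 1) c) = face B (Suc n) k b" using ss.face_deg_gt[OF B cm(1) ki] c n k by simp
        finally show ?thesis .
      qed
    qed
    moreover have "?e = deg E n j (g n c')" if c': "c' \<in> cells B n" "j \<le> n" "b = deg B n j c'" for j c'
    proof -
      consider "i < j" | "j < i" | "i = j" by linarith
      then show ?thesis
      proof cases
        case 3
        have "c = face B (Suc n) i b" "c' = face B (Suc n) i b" 
          using ss.face_deg_eq[OF B c(1), of i i] ss.face_deg_eq[OF B c'(1), of i i] c c' 3 by auto
        then show ?thesis using 3 by simp
      qed (use wd[of c c' i j] wd[of c' c j i] c c' in auto)
    qed
    ultimately show ?thesis using e fe by blast
  next
    case False
    have "compat E n {..Suc n} (\<lambda>i. g n (face B (Suc n) i b))"
    proof (rule compatI)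
      fix i assume "i \<in> {..Suc n}" then show "g n (face B (Suc n) i b) \<in> cells E n" using g_in ss.face_in[OF B _ b] by simp
    next
      fix i j assume ij: "i \<in> {..Suc n}" "j \<in> {..Suc n}" "i < j" "0 < n"
      then obtain m where n: "n = Suc m" by (cases n) auto
      have bm: "b \<in> cells B (Suc (Suc m))" using b n by simp
      show "face E n i (g n (face B (Suc n) j b)) = face E n (j - 1) (g n (face B (Suc n) i b))"
        using gd[of m "face B (Suc n) j b" i] gd[of m "face B (Suc n) i b" "j - 1"] ss.face_in[OF B _ bm, of j] ss.face_in[OF B _ bm, of i]
          ss.face_face[OF B bm ij(3)] ij n by simp
    qed
    then obtain e where "e \<in> cells E (Suc n)" "f (Suc n) e = b" "\<And>i. i \<le> Suc n \<Longrightarrow> face E (Suc n) i e = g n (face B (Suc n) i b)"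
      by (rule acyclic_fibD[OF f _ b]) (use fg ss.face_in[OF B _ b] in auto)
    then show ?thesis using False by blast
  qed
  then obtain h where h: "\<And>b. b \<in> cells B (Suc n) \<Longrightarrow> h b\<in>cells E (Suc n) \<and> f (Suc n) (h b) = b \<and>
     (\<forall>i\<le>Suc n. face E (Suc n) i (h b) = g n (face B (Suc n) i b)) \<and>
      (\<forall>c\<in>cells B n. \<forall>i\<le>n. b = deg B n i c \<longrightarrow> h b = deg E n i (g n c))" by metis
  have "partial_section E B f (Suc n) (g(Suc n := h))" unfolding partial_section_def
  proof (intro conjI allI impI ballI)
    fix k b assume "k \<le> Suc n" "b \<in> cells B k"
    then show "(g(Suc n := h)) k b \<in> cells E k" "f k ((g(Suc n := h)) k b) = b" using h g_in fg by (auto simp: le_Suc_eq)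
  next
    fix k b i assume "k < Suc n" "b \<in> cells B (Suc k)" "i \<le> Suc k"
    then show "face E (Suc k) i ((g(Suc n := h)) (Suc k) b) = (g(Suc n := h)) k (face B (Suc k) i b)"
      using h gd by (auto simp: less_Suc_eq)
  next
    fix k b i assume "k < Suc n" "b \<in> cells B k" "i \<le> k"
    then show "(g(Suc n := h)) (Suc k) (deg B k i b) = deg E k i ((g(Suc n := h)) k b)"
      using h ss.deg_in[OF B] gs by (auto simp: less_Suc_eq)
  qed
  then show thesis by (rule that) auto
qed

text \<open>The choice in \<open>eta2\<close> is meaningful only once a section exists. It has to
  respect faces and degeneracies simultaneously, which is why it is built dimension by
  dimension.\<close>

theorem acyclic_fib_section:
  assumes f: "acyclic_fib E B f" and E: "ss E" and B: "ss B"
  obtains g where "g \<in> sset_hom B E" "\<And>n b. b \<in> cells B n \<Longrightarrow> f n (g n b) = b"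
proof -
  obtain h where "\<And>b. b \<in> cells B 0 \<Longrightarrow> h b \<in> cells E 0 \<and> f 0 (h b) = b"
    using f unfolding acyclic_fib_def surj_vertices_def by metis
  then have "partial_section E B f 0 (\<lambda>_. h)" unfolding partial_section_def by auto
  \<comment> \<open>Each extension leaves the lower levels unchanged, so the diagonal of the chosen
    sequence is a section in all dimensions.\<close>
  then have "\<exists>G. \<forall>n. partial_section E B f n (G n) \<and> (\<forall>k\<le>n. G (Suc n) k = G n k)"
    using partial_section_extend[OF f E B]
    by (intro dependent_nat_choice[where P="\<lambda>n g. partial_section E B f n g"]) metis+
  then obtain G where G: "\<And>n. partial_section E B f n (G n)" "\<And>n k. k \<le> n \<Longrightarrow> G (Suc n) k = G n k" by blast
  define g where "g n = G n n" for n
  have gG: "G n k = g k" if "k \<le> n" for n k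
    using that by (induction rule: dec_induct) (auto simp: g_def G(2))
  have ps: "partial_section E B f n g" for n by (rule partial_section_cong[OF G(1)[of n]]) (simp add: gG)
  have g_in: "g n b \<in> cells E n" "f n (g n b) = b" if "b \<in> cells B n" for n b
    using ps[of n] that unfolding partial_section_def by auto
  have sg: "smap B E g"
  proof (rule smapI[OF B E g_in(1)])
    fix n x i assume "x \<in> cells B (Suc n)" "i \<le> Suc n"
    then show "g n (face B (Suc n) i x) = face E (Suc n) i (g (Suc n) x)" 
      using ps[of "Suc n"] unfolding partial_section_def by simp
  next
    fix n x i assume "x \<in> cells B n" "i \<le> n"
    then show "g (Suc n) (deg B n i x) = deg E n i (g n x)"
      using ps[of "Suc n"] unfolding partial_section_def by simp
  qed
  let ?g = "\<lambda>n. restrict (g n) (cells B n)"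
  have "?g \<in> sset_hom B E" unfolding sset_hom_def using g_in smap_act[OF sg] ss.act_in[OF B] by auto
  then show thesis by (rule that) (simp add: g_in)
qed

section \<open>Kan fibrations in terms of faces\<close>

text \<open>Inverse to composition with the coface on simplices that avoid vertex \<open>i\<close>:
  it exhibits a simplex of a horn as a simplex of its i-th face.\<close>

definition omit :: "nat \<Rightarrow> nat list \<Rightarrow> nat list" where "omit i x = map (\<lambda>j. if j < i then j else j - 1) x"

lemma omit_ops: "x \<in> ops m (Suc n) \<Longrightarrow> i \<le> Suc n \<Longrightarrow> i \<notin> set x \<Longrightarrow> omit i x \<in> ops m n"
  unfolding ops_def omit_def sorted_iff_nth_mono by fastforce

lemma coface_omit: 
  assumes "x \<in> ops m (Suc n)" "i \<le> Suc n" "i \<notin> set x"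
  shows "ocomp (coface (Suc n) i) (omit i x) = x"
proof -
  have "ocomp (coface (Suc n) i) (omit i x) = map (\<lambda>j. up i (if j < i then j else j - 1)) x"
    using ocomp_mk_left[OF omit_ops[OF assms], of "up i"] assms by (simp add: coface_mk o_def omit_def)
  also have "\<dots> = x"
  proof (rule map_idI)
    fix j assume "j \<in> set x" then have "j \<noteq> i" using assms by auto
    then show "up i (if j < i then j else j - 1) = j" by (auto simp: up_def)
  qed
  finally show ?thesis .
qed

lemma omit_coface: "x \<in> ops m n \<Longrightarrow> i \<le> Suc n \<Longrightarrow> omit i (ocomp (coface (Suc n) i) x) = x"
proof -
  assume x: "x \<in> ops m n" and i: "i \<le> Suc n"
  have "ocomp (coface (Suc n) i) x = map (up i) x" using ocomp_mk_left[OF x, of "up i"] i by (simp add: coface_mk)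
  then show ?thesis unfolding omit_def by (auto simp: up_def intro!: map_idI)
qed

lemma omit_ocomp: "\<theta> \<in> ops l m \<Longrightarrow> x \<in> ops m n \<Longrightarrow> omit i (ocomp x \<theta>) = ocomp (omit i x) \<theta>"
  by (auto simp: omit_def ocomp_def ops_def)

lemma omit_omit: "i < j \<Longrightarrow> j \<notin> set x \<Longrightarrow> i \<notin> set x \<Longrightarrow> omit (j - 1) (omit i x) = omit i (omit j x)"
proof -
  assume a: "i < j" "j \<notin> set x" "i \<notin> set x"
  have "(if (if y < i then y else y - 1) < j - 1 then (if y < i then y else y - 1) else (if y < i then y else y - 1) - 1) =
      (if (if y < j then y else y - 1) < i then (if y < j then y else y - 1) else (if y < j then y else y - 1) - 1)"
    if "y \<in> set x" for y
  proof -
    have "y \<noteq> i" "y \<noteq> j" using that a by auto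
    then show ?thesis using a(1) by auto
  qed
  then show ?thesis unfolding omit_def by simp
qed

lemma omit_notin:
  assumes "i < j" "j \<notin> set x" "i \<notin> set x"
  shows "j - 1 \<notin> set (omit i x)" "i \<notin> set (omit j x)"
proof -
  have *: "(if y < i then y else y - 1) \<noteq> j - 1 \<and> (if y < j then y else y - 1) \<noteq> i" if "y \<in> set x" for y
  proof -
    have "y \<noteq> i" "y \<noteq> j" using that assms by auto
    then show ?thesis using assms(1) by auto
  qed
  show "j - 1 \<notin> set (omit i x)"
  proof
    assume "j - 1 \<in> set (omit i x)"
    then obtain y where "j - 1 = (if y < i then y else y - 1)" "y \<in> set x" unfolding omit_def set_map by (rule imageE)
    then show False using *[of y] by argo
  qed
  show "i \<notin> set (omit j x)"
  proof
    assume "i \<in> set (omit j x)"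
    then obtain y where "i = (if y < j then y else y - 1)" "y \<in> set x" unfolding omit_def set_map by (rule imageE)
    then show False using *[of y] by argo
  qed
qed

lemma ops_ocomp_set: "x \<in> ops m n \<Longrightarrow> \<theta> \<in> ops l m \<Longrightarrow> set (ocomp x \<theta>) \<subseteq> set x"
  using opsD[of x m n] opsD[of \<theta> l m] by (auto simp: ocomp_def intro!: nth_mem)

lemma cells_horn: "cells (horn n k) m = {x \<in> ops m n. \<exists>i\<in>{..n} - {k}. i \<notin> set x}"
  by (auto simp: horn_def simplex_def)
lemma act_horn [simp]: "act (horn n k) m \<theta> x = ocomp x \<theta>" by (simp add: horn_def simplex_def)
lemma cells_simplex [simp]: "cells (simplex n) m = ops m n" by (simp add: simplex_def)
lemma act_simplex [simp]: "act (simplex n) m \<theta> x = ocomp x \<theta>" by (simp add: simplex_def)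

text \<open>A simplex of the horn takes its value from any face that contains it. If two faces
  contain it, so does their intersection, where compatibility of the family makes both values equal;
  hence the choice of face is harmless.\<close>

lemma compat_horn_map:
  assumes E: "ss E" and k: "k \<le> Suc p" and w: "compat E p ({..Suc p} - {k}) w"
  obtains u where "u \<in> sset_hom (horn (Suc p) k) E"
    "\<And>m x i. x \<in> ops m (Suc p) \<Longrightarrow> i \<le> Suc p \<Longrightarrow> i \<noteq> k \<Longrightarrow> i \<notin> set x \<Longrightarrow> u m x = act E p (omit i x) (w i)"
proof -
  let ?I = "{..Suc p} - {k}"
  have wd: "act E p (omit i x) (w i) = act E p (omit j x) (w j)"
    if x: "x \<in> ops m (Suc p)" and i: "i \<in> ?I" "i \<notin> set x" and j: "j \<in> ?I" "j \<notin> set x" and ij: "i < j" for x m i j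
  proof -
    have "p \<noteq> 0" using i j ij k by auto
    then obtain q where p: "p = Suc q" by (cases p) auto
    have xi: "omit i x \<in> ops m (Suc q)" and xj: "omit j x \<in> ops m (Suc q)" using omit_ops[OF x] i j p by auto
    have "j - 1 \<notin> set (omit i x)" "i \<notin> set (omit j x)" using omit_notin[OF ij j(2) i(2)] .
    note om = omit_ops[OF xi _ this(1)] coface_omit[OF xi _ this(1)] omit_ops[OF xj _ this(2)] coface_omit[OF xj _ this(2)]
    have wi: "w i \<in> cells E (Suc q)" "w j \<in> cells E (Suc q)" using compat_in[OF w] i j p by auto
    have "act E p (omit i x) (w i) = act E q (omit (j - 1) (omit i x)) (face E p (j - 1) (w i))"
      unfolding face_def p using ss.act_act[OF E om(1) coface_ops wi(1)] om(2) i j ij p by auto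
    also have "\<dots> = act E q (omit i (omit j x)) (face E p i (w j))"
      using omit_omit[OF ij j(2) i(2)] compat_eq[of E q ?I w i j] w i j ij p by simp
    also have "\<dots> = act E p (omit j x) (w j)"
      unfolding face_def p using ss.act_act[OF E om(3) coface_ops wi(2)] om(4) i j ij p by auto
    finally show ?thesis .
  qed
  define ch where "ch x = (SOME i. i \<in> ?I \<and> i \<notin> set x)" for x
  define u where "u m = (\<lambda>x\<in>cells (horn (Suc p) k) m. act E p (omit (ch x) x) (w (ch x)))" for m
  have ch: "ch x \<in> ?I \<and> ch x \<notin> set x" if "x \<in> cells (horn (Suc p) k) m" for x m
  proof -
    have "\<exists>i. i \<in> ?I \<and> i \<notin> set x" using that by (auto simp: cells_horn)
    then show ?thesis unfolding ch_def by (rule someI_ex)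
  qed
  have u: "u m x = act E p (omit i x) (w i)" if x: "x \<in> ops m (Suc p)" and i: "i \<in> ?I" "i \<notin> set x" for m x i
  proof -
    have h: "x \<in> cells (horn (Suc p) k) m" using x i by (auto simp: cells_horn)
    have c: "ch x \<in> ?I" "ch x \<notin> set x" using ch[OF h] by blast+
    have "act E p (omit (ch x) x) (w (ch x)) = act E p (omit i x) (w i)"
    proof (cases "ch x" i rule: linorder_cases)
      case less then show ?thesis by (rule wd[OF x c i])
    next
      case greater then show ?thesis by (rule wd[OF x i c, symmetric])
    qed simp
    then show ?thesis using h unfolding u_def by simp
  qed
  have "u \<in> sset_hom (horn (Suc p) k) E" unfolding sset_hom_def
  proof (intro CollectI conjI allI ballI)
    fix n show "u n \<in> cells (horn (Suc p) k) n \<rightarrow>\<^sub>E cells E n"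
    proof (rule PiE_I)
      fix x assume x: "x \<in> cells (horn (Suc p) k) n"
      then have xo: "x \<in> ops n (Suc p)" by (auto simp: cells_horn)
      note c = ch[OF x]
      have "omit (ch x) x \<in> ops n p" using omit_ops[OF xo] c by auto
      then have "act E p (omit (ch x) x) (w (ch x)) \<in> cells E n" using c by (intro ss.act_in[OF E] compat_in[OF w]) auto
      then show "u n x \<in> cells E n" using u[OF xo, of "ch x"] c by simp
    qed (simp add: u_def)
  next
    fix m n \<theta> x assume th: "\<theta> \<in> ops m n" and x: "x \<in> cells (horn (Suc p) k) n"
    then have xo: "x \<in> ops n (Suc p)" by (auto simp: cells_horn)
    note c = ch[OF x]
    have om: "omit (ch x) x \<in> ops n p" using omit_ops[OF xo] c by auto
    have "u m (ocomp x \<theta>) = act E p (omit (ch x) (ocomp x \<theta>)) (w (ch x))"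
      using u[OF ocomp_ops[OF xo th]] c ops_ocomp_set[OF xo th] by blast
    also have "\<dots> = act E n \<theta> (act E p (omit (ch x) x) (w (ch x)))"
      using c omit_ocomp[OF th xo] ss.act_act[OF E th om compat_in[OF w]] by simp
    also have "act E p (omit (ch x) x) (w (ch x)) = u n x" using u[OF xo, of "ch x"] c by simp
    finally show "u m (act (horn (Suc p) k) n \<theta> x) = act E n \<theta> (u n x)" by simp
  qed
  then show thesis by (rule that) (use u in auto)
qed

lemma simplex_map: 
  assumes B: "ss B" and v: "v \<in> cells B n"
  shows "(\<lambda>m. \<lambda>x\<in>ops m n. act B n x v) \<in> sset_hom (simplex n) B"
  unfolding sset_hom_def
proof (intro CollectI conjI allI ballI)
  fix m show "(\<lambda>x\<in>ops m n. act B n x v) \<in> cells (simplex n) m \<rightarrow>\<^sub>E cells B m"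
    using ss.act_in[OF B _ v] by (auto simp: PiE_iff)
next
  fix m l \<theta> x assume th: "\<theta> \<in> ops m l" and "x \<in> cells (simplex n) l"
  then have x: "x \<in> ops l n" by simp
  show "(\<lambda>x\<in>ops m n. act B n x v) (act (simplex n) l \<theta> x) = act B l \<theta> ((\<lambda>x\<in>ops l n. act B n x v) x)"
    using x ocomp_ops[OF x th] ss.act_act[OF B th x v] by simp
qed

text \<open>This leaves maps out of horns behind: from here on a horn is a compatible family of
  faces.\<close>

lemma kan_fibration_kan_fib:
  assumes f: "kan_fibration E B f" and E: "ss E" and B: "ss B"
  shows "kan_fib E B f"
proof -
  have sf: "smap E B f" by (rule sset_hom_smap[OF conjunct1[OF f[unfolded kan_fibration_def]]])
  have lifts: "\<exists>w\<in>sset_hom (simplex n) E. (\<forall>m. \<forall>x\<in>cells (horn n k) m. w m x = u m x) \<and>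
       (\<forall>m. \<forall>x\<in>cells (simplex n) m. f m (w m x) = v m x)"
    if "1 \<le> n" "k \<le> n" "u \<in> sset_hom (horn n k) E" "v \<in> sset_hom (simplex n) B"
      "\<forall>m. \<forall>x\<in>cells (horn n k) m. f m (u m x) = v m x" for n k u v
    by (rule conjunct2[OF f[unfolded kan_fibration_def], THEN spec[of _ n], THEN spec[of _ k], THEN mp, OF that(1),
      THEN mp, OF that(2), THEN bspec, OF that(3), THEN bspec, OF that(4), THEN mp, OF that(5)])
  have "lift E B f p ({..Suc p} - {k})" if k: "k \<le> Suc p" for p k
  proof (rule liftI)
    let ?I = "{..Suc p} - {k}"
    fix w v assume w: "compat E p ?I w" and v: "v \<in> cells B (Suc p)" and fw: "\<And>i. i \<in> ?I \<Longrightarrow> f p (w i) = face B (Suc p) i v"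
    obtain u where u: "u \<in> sset_hom (horn (Suc p) k) E"
       "\<And>m x i. x \<in> ops m (Suc p) \<Longrightarrow> i \<le> Suc p \<Longrightarrow> i \<noteq> k \<Longrightarrow> i \<notin> set x \<Longrightarrow> u m x = act E p (omit i x) (w i)"
      by (rule compat_horn_map[OF E k w]) auto
    let ?v = "\<lambda>m. \<lambda>x\<in>ops m (Suc p). act B (Suc p) x v"
    have "f m (u m x) = ?v m x" if x: "x \<in> cells (horn (Suc p) k) m" for m x
    proof -
      obtain i where i: "i \<in> ?I" "i \<notin> set x" and xo: "x \<in> ops m (Suc p)" using x by (auto simp: cells_horn)
      have om: "omit i x \<in> ops m p" using omit_ops[OF xo] i by auto
      have "f m (u m x) = act B p (omit i x) (face B (Suc p) i v)"
        using u(2)[OF xo, of i] i smap_act[OF sf om] compat_in[OF w i(1)] fw[OF i(1)] by auto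
      also have "\<dots> = act B (Suc p) x v" unfolding face_def
        using ss.act_act[OF B om coface_ops v, of i] coface_omit[OF xo, of i] i by auto
      finally show ?thesis using xo by simp
    qed
    then have "\<exists>g\<in>sset_hom (simplex (Suc p)) E. (\<forall>m. \<forall>x\<in>cells (horn (Suc p) k) m. g m x = u m x) \<and>
       (\<forall>m. \<forall>x\<in>cells (simplex (Suc p)) m. f m (g m x) = ?v m x)"
      by (intro lifts[OF _ k u(1) simplex_map[OF B v]]) auto
    then obtain g where g: "g \<in> sset_hom (simplex (Suc p)) E" 
      "\<And>m x. x \<in> cells (horn (Suc p) k) m \<Longrightarrow> g m x = u m x"
      "\<And>m x. x \<in> ops m (Suc p) \<Longrightarrow> f m (g m x) = ?v m x"
      unfolding cells_simplex by blast
    have sg: "smap (simplex (Suc p)) E g" using g(1) by (rule sset_hom_smap)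
    \<comment> \<open>By Yoneda, the map \<open>g\<close> out of the simplex is its value on the
      identity operator.\<close>
    let ?e = "g (Suc p) (idop (Suc p))"
    have "?e \<in> cells E (Suc p)" using smap_in[OF sg] by simp
    moreover have "f (Suc p) ?e = v" using g(3)[of "idop (Suc p)" "Suc p"] ss.act_id[OF B v] by simp
    moreover have "face E (Suc p) i ?e = w i" if i: "i \<in> ?I" for i
    proof -
      have c: "coface (Suc p) i \<in> ops p (Suc p)" "i \<notin> set (coface (Suc p) i)" using i coface_ops[of i p] by (auto simp: coface_def simp del: upt_Suc)
      have "face E (Suc p) i ?e = g p (coface (Suc p) i)"
        unfolding face_def using smap_act[OF sg c(1), of "idop (Suc p)"] c(1) by simp
      also have "\<dots> = u p (coface (Suc p) i)" using c i by (intro g(2)) (auto simp: cells_horn)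
      also have "\<dots> = act E p (omit i (coface (Suc p) i)) (w i)" using c i by (intro u(2)) auto
      also have "omit i (coface (Suc p) i) = idop p"
        using omit_coface[of "idop p" p p i] i c opsD(1)[OF c(1)] by simp
      finally show ?thesis using ss.act_id[OF E compat_in[OF w i]] by simp
    qed
    ultimately show "\<exists>e\<in>cells E (Suc p). f (Suc p) e = v \<and> (\<forall>i\<in>?I. face E (Suc p) i e = w i)" by blast
  qed
  then show ?thesis unfolding kan_fib_def using sf by auto
qed

section \<open>Mapping out of complexes of index lists\<close>

definition hact :: "'a bisset \<Rightarrow> nat \<Rightarrow> nat \<Rightarrow> nat list \<Rightarrow> 'a \<Rightarrow> 'a" where
  "hact X n m \<theta> x = bact X n m \<theta> (idop m) x"
definition vact :: "'a bisset \<Rightarrow> nat \<Rightarrow> nat \<Rightarrow> nat list \<Rightarrow> 'a \<Rightarrow> 'a" where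
  "vact X n m \<phi> x = bact X n m (idop n) \<phi> x"

locale bss =
  fixes X :: "'a bisset"
  assumes bisimplicial: "bisimplicial_set X"
begin

lemma b_in: "\<theta> \<in> ops n' n \<Longrightarrow> \<phi> \<in> ops m' m \<Longrightarrow> x \<in> bcells X n m \<Longrightarrow> bact X n m \<theta> \<phi> x \<in> bcells X n' m'"
  by (rule bisimplicial[unfolded bisimplicial_set_def, THEN conjunct1, rule_format])

lemma b_id: "x \<in> bcells X n m \<Longrightarrow> bact X n m (idop n) (idop m) x = x"
  by (rule bisimplicial[unfolded bisimplicial_set_def, THEN conjunct2, THEN conjunct1, rule_format])

lemma b_b: "\<theta> \<in> ops n' n \<Longrightarrow> \<phi> \<in> ops m' m \<Longrightarrow> \<theta>' \<in> ops n'' n' \<Longrightarrow> \<phi>' \<in> ops m'' m' \<Longrightarrow> x \<in> bcells X n m \<Longrightarrow>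
   bact X n' m' \<theta>' \<phi>' (bact X n m \<theta> \<phi> x) = bact X n m (ocomp \<theta> \<theta>') (ocomp \<phi> \<phi>') x"
  by (rule bisimplicial[unfolded bisimplicial_set_def, THEN conjunct2, THEN conjunct2, rule_format])

lemma h_in: "\<theta> \<in> ops n' n \<Longrightarrow> x \<in> bcells X n m \<Longrightarrow> hact X n m \<theta> x \<in> bcells X n' m"
  unfolding hact_def by (rule b_in) auto
lemma v_in: "\<phi> \<in> ops m' m \<Longrightarrow> x \<in> bcells X n m \<Longrightarrow> vact X n m \<phi> x \<in> bcells X n m'"
  unfolding vact_def by (rule b_in) auto
lemma h_id: "x \<in> bcells X n m \<Longrightarrow> hact X n m (idop n) x = x" unfolding hact_def by (rule b_id)
lemma v_id: "x \<in> bcells X n m \<Longrightarrow> vact X n m (idop m) x = x" unfolding vact_def by (rule b_id)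
lemma h_h: "\<theta> \<in> ops n' n \<Longrightarrow> \<theta>' \<in> ops n'' n' \<Longrightarrow> x \<in> bcells X n m \<Longrightarrow> hact X n' m \<theta>' (hact X n m \<theta> x) = hact X n m (ocomp \<theta> \<theta>') x"
  unfolding hact_def using b_b[of \<theta> n' n "idop m" m m \<theta>' n'' "idop m" m x] by simp
lemma v_v: "\<phi> \<in> ops m' m \<Longrightarrow> \<phi>' \<in> ops m'' m' \<Longrightarrow> x \<in> bcells X n m \<Longrightarrow> vact X n m' \<phi>' (vact X n m \<phi> x) = vact X n m (ocomp \<phi> \<phi>') x"
  unfolding vact_def using b_b[of "idop n" n n \<phi> m' m "idop n" n \<phi>' m'' x] by simp
lemma b_vh: "\<theta> \<in> ops n' n \<Longrightarrow> \<phi> \<in> ops m' m \<Longrightarrow> x \<in> bcells X n m \<Longrightarrow> bact X n m \<theta> \<phi> x = vact X n' m \<phi> (hact X n m \<theta> x)"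
  unfolding vact_def hact_def using b_b[of \<theta> n' n "idop m" m m "idop n'" n' \<phi> m' x] by (simp add: opsD(1))
lemma b_hv: "\<theta> \<in> ops n' n \<Longrightarrow> \<phi> \<in> ops m' m \<Longrightarrow> x \<in> bcells X n m \<Longrightarrow> bact X n m \<theta> \<phi> x = hact X n m' \<theta> (vact X n m \<phi> x)"
  unfolding vact_def hact_def using b_b[of "idop n" n n \<phi> m' m \<theta> n' "idop m'" m' x] by (simp add: opsD(1))
lemma h_v: "\<theta> \<in> ops n' n \<Longrightarrow> \<phi> \<in> ops m' m \<Longrightarrow> x \<in> bcells X n m \<Longrightarrow> hact X n m' \<theta> (vact X n m \<phi> x) = vact X n' m \<phi> (hact X n m \<theta> x)"
  using b_vh b_hv by simp

end

text \<open>Dimension of the simplex with vertex list \<open>a\<close>.\<close>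

definition dm :: "nat list \<Rightarrow> nat" where "dm a = length a - 1"

lemma length_dm: "a \<noteq> [] \<Longrightarrow> length a = Suc (dm a)" by (cases a) (auto simp: dm_def)
lemma dm_ops: "a \<in> ops k n \<Longrightarrow> dm a = k" by (auto simp: dm_def ops_def)
lemma dm_ocomp: "\<theta> \<in> ops k n \<Longrightarrow> dm (ocomp a \<theta>) = k" by (auto simp: dm_def ops_def)

definition complex :: "nat list set \<Rightarrow> bool" where
  "complex A \<longleftrightarrow> (\<forall>a\<in>A. a \<noteq> [] \<and> sorted a) \<and> (\<forall>a\<in>A. \<forall>k. \<forall>\<theta>\<in>ops k (dm a). ocomp a \<theta> \<in> A)"

text \<open>A list is read as a simplex of $\Delta^\infty$, so that one ambient complex serves all dimensions.\<close>

definition cx :: "nat set set \<Rightarrow> nat list set" where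
  "cx F = {a. a \<noteq> [] \<and> sorted a \<and> (\<exists>S\<in>F. set a \<subseteq> S)}"

lemma complex_ne: "complex A \<Longrightarrow> a \<in> A \<Longrightarrow> a \<noteq> []" unfolding complex_def by blast
lemma complex_sorted: "complex A \<Longrightarrow> a \<in> A \<Longrightarrow> sorted a" unfolding complex_def by blast
lemma complex_ocomp: "complex A \<Longrightarrow> a \<in> A \<Longrightarrow> \<theta> \<in> ops k (dm a) \<Longrightarrow> ocomp a \<theta> \<in> A" unfolding complex_def by blast
lemma complexI:
  assumes "\<And>a. a \<in> A \<Longrightarrow> a \<noteq> []" "\<And>a. a \<in> A \<Longrightarrow> sorted a"
    "\<And>a k \<theta>. a \<in> A \<Longrightarrow> \<theta> \<in> ops k (dm a) \<Longrightarrow> ocomp a \<theta> \<in> A"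
  shows "complex A"
  unfolding complex_def using assms by simp
lemma complex_Un: "complex A \<Longrightarrow> complex B \<Longrightarrow> complex (A \<union> B)"
  by (rule complexI) (auto dest: complex_ne complex_sorted intro: complex_ocomp)
lemma complex_Int: "complex A \<Longrightarrow> complex B \<Longrightarrow> complex (A \<inter> B)"
  by (rule complexI) (auto dest: complex_ne complex_sorted intro: complex_ocomp)

lemma ocomp_sorted: 
  assumes "sorted a" "a \<noteq> []" "\<theta> \<in> ops k (dm a)" 
  shows "sorted (ocomp a \<theta>)" "ocomp a \<theta> \<noteq> []" "set (ocomp a \<theta>) \<subseteq> set a"
proof -
  have a: "a \<in> ops (dm a) (Max (set a))" using assms length_dm by (auto simp: ops_def)
  note o = ocomp_ops[OF a assms(3)]
  show "sorted (ocomp a \<theta>)" using opsD(2)[OF o] .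
  show "ocomp a \<theta> \<noteq> []" using opsD(5)[OF o] .
  show "set (ocomp a \<theta>) \<subseteq> set a" using ops_ocomp_set[OF a assms(3)] .
qed

lemma complex_cx [simp]: "complex (cx F)"
  unfolding complex_def
proof (intro conjI ballI allI)
  fix a k \<theta> assume a: "a \<in> cx F" and t: "\<theta> \<in> ops k (dm a)"
  then have "sorted a" "a \<noteq> []" by (auto simp: cx_def)
  from ocomp_sorted[OF this t] a show "ocomp a \<theta> \<in> cx F" unfolding cx_def by blast
qed (auto simp: cx_def)

lemma cx_Un: "cx (F \<union> G) = cx F \<union> cx G" unfolding cx_def by blast
lemma cx_empty [simp]: "cx {} = {}" unfolding cx_def by blast

text \<open>A position in \<open>a\<close> is fixed for each value, not for each entry of
  \<open>b\<close>. Since \<open>a\<close> is sorted, positions chosen this way are monotone in the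
  value, so they form an operator even when values repeat.\<close>

lemma sub_list:
  assumes a: "sorted a" "a \<noteq> []" and b: "b \<noteq> []" "sorted b" "set b \<subseteq> set a"
  obtains \<theta> where "\<theta> \<in> ops (dm b) (dm a)" "b = ocomp a \<theta>"
proof -
  define ix where "ix y = (LEAST i. i < length a \<and> a ! i = y)" for y
  have ix: "ix y < length a \<and> a ! ix y = y" if "y \<in> set a" for y
  proof -
    have "\<exists>i. i < length a \<and> a ! i = y" using that by (simp add: in_set_conv_nth)
    then show ?thesis unfolding ix_def by (rule LeastI_ex)
  qed
  have mono: "ix x \<le> ix y" if "x \<in> set a" "y \<in> set a" "x \<le> y" for x y
  proof (rule ccontr)
    assume "\<not> ix x \<le> ix y"
    then have "a ! ix y \<le> a ! ix x" using ix[OF that(1)] by (intro sorted_nth_mono[OF a(1)]) auto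
    then have "x = y" using ix that by simp
    then show False using \<open>\<not> ix x \<le> ix y\<close> by simp
  qed
  have "map ix b \<in> ops (dm b) (dm a)" unfolding ops_def
  proof (intro CollectI conjI)
    show "length (map ix b) = Suc (dm b)" using length_dm[OF b(1)] by simp
    show "sorted (map ix b)" unfolding sorted_map
      by (rule sorted_wrt_mono_rel[OF _ b(2)]) (use b(3) mono in auto)
    show "set (map ix b) \<subseteq> {..dm a}" using ix b(3) length_dm[OF a(2)] by fastforce
  qed
  moreover have "b = ocomp a (map ix b)" unfolding ocomp_def using ix b(3) by (auto intro!: map_idI[symmetric])
  ultimately show thesis by (rule that)
qed

lemma complex_closed:
  assumes "complex A" "a \<in> A" "b \<noteq> []" "sorted b" "set b \<subseteq> set a" shows "b \<in> A"
  by (rule sub_list[OF complex_sorted[OF assms(1,2)] complex_ne[OF assms(1,2)] assms(3-5)])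
    (use complex_ocomp[OF assms(1,2)] in blast)

text \<open>Since $(A\setminus X)_m=\mathrm{Hom}(A\Box\Delta^m,X)=\mathrm{Hom}(A,X_{\bullet m})$, an \<open>m\<close>-simplex of
  $A\setminus X$ is encoded as a horizontally natural function on \<open>A\<close>.\<close>

definition Mc :: "'a bisset \<Rightarrow> nat list set \<Rightarrow> (nat list \<Rightarrow> 'a) sset" where
  "Mc X A = \<lparr>cells = (\<lambda>m. {F \<in> extensional A. (\<forall>a\<in>A. F a \<in> bcells X (dm a) m) \<and>
       (\<forall>a\<in>A. \<forall>k. \<forall>\<theta>\<in>ops k (dm a). F (ocomp a \<theta>) = hact X (dm a) m \<theta> (F a))}),
     act = (\<lambda>m \<phi> F. \<lambda>a\<in>A. vact X (dm a) m \<phi> (F a))\<rparr>"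

definition res :: "nat list set \<Rightarrow> nat \<Rightarrow> (nat list \<Rightarrow> 'a) \<Rightarrow> nat list \<Rightarrow> 'a" where
  "res A m F = restrict F A"

lemma McI:
  assumes "F \<in> extensional A" "\<And>a. a \<in> A \<Longrightarrow> F a \<in> bcells X (dm a) m"
    "\<And>a k \<theta>. a \<in> A \<Longrightarrow> \<theta> \<in> ops k (dm a) \<Longrightarrow> F (ocomp a \<theta>) = hact X (dm a) m \<theta> (F a)"
  shows "F \<in> cells (Mc X A) m"
  using assms unfolding Mc_def by auto

lemma Mc_ext: "F \<in> cells (Mc X A) m \<Longrightarrow> F \<in> extensional A" unfolding Mc_def by simp
lemma Mc_in: "F \<in> cells (Mc X A) m \<Longrightarrow> a \<in> A \<Longrightarrow> F a \<in> bcells X (dm a) m" unfolding Mc_def by simp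
lemma Mc_nat: "F \<in> cells (Mc X A) m \<Longrightarrow> a \<in> A \<Longrightarrow> \<theta> \<in> ops k (dm a) \<Longrightarrow> F (ocomp a \<theta>) = hact X (dm a) m \<theta> (F a)"
  unfolding Mc_def by simp
lemma Mc_eqI: "F \<in> cells (Mc X A) m \<Longrightarrow> G \<in> cells (Mc X A) m \<Longrightarrow> (\<And>a. a \<in> A \<Longrightarrow> F a = G a) \<Longrightarrow> F = G"
  by (rule extensionalityI[OF Mc_ext Mc_ext])
lemma act_Mc: "act (Mc X A) m \<phi> F = (\<lambda>a\<in>A. vact X (dm a) m \<phi> (F a))" unfolding Mc_def by simp

context bss begin

lemma Mc_act_in:
  assumes A: "complex A" and p: "\<phi> \<in> ops m' m" and F: "F \<in> cells (Mc X A) m"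
  shows "act (Mc X A) m \<phi> F \<in> cells (Mc X A) m'"
proof (rule McI)
  show "act (Mc X A) m \<phi> F \<in> extensional A" unfolding act_Mc by simp
  show "act (Mc X A) m \<phi> F a \<in> bcells X (dm a) m'" if "a \<in> A" for a
    unfolding act_Mc using that v_in[OF p Mc_in[OF F that]] by simp
  show "act (Mc X A) m \<phi> F (ocomp a \<theta>) = hact X (dm a) m' \<theta> (act (Mc X A) m \<phi> F a)"
    if a: "a \<in> A" and t: "\<theta> \<in> ops k (dm a)" for a k \<theta>
    unfolding act_Mc using a complex_ocomp[OF A a t] Mc_nat[OF F a t] h_v[OF t p Mc_in[OF F a]] dm_ocomp[OF t] by simp
qed

lemma ss_Mc: 
  assumes A: "complex A" shows "ss (Mc X A)"
proof
  show "act (Mc X A) n \<theta> F \<in> cells (Mc X A) m" if "\<theta> \<in> ops m n" "F \<in> cells (Mc X A) n" for m n \<theta> F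
    using Mc_act_in[OF A that] .
  show "act (Mc X A) n (idop n) F = F" if F: "F \<in> cells (Mc X A) n" for n F
    by (rule Mc_eqI[OF Mc_act_in[OF A idop_ops F] F]) (simp add: act_Mc v_id[OF Mc_in[OF F]])
  show "act (Mc X A) m \<phi> (act (Mc X A) n \<theta> F) = act (Mc X A) n (ocomp \<theta> \<phi>) F"
    if "\<phi> \<in> ops l m" "\<theta> \<in> ops m n" and F: "F \<in> cells (Mc X A) n" for l m n \<phi> \<theta> F
    unfolding act_Mc using v_v[OF that(2,1) Mc_in[OF F]] by (auto simp: fun_eq_iff)
qed

lemma rs_in: "A \<subseteq> B \<Longrightarrow> complex A \<Longrightarrow> F \<in> cells (Mc X B) m \<Longrightarrow> res A m F \<in> cells (Mc X A) m"
  unfolding res_def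
  by (rule McI) (auto simp: Mc_in subset_iff complex_ocomp Mc_nat)

lemma smap_res: "A \<subseteq> B \<Longrightarrow> complex A \<Longrightarrow> smap (Mc X B) (Mc X A) (res A)"
  unfolding smap_def using rs_in[of A B] by (auto simp: act_Mc res_def fun_eq_iff)

lemma rs_rs: "A \<subseteq> B \<Longrightarrow> res A m (res B m F) = res A m F"
  unfolding res_def by (auto simp: fun_eq_iff)

lemma Mc_glue:
  assumes A: "complex A" and B: "complex B" and F: "F \<in> cells (Mc X A) m" and G: "G \<in> cells (Mc X B) m"
    and eq: "res (A \<inter> B) m F = res (A \<inter> B) m G"
  obtains K where "K \<in> cells (Mc X (A \<union> B)) m" "res A m K = F" "res B m K = G"
proof -
  have e: "F a = G a" if "a \<in> A" "a \<in> B" for a using fun_cong[OF eq, of a] that by (simp add: res_def)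
  define K where "K = (\<lambda>a\<in>A \<union> B. if a \<in> A then F a else G a)"
  have KA: "K a = F a" if "a \<in> A" for a using that by (simp add: K_def)
  have KB: "K a = G a" if "a \<in> B" for a using that e by (simp add: K_def)
  have "K \<in> cells (Mc X (A \<union> B)) m"
  proof (rule McI)
    show "K \<in> extensional (A \<union> B)" by (simp add: K_def)
    show "K a \<in> bcells X (dm a) m" if "a \<in> A \<union> B" for a 
      using that KA KB Mc_in[OF F] Mc_in[OF G] by auto
    show "K (ocomp a \<theta>) = hact X (dm a) m \<theta> (K a)" if a: "a \<in> A \<union> B" and t: "\<theta> \<in> ops k (dm a)" for a k \<theta>
      using a
    proof
      assume "a \<in> A"
      then show ?thesis using Mc_nat[OF F _ t] complex_ocomp[OF A _ t] KA by simp
    next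
      assume "a \<in> B"
      then show ?thesis using Mc_nat[OF G _ t] complex_ocomp[OF B _ t] KB by simp
    qed
  qed
  moreover have "res A m K = F" by (rule extensionalityI[OF _ Mc_ext[OF F]]) (simp_all add: res_def KA)
  moreover have "res B m K = G" by (rule extensionalityI[OF _ Mc_ext[OF G]]) (simp_all add: res_def KB)
  ultimately show thesis by (rule that)
qed

text \<open>Mapping into X turns the pushout of \<open>A\<close> and \<open>B\<close> along their
  intersection into a pullback.\<close>

lemma Mc_pullback:
  assumes A: "complex A" and B: "complex B"
  shows "pullback_square (Mc X (A \<union> B)) (Mc X A) (res A) (Mc X B) (Mc X (A \<inter> B)) (res (A \<inter> B)) (res B) (res (A \<inter> B))"
  unfolding pullback_square_def
proof (intro conjI allI ballI impI)
  show "smap (Mc X (A \<union> B)) (Mc X A) (res A)" using A by (intro smap_res) auto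
  show "smap (Mc X B) (Mc X (A \<inter> B)) (res (A \<inter> B))" using A B by (intro smap_res complex_Int) auto
  show "smap (Mc X (A \<union> B)) (Mc X B) (res B)" using B by (intro smap_res) auto
  show "smap (Mc X A) (Mc X (A \<inter> B)) (res (A \<inter> B))" using A B by (intro smap_res complex_Int) auto
next
  fix n F show "res (A \<inter> B) n (res B n F) = res (A \<inter> B) n (res A n F)" by (simp add: rs_rs)
next
  fix n F G assume "F \<in> cells (Mc X A) n" "G \<in> cells (Mc X B) n" "res (A \<inter> B) n G = res (A \<inter> B) n F"
  then show "\<exists>K\<in>cells (Mc X (A \<union> B)) n. res B n K = G \<and> res A n K = F"
    using Mc_glue[OF A B, of F n G] by metis
next
  fix n F G assume F: "F \<in> cells (Mc X (A \<union> B)) n" and G: "G \<in> cells (Mc X (A \<union> B)) n"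
    and e: "res B n F = res B n G" "res A n F = res A n G"
  show "F = G"
  proof (rule Mc_eqI[OF F G])
    fix a assume "a \<in> A \<union> B"
    then show "F a = G a" using fun_cong[OF e(1), of a] fun_cong[OF e(2), of a] by (auto simp: res_def)
  qed
qed

text \<open>Properties of maps are rephrased as properties of inclusions. Contravariance of
  \<open>Mc X\<close> turns stability under pullback into stability under attaching cells.\<close>

definition kan_incl :: "nat list set \<Rightarrow> nat list set \<Rightarrow> bool" where "kan_incl A B \<longleftrightarrow> kan_fib (Mc X B) (Mc X A) (res A)"
definition acyclic_incl :: "nat list set \<Rightarrow> nat list set \<Rightarrow> bool" where "acyclic_incl A B \<longleftrightarrow> acyclic_fib (Mc X B) (Mc X A) (res A)"

lemma kan_incl_Un: "complex A \<Longrightarrow> complex B \<Longrightarrow> kan_incl (A \<inter> B) B \<Longrightarrow> kan_incl A (A \<union> B)"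
  unfolding kan_incl_def by (rule kan_fib_pullback[OF Mc_pullback ss_Mc[OF complex_Un]])
lemma acyclic_incl_Un: "complex A \<Longrightarrow> complex B \<Longrightarrow> acyclic_incl (A \<inter> B) B \<Longrightarrow> acyclic_incl A (A \<union> B)"
  unfolding acyclic_incl_def by (rule acyclic_fib_pullback[OF Mc_pullback ss_Mc[OF complex_Un]])
lemma kan_incl_trans: "complex A \<Longrightarrow> complex B \<Longrightarrow> complex C \<Longrightarrow> A \<subseteq> B \<Longrightarrow> kan_incl A B \<Longrightarrow> kan_incl B C \<Longrightarrow> kan_incl A C"
  unfolding kan_incl_def using kan_fib_comp[of "Mc X C" "Mc X B" "res B" "Mc X A" "res A"] ss_Mc[of C] by (simp add: rs_rs)
lemma acyclic_incl_trans: "complex A \<Longrightarrow> complex B \<Longrightarrow> complex C \<Longrightarrow> A \<subseteq> B \<Longrightarrow> acyclic_incl A B \<Longrightarrow> acyclic_incl B C \<Longrightarrow> acyclic_incl A C"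
  unfolding acyclic_incl_def using acyclic_fib_comp[of "Mc X C" "Mc X B" "res B" "Mc X A" "res A"] ss_Mc[of C] by (simp add: rs_rs)
lemma acyclic_incl_cancel: "complex A \<Longrightarrow> complex B \<Longrightarrow> complex C \<Longrightarrow> A \<subseteq> B \<Longrightarrow> kan_incl B C \<Longrightarrow> acyclic_incl A B \<Longrightarrow> acyclic_incl A C \<Longrightarrow> acyclic_incl B C"
  unfolding acyclic_incl_def kan_incl_def using acyclic_fib_cancel[of "Mc X C" "Mc X B" "res B" "Mc X A" "res A"] ss_Mc by (simp add: rs_rs)

lemma rs_self: "F \<in> cells (Mc X A) m \<Longrightarrow> res A m F = F"
  unfolding res_def by (rule extensional_restrict[OF Mc_ext])

lemma kan_incl_refl: 
  assumes A: "complex A" shows "kan_incl A A"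
proof -
  have "lift (Mc X A) (Mc X A) (res A) p I" for p I
    unfolding lift_def using rs_self compat_in[of "Mc X A" p I] by metis
  then show ?thesis unfolding kan_incl_def kan_fib_def using smap_res[OF order.refl A] by blast
qed

end

section \<open>Reindexing complexes along an increasing list of vertices\<close>

context bss begin

text \<open>The list \<open>e\<close> acts as an order embedding of vertices. It moves inclusions
  known inside a standard simplex to arbitrary finite vertex sets.\<close>

definition push :: "nat list \<Rightarrow> nat list set \<Rightarrow> nat list set" where "push e A = ocomp e ` A"

definition reindex :: "nat list \<Rightarrow> nat list set \<Rightarrow> nat \<Rightarrow> (nat list \<Rightarrow> 'a) \<Rightarrow> nat list \<Rightarrow> 'a" where
  "reindex e A m F = (\<lambda>a\<in>A. F (ocomp e a))"

context
  fixes e :: "nat list"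
  assumes e: "sorted e" "distinct e" "e \<noteq> []"
begin

lemma em_cx:
  assumes F: "\<And>U. U \<in> F \<Longrightarrow> U \<subseteq> {..<length e}"
  shows "push e (cx F) = cx ((\<lambda>U. (!) e ` U) ` F)"
proof (intro equalityI subsetI)
  fix b assume "b \<in> push e (cx F)"
  then obtain a U where a: "b = ocomp e a" "a \<noteq> []" "sorted a" "U \<in> F" "set a \<subseteq> U" unfolding push_def cx_def by auto
  have "a \<in> ops (dm a) (dm e)" using a F[OF a(4)] length_dm[OF a(2)] length_dm[OF e(3)] by (auto simp: ops_def)
  from ocomp_sorted[OF e(1,3) this] have "sorted b" "b \<noteq> []" using a(1) by auto
  moreover have "set b \<subseteq> (!) e ` U" using a by (auto simp: ocomp_def)
  ultimately show "b \<in> cx ((\<lambda>U. (!) e ` U) ` F)" using a(4) by (auto simp: cx_def)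
next
  fix b assume "b \<in> cx ((\<lambda>U. (!) e ` U) ` F)"
  then obtain U where b: "b \<noteq> []" "sorted b" "U \<in> F" "set b \<subseteq> (!) e ` U" by (auto simp: cx_def)
  note U = F[OF b(3)]
  have "(!) e ` U \<subseteq> set e" using U by auto
  then have "set b \<subseteq> set e" using b(4) by blast
  then obtain \<theta> where t: "\<theta> \<in> ops (dm b) (dm e)" "b = ocomp e \<theta>" using sub_list[OF e(1,3) b(1,2)] by blast
  have "set \<theta> \<subseteq> U"
  proof
    fix i assume i: "i \<in> set \<theta>"
    then have il: "i < length e" using opsD(3)[OF t(1)] length_dm[OF e(3)] by auto
    have "e ! i \<in> set b" using i t(2) by (auto simp: ocomp_def)
    then obtain j where "j \<in> U" "e ! i = e ! j" using b(4) by auto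
    then show "i \<in> U" using nth_eq_iff_index_eq[OF e(2) il, of j] U by auto
  qed
  then have "\<theta> \<in> cx F" using opsD[OF t(1)] b(3) by (auto simp: cx_def)
  then show "b \<in> push e (cx F)" using t(2) unfolding push_def by auto
qed

context
  fixes A :: "nat list set"
  assumes A: "complex A" and Ae: "\<And>a. a \<in> A \<Longrightarrow> set a \<subseteq> {..<length e}"
begin

lemma a_ops: "a \<in> A \<Longrightarrow> a \<in> ops (dm a) (dm e)"
  using complex_sorted[OF A] length_dm[OF complex_ne[OF A]] length_dm[OF e(3)] Ae[of a] by (auto simp: ops_def)

lemma oea: "a \<in> A \<Longrightarrow> \<theta> \<in> ops k (dm a) \<Longrightarrow> ocomp (ocomp e a) \<theta> = ocomp e (ocomp a \<theta>)"
  by (rule ocomp_assoc) (use length_dm[OF complex_ne[OF A]] opsD(3)[of \<theta>] in fastforce)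

lemma dm_oe: "dm (ocomp e a) = dm a" by (simp add: dm_def)

lemma complex_em: "complex (push e A)"
proof (rule complexI)
  fix b assume "b \<in> push e A"
  then obtain a where a: "a \<in> A" "b = ocomp e a" unfolding push_def by auto
  from ocomp_sorted[OF e(1,3) a_ops[OF a(1)]] show "b \<noteq> []" "sorted b" using a(2) by auto
  fix k \<theta> assume "\<theta> \<in> ops k (dm b)"
  then have t: "\<theta> \<in> ops k (dm a)" using dm_oe a(2) by simp
  show "ocomp b \<theta> \<in> push e A" unfolding a(2) oea[OF a(1) t] push_def using complex_ocomp[OF A a(1) t] by simp
qed

lemma ocomp_inj: "inj_on (ocomp e) A"
proof (rule inj_onI)
  fix a b assume a: "a \<in> A" and b: "b \<in> A" and eq: "ocomp e a = ocomp e b"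
  have "inj_on ((!) e) {..<length e}" using e(2) by (auto simp: inj_on_def nth_eq_iff_index_eq)
  then have "inj_on ((!) e) (set a \<union> set b)" by (rule inj_on_subset) (use Ae[OF a] Ae[OF b] in auto)
  then show "a = b" using eq unfolding ocomp_def by (rule map_inj_on[rotated])
qed

lemma reindex_in: 
  assumes F: "F \<in> cells (Mc X (push e A)) m" shows "reindex e A m F \<in> cells (Mc X A) m"
proof (rule McI)
  show "reindex e A m F \<in> extensional A" by (simp add: reindex_def)
  have push: "ocomp e a \<in> push e A" if "a \<in> A" for a using that by (simp add: push_def)
  show "reindex e A m F a \<in> bcells X (dm a) m" if "a \<in> A" for a
    using Mc_in[OF F push[OF that]] that dm_oe by (simp add: reindex_def)
  show "reindex e A m F (ocomp a \<theta>) = hact X (dm a) m \<theta> (reindex e A m F a)" if a: "a \<in> A" and t: "\<theta> \<in> ops k (dm a)" for a k \<theta>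
    using Mc_nat[OF F push[OF a], of \<theta> k] a t complex_ocomp[OF A a t] oea[OF a t] dm_oe by (simp add: reindex_def)
qed

lemma sset_iso_reindex: "sset_iso (Mc X (push e A)) (Mc X A) (reindex e A)"
  unfolding sset_iso_def smap_def
proof (intro conjI allI ballI)
  fix n F assume "F \<in> cells (Mc X (push e A)) n" then show "reindex e A n F \<in> cells (Mc X A) n" by (rule reindex_in)
next
  fix m n \<theta> F assume "\<theta> \<in> ops m n" and F: "F \<in> cells (Mc X (push e A)) n"
  show "reindex e A m (act (Mc X (push e A)) n \<theta> F) = act (Mc X A) n \<theta> (reindex e A n F)"
    unfolding act_Mc reindex_def by (rule restrict_ext) (simp add: push_def dm_oe)
next
  fix m
  show "bij_betw (reindex e A m) (cells (Mc X (push e A)) m) (cells (Mc X A) m)"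
  proof (rule bij_betw_imageI)
    show "inj_on (reindex e A m) (cells (Mc X (push e A)) m)"
    proof (rule inj_onI)
      fix F G assume F: "F \<in> cells (Mc X (push e A)) m" and G: "G \<in> cells (Mc X (push e A)) m" and eq: "reindex e A m F = reindex e A m G"
      show "F = G"
      proof (rule Mc_eqI[OF F G])
        fix b assume "b \<in> push e A"
        then obtain a where "a \<in> A" "b = ocomp e a" unfolding push_def by auto
        then show "F b = G b" using fun_cong[OF eq, of a] by (simp add: reindex_def)
      qed
    qed
    show "reindex e A m ` cells (Mc X (push e A)) m = cells (Mc X A) m"
    proof (intro equalityI subsetI)
      fix G assume "G \<in> reindex e A m ` cells (Mc X (push e A)) m" then show "G \<in> cells (Mc X A) m" using reindex_in by auto
    next
      fix G assume G: "G \<in> cells (Mc X A) m"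
      define F where "F = (\<lambda>b\<in>push e A. G (the_inv_into A (ocomp e) b))"
      have Fe: "F (ocomp e a) = G a" if "a \<in> A" for a
        using that by (simp add: F_def push_def the_inv_into_f_f[OF ocomp_inj])
      have "F \<in> cells (Mc X (push e A)) m"
      proof (rule McI)
        show "F \<in> extensional (push e A)" by (simp add: F_def)
        fix b assume "b \<in> push e A"
        then obtain a where a: "a \<in> A" "b = ocomp e a" unfolding push_def by auto
        show "F b \<in> bcells X (dm b) m" using Mc_in[OF G a(1)] Fe[OF a(1)] a(2) dm_oe by simp
        fix k \<theta> assume "\<theta> \<in> ops k (dm b)"
        then have t: "\<theta> \<in> ops k (dm a)" using dm_oe a(2) by simp
        show "F (ocomp b \<theta>) = hact X (dm b) m \<theta> (F b)"
          unfolding a(2) oea[OF a(1) t] Fe[OF a(1)] Fe[OF complex_ocomp[OF A a(1) t]] dm_oe by (rule Mc_nat[OF G a(1) t])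
      qed
      moreover have "reindex e A m F = G" by (rule extensionalityI[OF _ Mc_ext[OF G]]) (simp_all add: reindex_def Fe)
      ultimately show "G \<in> reindex e A m ` cells (Mc X (push e A)) m" by (metis imageI)
    qed
  qed
qed

end

lemma reindex_square:
  assumes B: "complex B" "\<And>a. a \<in> B \<Longrightarrow> set a \<subseteq> {..<length e}" and A: "complex A" "A \<subseteq> B"
  shows "pullback_square (Mc X (push e B)) (Mc X (push e A)) (res (push e A)) (Mc X B) (Mc X A) (res A) (reindex e B) (reindex e A)"
proof (rule sset_iso_pullback[OF sset_iso_reindex[OF B] sset_iso_reindex[OF A(1)]])
  show "set a \<subseteq> {..<length e}" if "a \<in> A" for a using B(2) that A(2) by blast
  have sub: "push e A \<subseteq> push e B" using A(2) unfolding push_def by blast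
  show "smap (Mc X (push e B)) (Mc X (push e A)) (res (push e A))"
    by (rule smap_res[OF sub complex_em[OF A(1)]]) (use B(2) A(2) in blast)
  show "smap (Mc X B) (Mc X A) (res A)" by (rule smap_res[OF A(2,1)])
  show "res A n (reindex e B n F) = reindex e A n (res (push e A) n F)" for n F
    unfolding res_def reindex_def using A(2) by (auto simp: push_def fun_eq_iff)
qed

lemma kan_incl_em:
  assumes B: "complex B" "\<And>a. a \<in> B \<Longrightarrow> set a \<subseteq> {..<length e}" and A: "complex A" "A \<subseteq> B" and K: "kan_incl A B"
  shows "kan_incl (push e A) (push e B)"
  using kan_fib_pullback[OF reindex_square[OF B A] ss_Mc[OF complex_em[OF B]]] K unfolding kan_incl_def by simp

lemma acyclic_incl_em:
  assumes B: "complex B" "\<And>a. a \<in> B \<Longrightarrow> set a \<subseteq> {..<length e}" and A: "complex A" "A \<subseteq> B" and K: "acyclic_incl A B"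
  shows "acyclic_incl (push e A) (push e B)"
  using acyclic_fib_pullback[OF reindex_square[OF B A] ss_Mc[OF complex_em[OF B]]] K unfolding acyclic_incl_def by simp

end

end

section \<open>Comparison with \<open>A \ X\<close>\<close>

text \<open>A common form for the simplex, its boundary, the spine and the corolla, each of which is
  obtained from a complex \<open>cx F\<close>.\<close>

definition sub_sset :: "nat list set \<Rightarrow> nat list sset" where
  "sub_sset S = \<lparr>cells = (\<lambda>m. {x \<in> S. length x = Suc m}), act = (\<lambda>m \<theta> x. ocomp x \<theta>)\<rparr>"

lemma cx_ops: "a \<in> cx {{..n}} \<longleftrightarrow> a \<in> ops (dm a) n"
  using length_dm[of a] by (auto simp: cx_def ops_def)

lemma ops_cx: "{x \<in> cx F. length x = Suc m} = {x \<in> ops m n. \<exists>S\<in>F. set x \<subseteq> S}" if "\<And>S. S \<in> F \<Longrightarrow> S \<subseteq> {..n}"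
proof (intro equalityI subsetI)
  fix x assume "x \<in> {x \<in> cx F. length x = Suc m}"
  then obtain S where S: "S \<in> F" "set x \<subseteq> S" and x: "sorted x" "length x = Suc m" unfolding cx_def by auto
  have "set x \<subseteq> {..n}" using S that[OF S(1)] by (rule_tac order_trans)
  then have "x \<in> ops m n" using x by (simp add: ops_def)
  then show "x \<in> {x \<in> ops m n. \<exists>S\<in>F. set x \<subseteq> S}" using S by blast
next
  fix x assume "x \<in> {x \<in> ops m n. \<exists>S\<in>F. set x \<subseteq> S}"
  then obtain S where S: "S \<in> F" "set x \<subseteq> S" and x: "x \<in> ops m n" by blast
  then show "x \<in> {x \<in> cx F. length x = Suc m}" using opsD[OF x] unfolding cx_def by auto
qed

lemma simplex_sub: "simplex n = sub_sset (cx {{..n}})"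
proof -
  have "{x \<in> cx {{..n}}. length x = Suc m} = ops m n" for m
    unfolding ops_def cx_def by auto
  then show ?thesis unfolding simplex_def sub_sset_def by simp
qed

lemma boundary_sub: "boundary n = sub_sset (cx ((\<lambda>i. {..n} - {i}) ` {..n}))"
proof -
  have "(set x \<noteq> {..n}) = (\<exists>S\<in>(\<lambda>i. {..n} - {i}) ` {..n}. set x \<subseteq> S)" if "x \<in> ops m n" for x m
    using opsD(3)[OF that] by auto
  then have "{x \<in> ops m n. set x \<noteq> {..n}} = {x \<in> ops m n. \<exists>S\<in>(\<lambda>i. {..n} - {i}) ` {..n}. set x \<subseteq> S}" for m
    by (intro Collect_cong conj_cong refl)
  moreover have "{x \<in> cx ((\<lambda>i. {..n} - {i}) ` {..n}). length x = Suc m} = {x \<in> ops m n. \<exists>S\<in>(\<lambda>i. {..n} - {i}) ` {..n}. set x \<subseteq> S}" for m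
    by (rule ops_cx) auto
  ultimately show ?thesis unfolding boundary_def simplex_def sub_sset_def by simp
qed

definition spine_cx :: "nat \<Rightarrow> nat list set" where "spine_cx n = cx ((\<lambda>i. {i, Suc i}) ` {..<n})"
definition corolla_cx :: "nat \<Rightarrow> nat list set" where "corolla_cx n = cx ((\<lambda>i. {0, i}) ` {1..n})"

lemma spine_sub: "spine n = sub_sset (spine_cx n)"
proof -
  have "{x \<in> ops m n. \<exists>i<n. set x \<subseteq> {i, Suc i}} = {x \<in> ops m n. \<exists>S\<in>(\<lambda>i. {i, Suc i}) ` {..<n}. set x \<subseteq> S}" for m
    by auto
  moreover have "{x \<in> cx ((\<lambda>i. {i, Suc i}) ` {..<n}). length x = Suc m} = {x \<in> ops m n. \<exists>S\<in>(\<lambda>i. {i, Suc i}) ` {..<n}. set x \<subseteq> S}" for m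
    by (rule ops_cx) auto
  ultimately show ?thesis unfolding spine_def simplex_def sub_sset_def spine_cx_def by simp
qed

lemma corolla_sub: "corolla n = sub_sset (corolla_cx n)"
proof -
  have "{x \<in> ops m n. \<exists>i. 0 < i \<and> i \<le> n \<and> set x \<subseteq> {0, i}} = {x \<in> ops m n. \<exists>S\<in>(\<lambda>i. {0, i}) ` {1..n}. set x \<subseteq> S}" for m
    by (auto simp: Suc_le_eq Bex_def)
  moreover have "{x \<in> cx ((\<lambda>i. {0, i}) ` {1..n}). length x = Suc m} = {x \<in> ops m n. \<exists>S\<in>(\<lambda>i. {0, i}) ` {1..n}. set x \<subseteq> S}" for m
    by (rule ops_cx) auto
  ultimately show ?thesis unfolding corolla_def simplex_def sub_sset_def corolla_cx_def by simp
qed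

lemma sub_cells: "a \<in> cells (sub_sset S) n \<longleftrightarrow> a \<in> S \<and> length a = Suc n" by (simp add: sub_sset_def)
lemma sub_act [simp]: "act (sub_sset S) n \<theta> a = ocomp a \<theta>" by (simp add: sub_sset_def)

lemma sub_ocomp: "complex S \<Longrightarrow> a \<in> cells (sub_sset S) n \<Longrightarrow> \<theta> \<in> ops k n \<Longrightarrow> ocomp a \<theta> \<in> cells (sub_sset S) k"
  using complex_ocomp[of S a \<theta> k] opsD(1)[of \<theta> k n] by (auto simp: sub_cells dm_def)

context bss begin

abbreviation LD :: "nat list set \<Rightarrow> ('a, nat list) ldiv_cell sset" where "LD S \<equiv> ldiv (sub_sset S) X"

lemma LD_ext: "f \<in> cells (LD S) m \<Longrightarrow> f n k \<in> extensional (cells (sub_sset S) n \<times> ops k m)"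
  unfolding ldiv_def bisset_hom_def box_def by (auto simp: PiE_def)
lemma LD_in: "f \<in> cells (LD S) m \<Longrightarrow> a \<in> cells (sub_sset S) n \<Longrightarrow> y \<in> ops k m \<Longrightarrow> f n k (a, y) \<in> bcells X n k"
  unfolding ldiv_def bisset_hom_def box_def by (auto simp: PiE_def)
lemma LD_nat: "f \<in> cells (LD S) m \<Longrightarrow> a \<in> cells (sub_sset S) n \<Longrightarrow> y \<in> ops k m \<Longrightarrow> \<theta> \<in> ops n' n \<Longrightarrow> \<phi> \<in> ops k' k \<Longrightarrow>
    f n' k' (ocomp a \<theta>, ocomp y \<phi>) = bact X n k \<theta> \<phi> (f n k (a, y))"
  unfolding ldiv_def bisset_hom_def box_def by (auto simp: PiE_def)

lemma LDI:
  assumes "\<And>n k. f n k \<in> extensional (cells (sub_sset S) n \<times> ops k m)"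
    "\<And>n k a y. a \<in> cells (sub_sset S) n \<Longrightarrow> y \<in> ops k m \<Longrightarrow> f n k (a, y) \<in> bcells X n k"
    "\<And>n k a y n' k' \<theta> \<phi>. a \<in> cells (sub_sset S) n \<Longrightarrow> y \<in> ops k m \<Longrightarrow> \<theta> \<in> ops n' n \<Longrightarrow> \<phi> \<in> ops k' k \<Longrightarrow>
      f n' k' (ocomp a \<theta>, ocomp y \<phi>) = bact X n k \<theta> \<phi> (f n k (a, y))"
  shows "f \<in> cells (LD S) m"
  unfolding ldiv_def bisset_hom_def box_def using assms by (auto simp: PiE_def)

lemma act_LD: "\<phi> \<in> ops l m \<Longrightarrow> act (LD S) m \<phi> f n k = (\<lambda>(a, y)\<in>cells (sub_sset S) n \<times> ops k l. f n k (a, ocomp \<phi> y))"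
  by (simp add: ldiv_def box_def opsD(1))

lemma act_LD_in:
  assumes S: "complex S" and p: "\<phi> \<in> ops l m" and f: "f \<in> cells (LD S) m"
  shows "act (LD S) m \<phi> f \<in> cells (LD S) l"
proof (rule LDI)
  fix n k show "act (LD S) m \<phi> f n k \<in> extensional (cells (sub_sset S) n \<times> ops k l)" unfolding act_LD[OF p] by simp
  fix a y assume a: "a \<in> cells (sub_sset S) n" and y: "y \<in> ops k l"
  show "act (LD S) m \<phi> f n k (a, y) \<in> bcells X n k" unfolding act_LD[OF p] using a y LD_in[OF f a ocomp_ops[OF p y]] by simp
  fix n' k' \<theta> \<phi>' assume t: "\<theta> \<in> ops n' n" "\<phi>' \<in> ops k' k"
  have "ocomp \<phi> (ocomp y \<phi>') = ocomp (ocomp \<phi> y) \<phi>'"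
    by (rule ocomp_assoc[symmetric]) (use opsD(1)[OF y] opsD(3)[OF t(2)] in fastforce)
  then show "act (LD S) m \<phi> f n' k' (ocomp a \<theta>, ocomp y \<phi>') = bact X n k \<theta> \<phi>' (act (LD S) m \<phi> f n k (a, y))"
    unfolding act_LD[OF p] using a y sub_ocomp[OF S a t(1)] ocomp_ops[OF y t(2)] LD_nat[OF f a ocomp_ops[OF p y] t] by simp
qed

lemma LD_eqI:
  assumes f: "f \<in> cells (LD S) m" and g: "g \<in> cells (LD S) m"
    and eq: "\<And>n k a y. a \<in> cells (sub_sset S) n \<Longrightarrow> y \<in> ops k m \<Longrightarrow> f n k (a, y) = g n k (a, y)"
  shows "f = g"
proof (intro ext)
  fix n k z show "f n k z = g n k z"
    by (rule fun_cong[OF extensionalityI[OF LD_ext[OF f] LD_ext[OF g]]]) (use eq in auto)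
qed

lemma ss_LD: 
  assumes S: "complex S" shows "ss (LD S)"
proof
  show "act (LD S) n \<theta> f \<in> cells (LD S) m" if "\<theta> \<in> ops m n" "f \<in> cells (LD S) n" for m n \<theta> f
    using act_LD_in[OF S that] .
  show "act (LD S) n (idop n) f = f" if f: "f \<in> cells (LD S) n" for n f
    by (rule LD_eqI[OF act_LD_in[OF S idop_ops f] f]) (simp add: act_LD[OF idop_ops])
  show "act (LD S) m \<phi> (act (LD S) n \<theta> f) = act (LD S) n (ocomp \<theta> \<phi>) f"
    if p: "\<phi> \<in> ops l m" and t: "\<theta> \<in> ops m n" and f: "f \<in> cells (LD S) n" for l m n \<phi> \<theta> f
  proof (rule LD_eqI[OF act_LD_in[OF S p act_LD_in[OF S t f]] act_LD_in[OF S ocomp_ops[OF t p] f]])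
    fix k j a y assume a: "a \<in> cells (sub_sset S) k" and y: "y \<in> ops j l"
    have "ocomp \<theta> (ocomp \<phi> y) = ocomp (ocomp \<theta> \<phi>) y"
      by (rule ocomp_assoc[symmetric]) (use opsD(1)[OF p] opsD(3)[OF y] in fastforce)
    then show "act (LD S) m \<phi> (act (LD S) n \<theta> f) k j (a, y) = act (LD S) n (ocomp \<theta> \<phi>) f k j (a, y)"
      unfolding act_LD[OF p] act_LD[OF t] act_LD[OF ocomp_ops[OF t p]] using a y ocomp_ops[OF p y] by simp
  qed
qed

text \<open>The Yoneda isomorphism: a map out of the product of \<open>S\<close> with Delta^m is
  evaluated at the universal m-simplex, and \<open>LD_ev\<close> recovers it from these values by
  vertical naturality.\<close>

definition ev :: "nat list set \<Rightarrow> nat \<Rightarrow> ('a, nat list) ldiv_cell \<Rightarrow> nat list \<Rightarrow> 'a" where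
  "ev S m f = (\<lambda>a\<in>S. f (dm a) m (a, idop m))"

lemma complex_cells: "complex S \<Longrightarrow> a \<in> S \<Longrightarrow> a \<in> cells (sub_sset S) (dm a)"
  using length_dm[OF complex_ne] by (simp add: sub_cells)

lemma ev_in:
  assumes S: "complex S" and f: "f \<in> cells (LD S) m"
  shows "ev S m f \<in> cells (Mc X S) m"
proof (rule McI)
  show "ev S m f \<in> extensional S" by (simp add: ev_def)
  show "ev S m f a \<in> bcells X (dm a) m" if "a \<in> S" for a
    using LD_in[OF f complex_cells[OF S that] idop_ops] that by (simp add: ev_def)
  show "ev S m f (ocomp a \<theta>) = hact X (dm a) m \<theta> (ev S m f a)" if a: "a \<in> S" and t: "\<theta> \<in> ops k (dm a)" for a k \<theta>
    using LD_nat[OF f complex_cells[OF S a] idop_ops t idop_ops] a complex_ocomp[OF S a t] dm_ocomp[OF t]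
    by (simp add: ev_def hact_def)
qed

lemma LD_ev: 
  assumes S: "complex S" and f: "f \<in> cells (LD S) m" and a: "a \<in> cells (sub_sset S) n" and y: "y \<in> ops k m"
  shows "f n k (a, y) = vact X n m y (ev S m f a)"
proof -
  have "dm a = n" "a \<in> S" using a by (auto simp: sub_cells dm_def)
  then show ?thesis using LD_nat[OF f a idop_ops idop_ops y] a y by (simp add: ev_def vact_def sub_cells)
qed

lemma sset_iso_ev:
  assumes S: "complex S" shows "sset_iso (LD S) (Mc X S) (ev S)"
  unfolding sset_iso_def smap_def
proof (intro conjI allI ballI)
  fix n f assume "f \<in> cells (LD S) n" then show "ev S n f \<in> cells (Mc X S) n" by (rule ev_in[OF S])
next
  fix m n \<theta> f assume t: "\<theta> \<in> ops m n" and f: "f \<in> cells (LD S) n"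
  show "ev S m (act (LD S) n \<theta> f) = act (Mc X S) n \<theta> (ev S n f)"
  proof (rule Mc_eqI[OF ev_in[OF S act_LD_in[OF S t f]] Mc_act_in[OF S t ev_in[OF S f]]])
    fix a assume a: "a \<in> S"
    show "ev S m (act (LD S) n \<theta> f) a = act (Mc X S) n \<theta> (ev S n f) a"
      using LD_ev[OF S f complex_cells[OF S a] t] a complex_cells[OF S a]
      by (simp add: ev_def[of S m] act_LD[OF t] act_Mc opsD(1)[OF t])
  qed
next
  fix m
  show "bij_betw (ev S m) (cells (LD S) m) (cells (Mc X S) m)"
  proof (rule bij_betw_imageI)
    show "inj_on (ev S m) (cells (LD S) m)"
    proof (rule inj_onI)
      fix f g assume f: "f \<in> cells (LD S) m" and g: "g \<in> cells (LD S) m" and eq: "ev S m f = ev S m g"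
      show "f = g" by (rule LD_eqI[OF f g]) (simp add: LD_ev[OF S f] LD_ev[OF S g] eq)
    qed
    show "ev S m ` cells (LD S) m = cells (Mc X S) m"
    proof (intro equalityI subsetI)
      fix F assume "F \<in> ev S m ` cells (LD S) m" then show "F \<in> cells (Mc X S) m" using ev_in[OF S] by auto
    next
      fix F assume F: "F \<in> cells (Mc X S) m"
      \<comment> \<open>The inverse of evaluation: a vertical operator \<open>y\<close> is a simplex
        of Delta^m and acts on the value at the universal one.\<close>
      define f where "f n k = (\<lambda>(a, y)\<in>cells (sub_sset S) n \<times> ops k m. vact X n m y (F a))" for n k
      have Fa: "F a \<in> bcells X n m" if "a \<in> cells (sub_sset S) n" for a n
        using Mc_in[OF F, of a] that by (auto simp: sub_cells dm_def)
      have "f \<in> cells (LD S) m"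
      proof (rule LDI)
        fix n k show "f n k \<in> extensional (cells (sub_sset S) n \<times> ops k m)" by (simp add: f_def)
        fix a y assume a: "a \<in> cells (sub_sset S) n" and y: "y \<in> ops k m"
        show "f n k (a, y) \<in> bcells X n k" using a y v_in[OF y Fa[OF a]] by (simp add: f_def)
        fix n' k' \<theta> \<phi> assume t: "\<theta> \<in> ops n' n" "\<phi> \<in> ops k' k"
        have aS: "a \<in> S" "dm a = n" using a by (auto simp: sub_cells dm_def)
        have "f n' k' (ocomp a \<theta>, ocomp y \<phi>) = vact X n' m (ocomp y \<phi>) (hact X n m \<theta> (F a))"
          using sub_ocomp[OF S a t(1)] ocomp_ops[OF y t(2)] Mc_nat[OF F aS(1), of \<theta> n'] t(1) aS(2) by (simp add: f_def)
        also have "\<dots> = vact X n' k \<phi> (vact X n' m y (hact X n m \<theta> (F a)))"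
          using v_v[OF y t(2) h_in[OF t(1) Fa[OF a]]] by simp
        also have "vact X n' m y (hact X n m \<theta> (F a)) = hact X n k \<theta> (vact X n m y (F a))"
          using h_v[OF t(1) y Fa[OF a]] by simp
        also have "vact X n' k \<phi> \<dots> = bact X n k \<theta> \<phi> (vact X n m y (F a))"
          using b_vh[OF t v_in[OF y Fa[OF a]]] by simp
        finally show "f n' k' (ocomp a \<theta>, ocomp y \<phi>) = bact X n k \<theta> \<phi> (f n k (a, y))" using a y by (simp add: f_def)
      qed
      moreover have "ev S m f = F"
      proof (rule extensionalityI[OF _ Mc_ext[OF F]])
        show "ev S m f a = F a" if "a \<in> S" for a
          using that complex_cells[OF S that] v_id[OF Mc_in[OF F that]] by (simp add: ev_def f_def)
      qed (simp add: ev_def)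
      ultimately show "F \<in> ev S m ` cells (LD S) m" by (metis imageI)
    qed
  qed
qed

abbreviation IN :: "nat list set \<Rightarrow> nat list set \<Rightarrow> nat \<Rightarrow> ('a, nat list) ldiv_cell \<Rightarrow> ('a, nat list) ldiv_cell" where
  "IN S T \<equiv> ldiv_incl (sub_sset S) (sub_sset T) X"

lemma IN_eq: "f \<in> cells (LD T) m \<Longrightarrow> IN S T m f n k = restrict (f n k) (cells (sub_sset S) n \<times> ops k m)"
  by (simp add: ldiv_incl_def box_def)

lemma IN_hom:
  assumes T: "complex T" and S: "complex S" "S \<subseteq> T"
  shows "IN S T \<in> sset_hom (LD T) (LD S)"
proof -
  have sub: "a \<in> cells (sub_sset T) n" if "a \<in> cells (sub_sset S) n" for a n using that S(2) by (auto simp: sub_cells)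
  have i: "IN S T m f \<in> cells (LD S) m" if f: "f \<in> cells (LD T) m" for m f
  proof (rule LDI)
    fix n k show "IN S T m f n k \<in> extensional (cells (sub_sset S) n \<times> ops k m)" unfolding IN_eq[OF f] by simp
    fix a y assume a: "a \<in> cells (sub_sset S) n" and y: "y \<in> ops k m"
    show "IN S T m f n k (a, y) \<in> bcells X n k" unfolding IN_eq[OF f] using a y LD_in[OF f sub[OF a] y] by simp
    fix n' k' \<theta> \<phi> assume t: "\<theta> \<in> ops n' n" "\<phi> \<in> ops k' k"
    show "IN S T m f n' k' (ocomp a \<theta>, ocomp y \<phi>) = bact X n k \<theta> \<phi> (IN S T m f n k (a, y))"
      unfolding IN_eq[OF f] using a y LD_nat[OF f sub[OF a] y t] sub_ocomp[OF S(1) a t(1)] ocomp_ops[OF y t(2)] by simp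
  qed
  show ?thesis unfolding sset_hom_def
  proof (intro CollectI conjI allI ballI)
    fix n show "IN S T n \<in> cells (LD T) n \<rightarrow>\<^sub>E cells (LD S) n" 
      by (rule PiE_I) (use i in \<open>auto simp: ldiv_incl_def\<close>)
  next
    fix m n \<theta> f assume t: "\<theta> \<in> ops m n" and f: "f \<in> cells (LD T) n"
    show "IN S T m (act (LD T) n \<theta> f) = act (LD S) n \<theta> (IN S T n f)"
    proof (rule LD_eqI[OF i[OF act_LD_in[OF T t f]] act_LD_in[OF S(1) t i[OF f]]])
      fix l k a y assume a: "a \<in> cells (sub_sset S) l" and y: "y \<in> ops k m"
      show "IN S T m (act (LD T) n \<theta> f) l k (a, y) = act (LD S) n \<theta> (IN S T n f) l k (a, y)"
        unfolding IN_eq[OF act_LD_in[OF T t f]] act_LD[OF t] IN_eq[OF f] using a y sub[OF a] ocomp_ops[OF t y] by simp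
    qed
  qed
qed

lemma ev_IN:
  assumes S: "complex S" "S \<subseteq> T" and f: "f \<in> cells (LD T) m"
  shows "res S m (ev T m f) = ev S m (IN S T m f)"
proof -
  have "restrict (ev T m f) S a = ev S m (IN S T m f) a" for a
    using S(2) complex_cells[OF S(1), of a] by (auto simp: ev_def IN_eq[OF f])
  then show ?thesis unfolding res_def by (rule ext)
qed

lemma LD_square:
  assumes T: "complex T" and S: "complex S" "S \<subseteq> T"
  shows "pullback_square (LD T) (LD S) (IN S T) (Mc X T) (Mc X S) (res S) (ev T) (ev S)"
  by (rule sset_iso_pullback[OF sset_iso_ev[OF T] sset_iso_ev[OF S(1)] sset_hom_smap[OF IN_hom[OF T S]] smap_res[OF S(2,1)]]) (rule ev_IN[OF S])

text \<open>With the isomorphisms inverted, properties pass from \<open>ldiv\<close> to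
  \<open>Mc\<close>; \<open>LD_square\<close> carries them the other way.\<close>

lemma LD_square':
  assumes T: "complex T" and S: "complex S" "S \<subseteq> T"
  shows "pullback_square (Mc X T) (Mc X S) (res S) (LD T) (LD S) (IN S T) (\<lambda>n. the_inv_into (cells (LD T) n) (ev T n))
    (\<lambda>n. the_inv_into (cells (LD S) n) (ev S n))"
  by (rule sset_iso_pullback'[OF sset_iso_ev[OF T] sset_iso_ev[OF S(1)] sset_hom_smap[OF IN_hom[OF T S]] smap_res[OF S(2,1)] _
      ss_LD[OF T] ss_LD[OF S(1)]]) (rule ev_IN[OF S])

lemma kan_incl_kan_fibration:
  assumes "complex T" "complex S" "S \<subseteq> T" "kan_fibration (LD T) (LD S) (IN S T)"
  shows "kan_incl S T"
  using kan_fib_pullback[OF LD_square'[OF assms(1-3)] ss_Mc[OF assms(1)] kan_fibration_kan_fib[OF assms(4) ss_LD[OF assms(1)] ss_LD[OF assms(2)]]]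
  unfolding kan_incl_def .

end

section \<open>Fibrations and acyclic inclusions\<close>

text \<open>The alternative \<open>U = {}\<close> is free because simplices are nonempty lists, so
  an empty vertex set generates nothing.\<close>

lemma cx_mono: "(\<And>U. U \<in> F \<Longrightarrow> U = {} \<or> (\<exists>V\<in>G. U \<subseteq> V)) \<Longrightarrow> cx F \<subseteq> cx G"
proof
  fix a assume h: "\<And>U. U \<in> F \<Longrightarrow> U = {} \<or> (\<exists>V\<in>G. U \<subseteq> V)" and "a \<in> cx F"
  then obtain U where U: "U \<in> F" "set a \<subseteq> U" and a: "a \<noteq> []" "sorted a" unfolding cx_def by blast
  have "U \<noteq> {}" using U(2) a(1) by auto
  then obtain V where "V \<in> G" "U \<subseteq> V" using h[OF U(1)] by blast
  then have "\<exists>V\<in>G. set a \<subseteq> V" using U(2) by blast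
  then show "a \<in> cx G" using a unfolding cx_def by simp
qed

lemma cx_eqI: "(\<And>U. U \<in> F \<Longrightarrow> U = {} \<or> (\<exists>V\<in>G. U \<subseteq> V)) \<Longrightarrow> (\<And>V. V \<in> G \<Longrightarrow> V = {} \<or> (\<exists>U\<in>F. V \<subseteq> U)) \<Longrightarrow> cx F = cx G"
  by (intro equalityI cx_mono)

lemma cx_Int1: "cx F \<inter> cx {S} = cx ((\<lambda>U. U \<inter> S) ` F)"
  unfolding cx_def by auto

lemma complex_cx_subset: "complex A \<Longrightarrow> a \<in> A \<Longrightarrow> set a = S \<Longrightarrow> cx {S} \<subseteq> A"
  using complex_closed unfolding cx_def by auto

lemma smap_id: "smap E E (\<lambda>n x. x)" unfolding smap_def by auto

lemma kan_fib_id: "ss E \<Longrightarrow> kan_fib E E (\<lambda>n x. x)"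
  unfolding kan_fib_def lift_def using smap_id by auto

lemma sset_iso_kan_fib:
  assumes i: "sset_iso E B f" and E: "ss E" and B: "ss B"
  shows "kan_fib E B f"
proof (rule kan_fib_pullback[OF _ E kan_fib_id[OF B]])
  have sm: "smap E B f" using i unfolding sset_iso_def by simp
  have "sset_iso B B (\<lambda>n x. x)" unfolding sset_iso_def using smap_id by (auto intro: bij_betw_imageI)
  then show "pullback_square E B f B B (\<lambda>n x. x) f (\<lambda>n x. x)"
    by (rule sset_iso_pullback[OF i _ sm smap_id]) simp
qed

locale vf = bss +
  assumes v_fibrant: "v_fibrant X"
begin

lemma kan_incl_cell: "kan_incl (cx ((\<lambda>i. {..n} - {i}) ` {..n})) (cx {{..n}})"
proof (rule kan_incl_kan_fibration)
  show "cx ((\<lambda>i. {..n} - {i}) ` {..n}) \<subseteq> cx {{..n}}" by (rule cx_mono) auto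
  show "kan_fibration (LD (cx {{..n}})) (LD (cx ((\<lambda>i. {..n} - {i}) ` {..n}))) (IN (cx ((\<lambda>i. {..n} - {i}) ` {..n})) (cx {{..n}}))"
    using v_fibrant unfolding v_fibrant_def simplex_sub boundary_sub by simp
qed auto

text \<open>The sorted list of elements of \<open>S\<close> identifies it with a standard simplex,
  where the assertion is Reedy fibrancy.\<close>

lemma kan_incl_simplex:
  assumes S: "finite S" "S \<noteq> {}"
  shows "kan_incl (cx ((\<lambda>x. S - {x}) ` S)) (cx {S})"
proof -
  define e where "e = sorted_list_of_set S"
  have e: "sorted e" "distinct e" "e \<noteq> []" "set e = S" unfolding e_def using S by auto
  define n where "n = dm e"
  have len: "{..<length e} = {..n}" using length_dm[OF e(3)] n_def by auto
  have inj: "inj_on ((!) e) {..n}" unfolding len[symmetric] by (rule inj_on_nth[OF e(2)]) simp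
  have im: "(!) e ` {..n} = S" unfolding len[symmetric] e(4)[symmetric] lessThan_atLeast0 by (simp add: nth_image)
  have "kan_incl (push e (cx ((\<lambda>i. {..n} - {i}) ` {..n}))) (push e (cx {{..n}}))"
  proof (rule kan_incl_em[OF e(1-3) complex_cx _ complex_cx _ kan_incl_cell])
    show "cx ((\<lambda>i. {..n} - {i}) ` {..n}) \<subseteq> cx {{..n}}" by (rule cx_mono) auto
    show "set a \<subseteq> {..<length e}" if "a \<in> cx {{..n}}" for a using that len by (auto simp: cx_def)
  qed
  moreover have "push e (cx {{..n}}) = cx {S}" using em_cx[OF e(1-3), of "{{..n}}"] len im by simp
  moreover have "push e (cx ((\<lambda>i. {..n} - {i}) ` {..n})) = cx ((\<lambda>x. S - {x}) ` S)"
  proof -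
    have "(\<lambda>U. (!) e ` U) ` (\<lambda>i. {..n} - {i}) ` {..n} = (\<lambda>x. S - {x}) ` S"
    proof -
      have "(!) e ` ({..n} - {i}) = S - {e ! i}" if "i \<in> {..n}" for i
        using inj_on_image_set_diff[OF inj, of "{..n}" "{i}"] that im by simp
      then have "(\<lambda>U. (!) e ` U) ` (\<lambda>i. {..n} - {i}) ` {..n} = (\<lambda>i. S - {e ! i}) ` {..n}" 
        unfolding image_image by (rule image_cong[OF refl])
      also have "\<dots> = (\<lambda>x. S - {x}) ` ((!) e ` {..n})" by (simp only: image_image)
      also have "\<dots> = (\<lambda>x. S - {x}) ` S" by (simp only: im)
      finally show ?thesis .
    qed
    then show ?thesis using em_cx[OF e(1-3), of "(\<lambda>i. {..n} - {i}) ` {..n}"] len by auto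
  qed
  ultimately show ?thesis by simp
qed

text \<open>Either the simplex on \<open>S\<close> already lies in \<open>A\<close>, or
  \<open>A\<close> meets it exactly in its boundary, because a complex containing a simplex with
  vertex set \<open>S\<close> contains all of \<open>cx {S}\<close>. In the second case the boundary
  inclusion is pushed out.\<close>

lemma kan_incl_add_simplex:
  assumes "finite S" "complex A" "cx ((\<lambda>x. S - {x}) ` S) \<subseteq> A"
  shows "kan_incl A (A \<union> cx {S})"
proof (cases "cx {S} \<subseteq> A")
  case True
  then show ?thesis using kan_incl_refl[OF assms(2)] by (simp add: Un_absorb2)
next
  case False
  then have S: "S \<noteq> {}" by (auto simp: cx_def)
  have "A \<inter> cx {S} = cx ((\<lambda>x. S - {x}) ` S)"
  proof
    show "A \<inter> cx {S} \<subseteq> cx ((\<lambda>x. S - {x}) ` S)"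
    proof
      fix a assume a: "a \<in> A \<inter> cx {S}"
      then have "set a \<noteq> S" using complex_cx_subset[OF assms(2)] False by blast
      then show "a \<in> cx ((\<lambda>x. S - {x}) ` S)" using a by (auto simp: cx_def)
    qed
    have "cx ((\<lambda>x. S - {x}) ` S) \<subseteq> cx {S}" by (rule cx_mono) auto
    then show "cx ((\<lambda>x. S - {x}) ` S) \<subseteq> A \<inter> cx {S}" using assms(3) by blast
  qed
  then show ?thesis using kan_incl_Un[OF assms(2) complex_cx, of "{S}"] kan_incl_simplex[OF assms(1) S] by simp
qed

text \<open>Before a simplex is attached, its boundary has to be present. The boundary is generated
  by smaller vertex sets, so an outer induction on the bound \<open>k\<close> of their cardinalities
  supplies it, while an inner induction adds the members of \<open>F\<close>.\<close>

lemma kan_incl_cx: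
  assumes "finite F" "\<And>S. S \<in> F \<Longrightarrow> finite S" "complex A"
  shows "kan_incl A (A \<union> cx F)"
proof -
  have main: "\<forall>F A. finite F \<longrightarrow> (\<forall>S\<in>F. finite S \<and> card S \<le> k) \<longrightarrow> complex A \<longrightarrow> kan_incl A (A \<union> cx F)" for k
  proof (induction k)
    case 0
    have "cx F = {}" if "\<forall>S\<in>F. finite S \<and> card S \<le> 0" for F using that by (auto simp: cx_def)
    then show ?case using kan_incl_refl by simp
  next
    case (Suc k)
    have "kan_incl A (A \<union> cx F)" if "finite F" "\<forall>S\<in>F. finite S \<and> card S \<le> Suc k" "complex A" for F A
      using that
    proof (induction F)
      case empty
      then show ?case using kan_incl_refl by simp
    next
      case (insert S F)
      let ?A = "A \<union> cx F" and ?D = "cx ((\<lambda>x. S - {x}) ` S)"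
      have S: "finite S" "card S \<le> Suc k" using insert by auto
      have A: "complex ?A" by (rule complex_Un[OF insert.prems(2) complex_cx])
      have "kan_incl A ?A" using insert by simp
      moreover have "kan_incl ?A (?A \<union> ?D)" by (rule Suc.IH[rule_format, OF _ _ A]) (use S in \<open>auto simp: card_Diff_singleton\<close>)
      moreover have "kan_incl (?A \<union> ?D) (?A \<union> ?D \<union> cx {S})" 
        by (rule kan_incl_add_simplex[OF S(1) complex_Un[OF A complex_cx]]) auto
      moreover have "?A \<union> ?D \<union> cx {S} = A \<union> cx (insert S F)"
      proof -
        have "?D \<subseteq> cx {S}" by (rule cx_mono) auto
        moreover have "cx (insert S F) = cx {S} \<union> cx F" using cx_Un[of "{S}" F] by simp
        ultimately show ?thesis by blast
      qed
      ultimately have 1: "kan_incl A (?A \<union> ?D)" and 2: "kan_incl (?A \<union> ?D) (A \<union> cx (insert S F))"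
        using kan_incl_trans[OF insert.prems(2) A complex_Un[OF A complex_cx], of "(\<lambda>x. S - {x}) ` S"] by auto
      show ?case
        by (rule kan_incl_trans[OF insert.prems(2) complex_Un[OF A complex_cx] complex_Un[OF insert.prems(2) complex_cx] _ 1 2]) blast
    qed
    then show ?case by blast
  qed
  have "\<forall>S\<in>F. finite S \<and> card S \<le> Max (card ` F)" using assms by auto
  then show ?thesis using main assms(1,3) by blast
qed

lemma kan_incl_cx_sub: "finite G \<Longrightarrow> (\<And>S. S \<in> G \<Longrightarrow> finite S) \<Longrightarrow> cx F \<subseteq> cx G \<Longrightarrow> kan_incl (cx F) (cx G)"
  using kan_incl_cx[of G "cx F"] by (simp add: Un_absorb1)

text \<open>\<open>Mc X {}\<close> is a point. Fibrancy of restriction to the empty complex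
  therefore makes every \<open>Mc X (cx F)\<close> with finite data a Kan complex.\<close>

lemma kan_complex_empty: "kan_complex (Mc X {})"
proof -
  have "(\<lambda>_. undefined) \<in> cells (Mc X {}) m" for m by (rule McI) auto
  moreover have "F = G" if "F \<in> cells (Mc X {}) m" "G \<in> cells (Mc X {}) m" for F G m
    by (rule Mc_eqI[OF that]) simp
  moreover have "ss (Mc X {})" using ss_Mc complex_cx[of "{}"] by simp
  ultimately show ?thesis unfolding kan_complex_def using ss.face_in compat_in by (metis Diff_iff atMost_iff)
qed

lemma kan_complex_Mc: "finite F \<Longrightarrow> (\<And>S. S \<in> F \<Longrightarrow> finite S) \<Longrightarrow> kan_complex (Mc X (cx F))"
  using kan_incl_cx_sub[of F "{}"] kan_complex_kan_fib[OF _ kan_complex_empty ss_Mc[OF complex_cx], of F] by (simp add: kan_incl_def)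

lemma kan_complex_LD: "finite F \<Longrightarrow> (\<And>S. S \<in> F \<Longrightarrow> finite S) \<Longrightarrow> kan_complex (LD (cx F))"
  using kan_complex_kan_fib[OF sset_iso_kan_fib[OF sset_iso_ev[OF complex_cx] ss_LD[OF complex_cx] ss_Mc[OF complex_cx]] kan_complex_Mc ss_LD[OF complex_cx]]
  by blast

text \<open>After this equivalence homotopy groups no longer occur: the Segal and Bousfield
  conditions are statements about inclusions of complexes.\<close>

lemma whe_iff_acyclic_incl:
  assumes F: "finite F" "\<And>S. S \<in> F \<Longrightarrow> finite S" and G: "finite G" "\<And>S. S \<in> G \<Longrightarrow> finite S" and sub: "cx F \<subseteq> cx G"
  shows "weak_homotopy_equivalence (LD (cx G)) (LD (cx F)) (IN (cx F) (cx G)) \<longleftrightarrow> acyclic_incl (cx F) (cx G)"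
proof
  assume W: "weak_homotopy_equivalence (LD (cx G)) (LD (cx F)) (IN (cx F) (cx G))"
  have "kan_fib (LD (cx G)) (LD (cx F)) (IN (cx F) (cx G))"
    using kan_fib_pullback[OF LD_square[OF complex_cx complex_cx sub] ss_LD[OF complex_cx]] kan_incl_cx_sub[OF G sub] unfolding kan_incl_def .
  from whe_kan_fib_acyclic_fib[OF W this ss_LD[OF complex_cx] ss_LD[OF complex_cx] kan_complex_LD[OF F]]
  have "acyclic_fib (LD (cx G)) (LD (cx F)) (IN (cx F) (cx G))" by blast
  from acyclic_fib_pullback[OF LD_square'[OF complex_cx complex_cx sub] ss_Mc[OF complex_cx] this]
  show "acyclic_incl (cx F) (cx G)" unfolding acyclic_incl_def .
next
  assume "acyclic_incl (cx F) (cx G)"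
  then have "acyclic_fib (LD (cx G)) (LD (cx F)) (IN (cx F) (cx G))"
    using acyclic_fib_pullback[OF LD_square[OF complex_cx complex_cx sub] ss_LD[OF complex_cx]] unfolding acyclic_incl_def by blast
  then show "weak_homotopy_equivalence (LD (cx G)) (LD (cx F)) (IN (cx F) (cx G))"
    by (rule acyclic_fib_whe[OF _ IN_hom[OF complex_cx complex_cx sub] ss_LD[OF complex_cx] _ ss_LD[OF complex_cx]])
      (use kan_complex_LD F G in blast)+
qed

lemma spine_acyclic_incl: "weak_homotopy_equivalence (ldiv (simplex n) X) (ldiv (spine n) X) (ldiv_incl (spine n) (simplex n) X)
   \<longleftrightarrow> acyclic_incl (spine_cx n) (cx {{..n}})"
  unfolding spine_sub simplex_sub spine_cx_def
proof (rule whe_iff_acyclic_incl)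
  show "cx ((\<lambda>i. {i, Suc i}) ` {..<n}) \<subseteq> cx {{..n}}" by (rule cx_mono) auto
qed (simp, blast, simp, simp)

lemma corolla_acyclic_incl: "weak_homotopy_equivalence (ldiv (simplex n) X) (ldiv (corolla n) X) (ldiv_incl (corolla n) (simplex n) X)
   \<longleftrightarrow> acyclic_incl (corolla_cx n) (cx {{..n}})"
  unfolding corolla_sub simplex_sub corolla_cx_def
proof (rule whe_iff_acyclic_incl)
  show "cx ((\<lambda>i. {0, i}) ` {1..n}) \<subseteq> cx {{..n}}" by (rule cx_mono) auto
qed (simp, blast, simp, simp)

text \<open>Attaching the simplex \<open>S\<close> is a pushout along its intersection with what is
  already present. The family \<open>H\<close> is a convenient set of generators for that
  intersection.\<close>

lemma acyclic_incl_add: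
  assumes "acyclic_incl (cx H) (cx {S})" "cx ((\<lambda>U. U \<inter> S) ` G) = cx H"
  shows "acyclic_incl (cx G) (cx (insert S G))"
  using acyclic_incl_Un[of "cx G" "cx {S}"] assms cx_Un[of G "{S}"] by (simp add: cx_Int1)

lemma acyclic_incl_cancel_cx:
  assumes "acyclic_incl (cx F) (cx G)" "acyclic_incl (cx F) (cx H)" "cx F \<subseteq> cx G" "cx G \<subseteq> cx H" "finite H" "\<And>S. S \<in> H \<Longrightarrow> finite S"
  shows "acyclic_incl (cx G) (cx H)"
  by (rule acyclic_incl_cancel[OF complex_cx complex_cx complex_cx assms(3) kan_incl_cx_sub[OF assms(5,6,4)] assms(1,2)])

lemma acyclic_incl_triple:
  assumes A: "acyclic_incl (cx F) (cx {{..2}})" and F: "\<And>U. U \<in> F \<Longrightarrow> U \<subseteq> {..2}" and ijk: "i < j" "j < k"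
  shows "acyclic_incl (cx ((\<lambda>U. (!) [i, j, k] ` U) ` F)) (cx {{i, j, k}})"
proof -
  have e: "sorted [i, j, k]" "distinct [i, j, k]" "[i, j, k] \<noteq> []" using ijk by auto
  have l: "{..<length [i, j, k]} = {..2}" by auto
  have "(!) [i, j, k] ` {..2} = {i, j, k}"
    by (auto simp: numeral_2_eq_2 atMost_Suc)
  moreover have "acyclic_incl (push [i, j, k] (cx F)) (push [i, j, k] (cx {{..2}}))"
    by (rule acyclic_incl_em[OF e complex_cx _ complex_cx cx_mono A]) (use F in \<open>auto simp: cx_def\<close>)
  ultimately show ?thesis using em_cx[OF e, of F] em_cx[OF e, of "{{..2}}"] F unfolding l by simp
qed

end

locale segal = vf +
  assumes segal: "n \<ge> 2 \<Longrightarrow> acyclic_incl (spine_cx n) (cx {{..n}})"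
begin

lemma acyclic_incl_path: "i < j \<Longrightarrow> j < k \<Longrightarrow> acyclic_incl (cx {{i, j}, {j, k}}) (cx {{i, j, k}})"
proof -
  assume ijk: "i < j" "j < k"
  have s: "(\<lambda>i. {i, Suc i}) ` {..<2} = {{0, 1}, {1, 2::nat}}" by (auto simp: numeral_2_eq_2 lessThan_Suc)
  have "acyclic_incl (cx ((\<lambda>U. (!) [i, j, k] ` U) ` {{0, 1}, {1, 2}})) (cx {{i, j, k}})"
    by (rule acyclic_incl_triple[OF segal[of 2, unfolded spine_cx_def s] _ ijk]) auto
  then show ?thesis by simp
qed

lemma acyclic_incl_add_path:
  assumes "i < j" "j < k" "cx ((\<lambda>U. U \<inter> {i, j, k}) ` G) = cx {{i, j}, {j, k}}"
  shows "acyclic_incl (cx G) (cx (insert {i, j, k} G))"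
  by (rule acyclic_incl_add[OF acyclic_incl_path[OF assms(1,2)] assms(3)])

lemma spine3: "spine_cx 3 = cx {{0,1},{1,2},{2,3}}"
proof -
  have "(\<lambda>i. {i, Suc i}) ` {..<3} = {{0, 1}, {1, 2}, {2, 3::nat}}" by (auto simp: numeral_3_eq_3 numeral_2_eq_2 lessThan_Suc)
  then show ?thesis unfolding spine_cx_def by simp
qed

text \<open>Triangles are attached along inner 2-dimensional horns, which the Segal condition
  permits: the spine grows to 012 with 23, then to 012 with 023 or with 123. These grow further to
  the two inner horns, 012, 023, 123 and 012, 013, 123. Since the spine is acyclic in Delta^3, right
  cancellation gives acyclicity at every stage.\<close>

lemma acyclic_incl_3:
  "acyclic_incl (cx {{0,1,2},{2,3}}) (cx {{..3}})" "acyclic_incl (cx {{0,2,3},{0,1,2}}) (cx {{..3}})"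
  "acyclic_incl (cx {{1,2,3},{0,2,3},{0,1,2}}) (cx {{..3}})" "acyclic_incl (cx {{0,1,3},{1,2,3},{0,1,2}}) (cx {{..3}})"
proof -
  have e: "cx {{0,1,2},{0,1},{1,2},{2,3}} = cx {{0,1,2},{2,3::nat}}"
    "cx {{0,2,3},{0,1,2},{2,3}} = cx {{0,2,3},{0,1,2::nat}}"
    "cx {{1,2,3},{0,1,2},{2,3}} = cx {{1,2,3},{0,1,2::nat}}"
    by (rule cx_eqI; auto)+
  have s: "acyclic_incl (cx {{0,1},{1,2},{2,3}}) (cx {{0,1,2},{2,3}})"
    unfolding e(1)[symmetric] by (rule acyclic_incl_add_path; (rule cx_eqI)?; auto)
  show a: "acyclic_incl (cx {{0,1,2},{2,3}}) (cx {{..3}})"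
    by (rule acyclic_incl_cancel_cx[OF s segal[of 3, unfolded spine3]]; (rule cx_mono)?; auto)
  have b0: "acyclic_incl (cx {{0,1,2},{2,3}}) (cx {{0,2,3},{0,1,2}})"
    unfolding e(2)[symmetric] by (rule acyclic_incl_add_path; (rule cx_eqI)?; auto)
  show b: "acyclic_incl (cx {{0,2,3},{0,1,2}}) (cx {{..3}})"
    by (rule acyclic_incl_cancel_cx[OF b0 a]; (rule cx_mono)?; auto)
  have c0: "acyclic_incl (cx {{0,1,2},{2,3}}) (cx {{1,2,3},{0,1,2}})"
    unfolding e(3)[symmetric] by (rule acyclic_incl_add_path; (rule cx_eqI)?; auto)
  have c: "acyclic_incl (cx {{1,2,3},{0,1,2}}) (cx {{..3}})"
    by (rule acyclic_incl_cancel_cx[OF c0 a]; (rule cx_mono)?; auto)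
  have d: "acyclic_incl (cx {{0,2,3},{0,1,2}}) (cx {{1,2,3},{0,2,3},{0,1,2}})"
    by (rule acyclic_incl_add_path; (rule cx_eqI)?; auto)
  show "acyclic_incl (cx {{1,2,3},{0,2,3},{0,1,2}}) (cx {{..3}})"
    by (rule acyclic_incl_cancel_cx[OF d b]; (rule cx_mono)?; auto)
  have f: "acyclic_incl (cx {{1,2,3},{0,1,2}}) (cx {{0,1,3},{1,2,3},{0,1,2}})"
    by (rule acyclic_incl_add_path; (rule cx_eqI)?; auto)
  show "acyclic_incl (cx {{0,1,3},{1,2,3},{0,1,2}}) (cx {{..3}})"
    by (rule acyclic_incl_cancel_cx[OF f c]; (rule cx_mono)?; auto)
qed

lemma corolla2: "corolla_cx 2 = cx {{0,1},{0,2}}"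
proof -
  have "(\<lambda>i. {0, i}) ` {1..2} = {{0, 1}, {0, 2::nat}}" by (auto simp: numeral_2_eq_2 atLeastAtMostSuc_conv)
  then show ?thesis unfolding corolla_cx_def by simp
qed

text \<open>Write n = m+1. The induction hypothesis fills Delta^m inside the corolla, leaving the
  edge {0,n}. The triangle {0,m,n} is then attached along {0,m} and {0,n}, an outer horn and hence
  an instance of \<open>C\<close>. The same complex, Delta^m with this triangle, is also reached
  from the spine through Segal steps, so right cancellation makes its inclusion into Delta^n
  acyclic.\<close>

lemma acyclic_incl_corolla:
  assumes C: "acyclic_incl (corolla_cx 2) (cx {{..2}})" and n: "2 \<le> n"
  shows "acyclic_incl (corolla_cx n) (cx {{..n}})"
  using n
proof (induction n rule: dec_induct)
  case base
  show ?case by (rule C)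
next
  case (step m)
  let ?m = "{..m}" and ?n = "Suc m"
  have m: "2 \<le> m" using step by simp
  define Gc where "Gc = (\<lambda>i. {0, i}) ` {1..?n}"
  define Gs where "Gs = (\<lambda>i. {i, Suc i}) ` {..<?n}"
  have eqs: "cx (insert ?m Gc) = cx {?m, {0, ?n}}" "cx (insert ?m Gs) = cx {?m, {m, ?n}}"
    "cx (insert {0, m, ?n} {?m, {0, ?n}}) = cx {{0, m, ?n}, ?m}"
    "cx (insert {0, m, ?n} {?m, {m, ?n}}) = cx {{0, m, ?n}, ?m}"
    by (rule cx_eqI; auto simp: Gc_def Gs_def le_Suc_eq less_Suc_eq)+
  have 1: "acyclic_incl (cx Gc) (cx {?m, {0, ?n}})" unfolding eqs(1)[symmetric]
  proof (rule acyclic_incl_add[OF step.IH[unfolded corolla_cx_def]], rule cx_eqI)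
    fix U assume "U \<in> (\<lambda>U. U \<inter> ?m) ` Gc"
    then obtain i where i: "1 \<le> i" "i \<le> ?n" "U = {0, i} \<inter> ?m" unfolding Gc_def by auto
    show "U = {} \<or> (\<exists>V\<in>(\<lambda>i. {0, i}) ` {1..m}. U \<subseteq> V)"
    proof (cases "i \<le> m")
      case True then show ?thesis using i by auto
    next
      case False then have "U \<subseteq> {0, 1}" using i by auto
      then show ?thesis using m by (intro disjI2 bexI[of _ "{0, 1}"]) auto
    qed
  next
    fix V assume "V \<in> (\<lambda>i. {0, i}) ` {1..m}"
    then obtain i where i: "1 \<le> i" "i \<le> m" "V = {0, i}" by auto
    then have "V \<subseteq> {0, i} \<inter> ?m" by auto
    moreover have "{0, i} \<inter> ?m \<in> (\<lambda>U. U \<inter> ?m) ` Gc" using i unfolding Gc_def by (intro imageI) auto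
    ultimately show "V = {} \<or> (\<exists>U\<in>(\<lambda>U. U \<inter> ?m) ` Gc. V \<subseteq> U)" by blast
  qed
  have 2: "acyclic_incl (cx {?m, {0, ?n}}) (cx {{0, m, ?n}, ?m})" unfolding eqs(3)[symmetric]
  proof (rule acyclic_incl_add)
    have "acyclic_incl (cx ((\<lambda>U. (!) [0, m, ?n] ` U) ` {{0, 1}, {0, 2}})) (cx {{0, m, ?n}})"
      by (rule acyclic_incl_triple[OF C[unfolded corolla2]]) (use m in auto)
    then show "acyclic_incl (cx {{0, m}, {0, ?n}}) (cx {{0, m, ?n}})" by simp
    show "cx ((\<lambda>U. U \<inter> {0, m, ?n}) ` {?m, {0, ?n}}) = cx {{0, m}, {0, ?n}}" by (rule cx_eqI) auto
  qed
  have s: "acyclic_incl (cx Gs) (cx {?m, {m, ?n}})" unfolding eqs(2)[symmetric]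
  proof (rule acyclic_incl_add[OF segal[OF m, unfolded spine_cx_def]], rule cx_eqI)
    fix U assume "U \<in> (\<lambda>U. U \<inter> ?m) ` Gs"
    then obtain i where i: "i < ?n" "U = {i, Suc i} \<inter> ?m" unfolding Gs_def by auto
    show "U = {} \<or> (\<exists>V\<in>(\<lambda>i. {i, Suc i}) ` {..<m}. U \<subseteq> V)"
    proof (cases "i < m")
      case True then show ?thesis using i by auto
    next
      case False then have "U \<subseteq> {m - 1, Suc (m - 1)}" using i by auto
      then show ?thesis using m by (intro disjI2 bexI[of _ "{m - 1, Suc (m - 1)}"]) auto
    qed
  next
    fix V assume "V \<in> (\<lambda>i. {i, Suc i}) ` {..<m}"
    then obtain i where i: "i < m" "V = {i, Suc i}" by auto
    then have "V \<subseteq> {i, Suc i} \<inter> ?m" by auto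
    moreover have "{i, Suc i} \<inter> ?m \<in> (\<lambda>U. U \<inter> ?m) ` Gs" using i unfolding Gs_def by (intro imageI) auto
    ultimately show "V = {} \<or> (\<exists>U\<in>(\<lambda>U. U \<inter> ?m) ` Gs. V \<subseteq> U)" by blast
  qed
  have Gs3: "acyclic_incl (cx Gs) (cx {{..?n}})" using segal[of ?n] m unfolding spine_cx_def Gs_def by simp
  have 3: "acyclic_incl (cx {?m, {m, ?n}}) (cx {{..?n}})"
    by (rule acyclic_incl_cancel_cx[OF s Gs3]; (rule cx_mono)?; auto simp: Gs_def less_Suc_eq)
  have p: "acyclic_incl (cx {?m, {m, ?n}}) (cx {{0, m, ?n}, ?m})" unfolding eqs(4)[symmetric]
  proof (rule acyclic_incl_add_path)
    show "cx ((\<lambda>U. U \<inter> {0, m, ?n}) ` {?m, {m, ?n}}) = cx {{0, m}, {m, ?n}}" by (rule cx_eqI) auto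
  qed (use m in auto)
  have 4: "acyclic_incl (cx {{0, m, ?n}, ?m}) (cx {{..?n}})"
    by (rule acyclic_incl_cancel_cx[OF p 3]; (rule cx_mono)?; auto)
  have 5: "acyclic_incl (cx Gc) (cx {{0, m, ?n}, ?m})"
    by (rule acyclic_incl_trans[OF complex_cx complex_cx complex_cx _ 1 2], rule cx_mono, auto simp: Gc_def le_Suc_eq)
  have "acyclic_incl (cx Gc) (cx {{..?n}})"
    by (rule acyclic_incl_trans[OF complex_cx complex_cx complex_cx _ 5 4], rule cx_mono, auto simp: Gc_def le_Suc_eq)
  then show ?case unfolding corolla_cx_def Gc_def .
qed

end

section \<open>Lifting along restriction maps out of a column\<close>

context bss begin

abbreviation col :: "nat \<Rightarrow> 'a sset" where "col \<equiv> column X"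

lemma cells_col [simp]: "cells (col n) = bcells X n" by (simp add: column_def)
lemma act_col: "act (col n) m \<phi> x = vact X n m \<phi> x" by (simp add: column_def vact_def)

lemma ss_col: "ss (col n)"
proof
  show "act (col n) k \<theta> x \<in> cells (col n) m" if "\<theta> \<in> ops m k" "x \<in> cells (col n) k" for m k \<theta> x
    using v_in[OF that(1)] that(2) by (simp add: act_col)
  show "act (col n) k (idop k) x = x" if "x \<in> cells (col n) k" for k x using v_id that by (simp add: act_col)
  show "act (col n) m \<phi> (act (col n) k \<theta> x) = act (col n) k (ocomp \<theta> \<phi>) x"
    if "\<phi> \<in> ops l m" "\<theta> \<in> ops m k" "x \<in> cells (col n) k" for l m k \<phi> \<theta> x
    using v_v[OF that(2,1)] that(3) by (simp add: act_col)
qed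

lemma smap_hact: "\<theta> \<in> ops n' n \<Longrightarrow> smap (col n) (col n') (\<lambda>m. hact X n m \<theta>)"
  unfolding smap_def by (simp add: act_col h_in h_v)

lemma h_face: "\<theta> \<in> ops n' n \<Longrightarrow> i \<le> Suc p \<Longrightarrow> x \<in> bcells X n (Suc p) \<Longrightarrow>
    hact X n p \<theta> (face (col n) (Suc p) i x) = face (col n') (Suc p) i (hact X n (Suc p) \<theta> x)"
  using smap_d[OF smap_hact] by simp
lemma h_deg: "\<theta> \<in> ops n' n \<Longrightarrow> i \<le> p \<Longrightarrow> x \<in> bcells X n p \<Longrightarrow>
    hact X n (Suc p) \<theta> (deg (col n) p i x) = deg (col n') p i (hact X n p \<theta> x)"
  using smap_s[OF smap_hact] by simp
lemma h_const: "\<theta> \<in> ops n' n \<Longrightarrow> x \<in> bcells X n 0 \<Longrightarrow>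
    hact X n m \<theta> (const_simplex (col n) x m) = const_simplex (col n') (hact X n 0 \<theta> x) m"
  using smap_c[OF smap_hact] by simp

text \<open>The condition under which values prescribed on two generating simplices \<open>e\<close>
  and \<open>e'\<close> can come from one cell of \<open>Mc\<close>.\<close>

definition agree :: "nat \<Rightarrow> nat list \<Rightarrow> 'a \<Rightarrow> nat list \<Rightarrow> 'a \<Rightarrow> bool" where
  "agree m e x e' x' \<longleftrightarrow> (\<forall>k \<theta> \<theta>'. \<theta> \<in> ops k (dm e) \<longrightarrow> \<theta>' \<in> ops k (dm e') \<longrightarrow> ocomp e \<theta> = ocomp e' \<theta>' \<longrightarrow>
     hact X (dm e) m \<theta> x = hact X (dm e') m \<theta>' x')"

text \<open>Strictly increasing lists are the nondegenerate simplices; composition with one of them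
  can be cancelled (\<open>facet_inj\<close>), so a value on it can be prescribed without
  self-consistency conditions.\<close>

definition facet :: "nat list \<Rightarrow> bool" where "facet e \<longleftrightarrow> sorted e \<and> distinct e \<and> e \<noteq> []"

lemma facet_inj:
  assumes "facet e" "\<theta> \<in> ops k (dm e)" "\<theta>' \<in> ops l (dm e)" "ocomp e \<theta> = ocomp e \<theta>'" shows "\<theta> = \<theta>'"
proof -
  have l: "length e = Suc (dm e)" using assms(1) length_dm by (auto simp: facet_def)
  have "inj_on ((!) e) (set \<theta> \<union> set \<theta>')"
    by (rule inj_on_nth) (use assms l opsD(3)[OF assms(2)] opsD(3)[OF assms(3)] in \<open>auto simp: facet_def less_Suc_eq_le\<close>)
  then show ?thesis using assms(4) unfolding ocomp_def by (rule map_inj_on[rotated])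
qed

text \<open>All vertices of a common simplex lie in the intersection of \<open>e\<close> and
  \<open>e'\<close>, so it factors through \<open>ocomp e \<alpha>\<close>. One equation there
  settles all the others.\<close>

lemma agreeI:
  assumes e: "facet e" "facet e'" and \<alpha>: "\<alpha> \<in> ops l (dm e)" "\<alpha>' \<in> ops l (dm e')" "ocomp e \<alpha> = ocomp e' \<alpha>'"
    and c: "set e \<inter> set e' \<subseteq> set (ocomp e \<alpha>)" and x: "x \<in> bcells X (dm e) m" "x' \<in> bcells X (dm e') m"
    and eq: "hact X (dm e) m \<alpha> x = hact X (dm e') m \<alpha>' x'"
  shows "agree m e x e' x'"
  unfolding agree_def
proof (intro allI impI)
  fix k \<theta> \<theta>' assume t: "\<theta> \<in> ops k (dm e)" "\<theta>' \<in> ops k (dm e')" "ocomp e \<theta> = ocomp e' \<theta>'"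
  have se: "sorted e" "e \<noteq> []" "sorted e'" "e' \<noteq> []" using e by (auto simp: facet_def)
  note o = ocomp_sorted[OF se(1,2) t(1)] and o' = ocomp_sorted[OF se(3,4) t(2)]
  have "set (ocomp e \<theta>) \<subseteq> set (ocomp e \<alpha>)" using o(3) o'(3) t(3) c by auto
  from sub_list[OF ocomp_sorted(1,2)[OF se(1,2) \<alpha>(1)] o(2,1) this]
  obtain \<zeta> where z: "\<zeta> \<in> ops k l" "ocomp e \<theta> = ocomp (ocomp e \<alpha>) \<zeta>"
    using dm_ocomp[OF t(1)] dm_ocomp[OF \<alpha>(1)] by metis
  have zs: "set \<zeta> \<subseteq> {..<length \<alpha>}" "set \<zeta> \<subseteq> {..<length \<alpha>'}"
    using opsD(1)[OF \<alpha>(1)] opsD(1)[OF \<alpha>(2)] opsD(3)[OF z(1)] by auto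
  have "\<theta> = ocomp \<alpha> \<zeta>" by (rule facet_inj[OF e(1) t(1) ocomp_ops[OF \<alpha>(1) z(1)]]) (simp add: z(2) ocomp_assoc[OF zs(1)])
  moreover have "\<theta>' = ocomp \<alpha>' \<zeta>" 
    by (rule facet_inj[OF e(2) t(2) ocomp_ops[OF \<alpha>(2) z(1)]]) (simp add: t(3)[symmetric] z(2) \<alpha>(3) ocomp_assoc[OF zs(2)])
  ultimately show "hact X (dm e) m \<theta> x = hact X (dm e') m \<theta>' x'"
    using h_h[OF \<alpha>(1) z(1) x(1)] h_h[OF \<alpha>(2) z(1) x(2)] eq by simp
qed

lemma agree_disjoint: "facet e \<Longrightarrow> facet e' \<Longrightarrow> set e \<inter> set e' = {} \<Longrightarrow> agree m e x e' x'"
  unfolding agree_def facet_def using ocomp_sorted[of e] ocomp_sorted[of e'] by (metis Int_subset_iff set_empty subset_empty)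

lemma agree_self: "facet e \<Longrightarrow> agree m e x e x"
  unfolding agree_def using facet_inj by blast

lemma agree_sym: "agree m e x e' x' \<Longrightarrow> agree m e' x' e x"
  unfolding agree_def by metis

definition facet_cx :: "(nat list \<times> 'a) set \<Rightarrow> nat list set" where "facet_cx P = cx ((\<lambda>(e, x). set e) ` P)"

lemma complex_facet_cx [simp]: "complex (facet_cx P)" unfolding facet_cx_def by simp

lemma facet_cx_cases:
  assumes "a \<in> facet_cx P" "\<And>e x. (e, x) \<in> P \<Longrightarrow> facet e"
  obtains e x \<theta> where "(e, x) \<in> P" "\<theta> \<in> ops (dm a) (dm e)" "a = ocomp e \<theta>"
proof -
  obtain e x where e: "(e, x) \<in> P" "set a \<subseteq> set e" "a \<noteq> []" "sorted a" using assms(1) unfolding facet_cx_def cx_def by auto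
  have "sorted e" "e \<noteq> []" using assms(2)[OF e(1)] by (auto simp: facet_def)
  from sub_list[OF this e(3,4,2)] show thesis using that e(1) by blast
qed

lemma facet_facet_cx: "(e, x) \<in> P \<Longrightarrow> facet e \<Longrightarrow> e \<in> facet_cx P"
  unfolding facet_cx_def cx_def facet_def by force

lemma Mc_facet_eqI:
  assumes F: "F \<in> cells (Mc X (facet_cx P)) m" and G: "G \<in> cells (Mc X (facet_cx P)) m"
    and P: "\<And>e x. (e, x) \<in> P \<Longrightarrow> facet e" and eq: "\<And>e x. (e, x) \<in> P \<Longrightarrow> F e = G e"
  shows "F = G"
proof (rule Mc_eqI[OF F G])
  fix a assume "a \<in> facet_cx P"
  then obtain e x \<theta> where e: "(e, x) \<in> P" "\<theta> \<in> ops (dm a) (dm e)" "a = ocomp e \<theta>" using facet_cx_cases P by blast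
  have f: "e \<in> facet_cx P" using facet_facet_cx[OF e(1) P[OF e(1)]] .
  show "F a = G a" unfolding e(3) using Mc_nat[OF F f e(2)] Mc_nat[OF G f e(2)] eq[OF e(1)] by simp
qed

text \<open>Each simplex inherits its value from a facet containing it. Agreement of the prescribed
  values makes the result independent of that facet, which gives naturality as well.\<close>

lemma Mc_glue_facets:
  assumes P: "\<And>e x. (e, x) \<in> P \<Longrightarrow> facet e" "\<And>e x. (e, x) \<in> P \<Longrightarrow> x \<in> bcells X (dm e) m"
    and ag: "\<And>e x e' x'. (e, x) \<in> P \<Longrightarrow> (e', x') \<in> P \<Longrightarrow> agree m e x e' x'"
  obtains v where "v \<in> cells (Mc X (facet_cx P)) m" "\<And>e x. (e, x) \<in> P \<Longrightarrow> v e = x"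
proof -
  define Q where "Q a y \<longleftrightarrow> (\<exists>e x \<theta>. (e, x) \<in> P \<and> \<theta> \<in> ops (dm a) (dm e) \<and> a = ocomp e \<theta> \<and> y = hact X (dm e) m \<theta> x)" for a y
  define v where "v = (\<lambda>a\<in>facet_cx P. SOME y. Q a y)"
  have Qu: "y = y'" if "Q a y" "Q a y'" for a y y' 
  proof -
    obtain e x \<theta> where 1: "(e, x) \<in> P" "\<theta> \<in> ops (dm a) (dm e)" "a = ocomp e \<theta>" "y = hact X (dm e) m \<theta> x" using \<open>Q a y\<close> Q_def by blast
    obtain e' x' \<theta>' where 2: "(e', x') \<in> P" "\<theta>' \<in> ops (dm a) (dm e')" "a = ocomp e' \<theta>'" "y' = hact X (dm e') m \<theta>' x'" using \<open>Q a y'\<close> Q_def by blast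
    show ?thesis using ag[OF 1(1) 2(1), unfolded agree_def, rule_format, OF 1(2) 2(2)] 1(3,4) 2(3,4) by simp
  qed
  have v: "v a = y" if "a \<in> facet_cx P" "Q a y" for a y
    using that(1) someI[of "Q a", OF that(2)] Qu that(2) unfolding v_def by auto
  have vo: "v (ocomp e \<theta>) = hact X (dm e) m \<theta> x" if e: "(e, x) \<in> P" and t: "\<theta> \<in> ops k (dm e)" for e x \<theta> k
    by (rule v[OF complex_ocomp[OF complex_facet_cx facet_facet_cx[OF e P(1)[OF e]] t]]) (use e t dm_ocomp[OF t] in \<open>auto simp: Q_def\<close>)
  have "v \<in> cells (Mc X (facet_cx P)) m"
  proof (rule McI)
    show "v \<in> extensional (facet_cx P)" by (simp add: v_def)
    fix a assume "a \<in> facet_cx P"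
    then obtain e x \<theta> where e: "(e, x) \<in> P" "\<theta> \<in> ops (dm a) (dm e)" "a = ocomp e \<theta>" using facet_cx_cases P(1) by blast
    have va: "v a = hact X (dm e) m \<theta> x" unfolding e(3) by (rule vo[OF e(1,2)])
    show "v a \<in> bcells X (dm a) m" unfolding va by (rule h_in[OF e(2) P(2)[OF e(1)]])
    fix k \<phi> assume f: "\<phi> \<in> ops k (dm a)"
    have "set \<phi> \<subseteq> {..<length \<theta>}" using opsD(1)[OF e(2)] opsD(3)[OF f] by auto
    then have "ocomp a \<phi> = ocomp e (ocomp \<theta> \<phi>)" unfolding e(3) by (rule ocomp_assoc)
    then show "v (ocomp a \<phi>) = hact X (dm a) m \<phi> (v a)"
      using vo[OF e(1) ocomp_ops[OF e(2) f]] h_h[OF e(2) f P(2)[OF e(1)]] va by simp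
  qed
  moreover have "v e = x" if "(e, x) \<in> P" for e x
  proof -
    have l: "length e = Suc (dm e)" using length_dm P(1)[OF that] by (auto simp: facet_def)
    show ?thesis using vo[OF that idop_ops] ocomp_idop[OF l] h_id[OF P(2)[OF that]] by simp
  qed
  ultimately show thesis by (rule that)
qed

text \<open>Restriction to \<open>A\<close> with X_n itself as source instead of the isomorphic
  \<open>Mc X (cx {{..n}})\<close>: a list in \<open>A\<close> is both a simplex of Delta^n and an
  operator acting on X_n.\<close>

definition col_res :: "nat list set \<Rightarrow> nat \<Rightarrow> nat \<Rightarrow> 'a \<Rightarrow> nat list \<Rightarrow> 'a" where
  "col_res A n m x = (\<lambda>a\<in>A. hact X n m a x)"

lemma cr_in: 
  assumes A: "complex A" "A \<subseteq> cx {{..n}}" and x: "x \<in> bcells X n m" shows "col_res A n m x \<in> cells (Mc X A) m"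
proof (rule McI)
  have o: "a \<in> ops (dm a) n" if "a \<in> A" for a using that A(2) cx_ops by blast
  show "col_res A n m x \<in> extensional A" by (simp add: col_res_def)
  show "col_res A n m x a \<in> bcells X (dm a) m" if "a \<in> A" for a using that h_in[OF o x] by (simp add: col_res_def)
  show "col_res A n m x (ocomp a \<theta>) = hact X (dm a) m \<theta> (col_res A n m x a)" if "a \<in> A" "\<theta> \<in> ops k (dm a)" for a k \<theta>
    using that h_h[OF o that(2) x] complex_ocomp[OF A(1) that] by (simp add: col_res_def)
qed

lemma smap_col_res: 
  assumes A: "complex A" "A \<subseteq> cx {{..n}}" shows "smap (col n) (Mc X A) (col_res A n)"
  unfolding smap_def
proof (intro conjI allI ballI)
  fix m x assume "x \<in> cells (col n) m" then show "col_res A n m x \<in> cells (Mc X A) m" using cr_in[OF A] by simp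
next
  fix m k \<theta> x assume t: "\<theta> \<in> ops m k" and x: "x \<in> cells (col n) k"
  show "col_res A n m (act (col n) k \<theta> x) = act (Mc X A) k \<theta> (col_res A n k x)"
    unfolding col_res_def act_Mc act_col
  proof (rule restrict_ext)
    fix a assume "a \<in> A"
    then have "a \<in> ops (dm a) n" using A(2) cx_ops by blast
    then show "hact X n m a (vact X n k \<theta> x) = vact X (dm a) k \<theta> (restrict (\<lambda>a. hact X n k a x) A a)"
      using h_v[OF _ t] x \<open>a \<in> A\<close> by simp
  qed
qed

lemma sset_iso_cr: "sset_iso (col n) (Mc X (cx {{..n}})) (col_res (cx {{..n}}) n)"
  unfolding sset_iso_def
proof (intro conjI allI)
  let ?A = "cx {{..n}}"
  have id: "idop n \<in> ?A" using idop_ops[of n] dm_ops[OF idop_ops[of n]] by (simp add: cx_ops)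
  show "smap (col n) (Mc X ?A) (col_res ?A n)" by (rule smap_col_res) auto
  fix m show "bij_betw (col_res ?A n m) (cells (col n) m) (cells (Mc X ?A) m)"
  proof (rule bij_betw_imageI)
    show "inj_on (col_res ?A n m) (cells (col n) m)"
    proof (rule inj_onI)
      fix x y assume x: "x \<in> cells (col n) m" and y: "y \<in> cells (col n) m" and eq: "col_res ?A n m x = col_res ?A n m y"
      show "x = y" using fun_cong[OF eq, of "idop n"] id h_id[of x n m] h_id[of y n m] x y by (simp add: col_res_def)
    qed
    show "col_res ?A n m ` cells (col n) m = cells (Mc X ?A) m"
    proof (intro equalityI subsetI)
      fix F assume "F \<in> col_res ?A n m ` cells (col n) m" then show "F \<in> cells (Mc X ?A) m" using cr_in[of ?A n _ m] by auto
    next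
      fix F assume F: "F \<in> cells (Mc X ?A) m"
      have Fi: "F (idop n) \<in> bcells X n m" using Mc_in[OF F id] dm_ops[OF idop_ops[of n]] by simp
      have "col_res ?A n m (F (idop n)) = F"
      proof (rule Mc_eqI[OF cr_in[OF complex_cx order.refl Fi] F])
        fix a assume a: "a \<in> ?A"
        then have ao: "a \<in> ops (dm a) n" by (simp add: cx_ops)
        then show "col_res ?A n m (F (idop n)) a = F a"
          using Mc_nat[OF F id, of a "dm a"] dm_ops[OF idop_ops[of n]] a by (simp add: col_res_def)
      qed
      then show "F \<in> col_res ?A n m ` cells (col n) m" using Fi by (metis cells_col imageI)
    qed
  qed
qed

lemma cr_square:
  assumes A: "complex A" "A \<subseteq> cx {{..n}}"
  shows "pullback_square (col n) (Mc X A) (col_res A n) (Mc X (cx {{..n}})) (Mc X A) (res A) (col_res (cx {{..n}}) n) (\<lambda>n x. x)"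
proof (rule sset_iso_pullback[OF sset_iso_cr _ smap_col_res[OF A] smap_res[OF A(2,1)]])
  show "sset_iso (Mc X A) (Mc X A) (\<lambda>n x. x)" unfolding sset_iso_def using smap_id by (auto intro: bij_betw_imageI)
  fix k x show "res A k (col_res (cx {{..n}}) n k x) = col_res A n k x"
    unfolding res_def col_res_def by (rule extensionalityI[of _ A]) (use A(2) in auto)
qed

lemma acyclic_fib_cr: "complex A \<Longrightarrow> A \<subseteq> cx {{..n}} \<Longrightarrow> acyclic_incl A (cx {{..n}}) \<Longrightarrow> acyclic_fib (col n) (Mc X A) (col_res A n)"
  unfolding acyclic_incl_def by (rule acyclic_fib_pullback[OF cr_square ss_col])
lemma kan_fib_cr: "complex A \<Longrightarrow> A \<subseteq> cx {{..n}} \<Longrightarrow> kan_incl A (cx {{..n}}) \<Longrightarrow> kan_fib (col n) (Mc X A) (col_res A n)"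
  unfolding kan_incl_def by (rule kan_fib_pullback[OF cr_square ss_col])

definition glueable :: "nat \<Rightarrow> nat \<Rightarrow> (nat list \<times> 'a) set \<Rightarrow> bool" where
  "glueable n m P \<longleftrightarrow> (\<forall>(e, x)\<in>P. facet e \<and> set e \<subseteq> {..n} \<and> x \<in> bcells X (dm e) m) \<and>
     (\<forall>(e, x)\<in>P. \<forall>(e', x')\<in>P. agree m e x e' x')"

lemma glueableD:
  assumes "glueable n m P" "(e, x) \<in> P"
  shows "facet e" "set e \<subseteq> {..n}" "x \<in> bcells X (dm e) m" "e \<in> ops (dm e) n"
proof -
  show 1: "facet e" "set e \<subseteq> {..n}" "x \<in> bcells X (dm e) m" using assms unfolding glueable_def by auto
  then show "e \<in> ops (dm e) n" using length_dm by (auto simp: facet_def ops_def)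
qed

lemma facet_cx_sub: "glueable n m P \<Longrightarrow> facet_cx P \<subseteq> cx {{..n}}"
  unfolding facet_cx_def by (rule cx_mono) (auto dest: glueableD)

text \<open>The target simplex of a lifting problem is replaced by its values on facets, so that
  later problems are posed with explicit edges and triangles and the cell of \<open>Mc\<close> stays
  hidden.\<close>

lemma glueable_lift:
  assumes L: "lift (col n) (Mc X (facet_cx P)) (col_res (facet_cx P) n) p I" and P: "glueable n (Suc p) P"
    and w: "compat (col n) p I w" and I: "I \<subseteq> {..Suc p}"
    and fw: "\<And>e x i. (e, x) \<in> P \<Longrightarrow> i \<in> I \<Longrightarrow> hact X n p e (w i) = face (col (dm e)) (Suc p) i x"
  obtains y where "y \<in> bcells X n (Suc p)" "\<And>i. i \<in> I \<Longrightarrow> face (col n) (Suc p) i y = w i" "\<And>e x. (e, x) \<in> P \<Longrightarrow> hact X n (Suc p) e y = x"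
proof -
  note sub = facet_cx_sub[OF P]
  note D = glueableD[OF P]
  obtain v where v: "v \<in> cells (Mc X (facet_cx P)) (Suc p)" "\<And>e x. (e, x) \<in> P \<Longrightarrow> v e = x"
    by (rule Mc_glue_facets[of P "Suc p"]) (use P in \<open>auto simp: glueable_def\<close>)
  have cre: "col_res (facet_cx P) n k y e = hact X n k e y" if "(e, x) \<in> P" for k y e x
    using facet_facet_cx[OF that D(1)[OF that]] by (simp add: col_res_def)
  have eq: "col_res (facet_cx P) n p (w i) = face (Mc X (facet_cx P)) (Suc p) i v" if i: "i \<in> I" for i
  proof -
    have ii: "i \<le> Suc p" using i I by auto
    have wi: "w i \<in> bcells X n p" using compat_in[OF w i] by simp
    have a: "col_res (facet_cx P) n p (w i) \<in> cells (Mc X (facet_cx P)) p" by (rule cr_in[OF complex_facet_cx sub wi])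
    have b: "face (Mc X (facet_cx P)) (Suc p) i v \<in> cells (Mc X (facet_cx P)) p" by (rule ss.face_in[OF ss_Mc[OF complex_facet_cx] ii v(1)])
    show ?thesis
    proof (rule Mc_facet_eqI[OF a b])
      fix e x assume e: "(e, x) \<in> P"
      show "facet e" by (rule D(1)[OF e])
      have "face (Mc X (facet_cx P)) (Suc p) i v e = vact X (dm e) (Suc p) (coface (Suc p) i) (v e)"
        using facet_facet_cx[OF e D(1)[OF e]] by (simp add: face_def act_Mc)
      also have "\<dots> = face (col (dm e)) (Suc p) i x" using v(2)[OF e] by (simp add: face_def act_col)
      finally show "col_res (facet_cx P) n p (w i) e = face (Mc X (facet_cx P)) (Suc p) i v e"
        using cre[OF e] fw[OF e i] by simp
    qed
  qed
  obtain y where y: "y \<in> cells (col n) (Suc p)" "col_res (facet_cx P) n (Suc p) y = v" "\<And>i. i \<in> I \<Longrightarrow> face (col n) (Suc p) i y = w i"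
    by (rule liftD[OF L w v(1) eq]) auto
  show thesis by (rule that) (use y v(2) cre in auto)
qed

end

context vf begin

lemma kan_incl_facet_cx: "finite P \<Longrightarrow> glueable n m P \<Longrightarrow> kan_incl (facet_cx P) (cx {{..n}})"
  unfolding facet_cx_def by (rule kan_incl_cx_sub) (use facet_cx_sub in \<open>auto simp: facet_cx_def\<close>)

lemma kan_lift:
  assumes "finite P" "glueable n (Suc p) P" "compat (col n) p ({..Suc p} - {k}) w" "k \<le> Suc p"
    "\<And>e x i. (e, x) \<in> P \<Longrightarrow> i \<le> Suc p \<Longrightarrow> i \<noteq> k \<Longrightarrow> hact X n p e (w i) = face (col (dm e)) (Suc p) i x"
  obtains y where "y \<in> bcells X n (Suc p)" "\<And>i. i \<le> Suc p \<Longrightarrow> i \<noteq> k \<Longrightarrow> face (col n) (Suc p) i y = w i" "\<And>e x. (e, x) \<in> P \<Longrightarrow> hact X n (Suc p) e y = x"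
proof -
  have "lift (col n) (Mc X (facet_cx P)) (col_res (facet_cx P) n) p ({..Suc p} - {k})"
    using kan_fib_cr[OF complex_facet_cx facet_cx_sub[OF assms(2)] kan_incl_facet_cx[OF assms(1,2)]] assms(4) unfolding kan_fib_def by blast
  then obtain y where "y \<in> bcells X n (Suc p)" "\<And>i. i \<in> {..Suc p} - {k} \<Longrightarrow> face (col n) (Suc p) i y = w i" "\<And>e x. (e, x) \<in> P \<Longrightarrow> hact X n (Suc p) e y = x"
    by (rule glueable_lift[OF _ assms(2,3)]) (use assms(5) in auto)
  then show thesis by (intro that) auto
qed

lemma acyclic_lift:
  assumes A: "acyclic_incl (facet_cx P) (cx {{..n}})" and "glueable n (Suc p) P" "compat (col n) p {..Suc p} w"
    "\<And>e x i. (e, x) \<in> P \<Longrightarrow> i \<le> Suc p \<Longrightarrow> hact X n p e (w i) = face (col (dm e)) (Suc p) i x"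
  obtains y where "y \<in> bcells X n (Suc p)" "\<And>i. i \<le> Suc p \<Longrightarrow> face (col n) (Suc p) i y = w i" "\<And>e x. (e, x) \<in> P \<Longrightarrow> hact X n (Suc p) e y = x"
proof -
  have "lift (col n) (Mc X (facet_cx P)) (col_res (facet_cx P) n) p {..Suc p}"
    using acyclic_fib_cr[OF complex_facet_cx facet_cx_sub[OF assms(2)] A] unfolding acyclic_fib_def by blast
  then obtain y where "y \<in> bcells X n (Suc p)" "\<And>i. i \<in> {..Suc p} \<Longrightarrow> face (col n) (Suc p) i y = w i" "\<And>e x. (e, x) \<in> P \<Longrightarrow> hact X n (Suc p) e y = x"
    by (rule glueable_lift[OF _ assms(2,3)]) (use assms(4) in auto)
  then show thesis by (intro that) auto
qed

lemma acyclic_lift_vertex: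
  assumes A: "acyclic_incl (facet_cx P) (cx {{..n}})" and P: "glueable n 0 P"
  obtains y where "y \<in> bcells X n 0" "\<And>e x. (e, x) \<in> P \<Longrightarrow> hact X n 0 e y = x"
proof -
  obtain v where v: "v \<in> cells (Mc X (facet_cx P)) 0" "\<And>e x. (e, x) \<in> P \<Longrightarrow> v e = x"
    by (rule Mc_glue_facets[of P 0]) (use P in \<open>auto simp: glueable_def\<close>)
  obtain y where y: "y \<in> cells (col n) 0" "col_res (facet_cx P) n 0 y = v"
    using surj_verticesD[OF acyclic_fib_surj_vertices[OF acyclic_fib_cr[OF complex_facet_cx facet_cx_sub[OF P] A]] v(1)] by blast
  have "hact X n 0 e y = x" if "(e, x) \<in> P" for e x
    using facet_facet_cx[OF that glueableD(1)[OF P that]] v(2)[OF that] y(2) by (auto simp: col_res_def)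
  then show thesis using that y(1) by simp
qed

end

declare One_nat_def [simp del]

lemma dm_simps [simp]: "dm [a] = 0" "dm [a, b] = 1" "dm [a, b, c] = 2" by (simp_all add: dm_def)
lemma ops_simps [simp]:
  "[a] \<in> ops 0 n \<longleftrightarrow> a \<le> n" "[a, b] \<in> ops 1 n \<longleftrightarrow> a \<le> b \<and> b \<le> n" "[a, b, c] \<in> ops 2 n \<longleftrightarrow> a \<le> b \<and> b \<le> c \<and> c \<le> n"
  by (auto simp: ops_def One_nat_def numeral_2_eq_2)
lemma ocomp_simps [simp]: "ocomp xs [] = []" "ocomp xs (i # is) = xs ! i # ocomp xs is" by (simp_all add: ocomp_def)

lemma coface_simps [simp]:
  "coface 1 0 = [1]" "coface 1 1 = [0]" "coface 2 0 = [1, 2]" "coface 2 1 = [0, 2]" "coface 2 2 = [0, 1]"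
  by (simp_all add: coface_def One_nat_def numeral_2_eq_2)
lemma collapse_simps [simp]: "collapse 0 = [0]" "collapse 1 = [0, 0]" by (simp_all add: collapse_def One_nat_def)

section \<open>Low-dimensional lifting\<close>

context bss begin

lemma h_in_list [simp]:
  "x \<in> bcells X n m \<Longrightarrow> i \<le> n \<Longrightarrow> hact X n m [i] x \<in> bcells X 0 m"
  "x \<in> bcells X n m \<Longrightarrow> i \<le> j \<Longrightarrow> j \<le> n \<Longrightarrow> hact X n m [i, j] x \<in> bcells X 1 m"
  "x \<in> bcells X n m \<Longrightarrow> i \<le> j \<Longrightarrow> j \<le> k \<Longrightarrow> k \<le> n \<Longrightarrow> hact X n m [i, j, k] x \<in> bcells X 2 m"
  by (simp_all add: h_in)

lemma h_h_list [simp]: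
  "x \<in> bcells X n m \<Longrightarrow> i \<le> n \<Longrightarrow> hact X 0 m [0, 0] (hact X n m [i] x) = hact X n m [i, i] x"
  "x \<in> bcells X n m \<Longrightarrow> i \<le> j \<Longrightarrow> j \<le> n \<Longrightarrow> a \<le> 1 \<Longrightarrow> hact X 1 m [a] (hact X n m [i, j] x) = hact X n m [[i, j] ! a] x"
  "x \<in> bcells X n m \<Longrightarrow> i \<le> j \<Longrightarrow> j \<le> n \<Longrightarrow> a \<le> b \<Longrightarrow> b \<le> 1 \<Longrightarrow> hact X 1 m [a, b] (hact X n m [i, j] x) = hact X n m [[i, j] ! a, [i, j] ! b] x"
  "x \<in> bcells X n m \<Longrightarrow> i \<le> j \<Longrightarrow> j \<le> k \<Longrightarrow> k \<le> n \<Longrightarrow> a \<le> 2 \<Longrightarrow> hact X 2 m [a] (hact X n m [i, j, k] x) = hact X n m [[i, j, k] ! a] x"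
  "x \<in> bcells X n m \<Longrightarrow> i \<le> j \<Longrightarrow> j \<le> k \<Longrightarrow> k \<le> n \<Longrightarrow> a \<le> b \<Longrightarrow> b \<le> 2 \<Longrightarrow>
     hact X 2 m [a, b] (hact X n m [i, j, k] x) = hact X n m [[i, j, k] ! a, [i, j, k] ! b] x"
  using h_h[of "[i]" 0 n "[0, 0]" 1 x m] h_h[of "[i, j]" 1 n "[a]" 0 x m] h_h[of "[i, j]" 1 n "[a, b]" 1 x m]
    h_h[of "[i, j, k]" 2 n "[a]" 0 x m] h_h[of "[i, j, k]" 2 n "[a, b]" 1 x m] by auto

lemma h_const_list [simp]:
  "x \<in> bcells X n 0 \<Longrightarrow> i \<le> n \<Longrightarrow> hact X n m [i] (const_simplex (col n) x m) = const_simplex (col 0) (hact X n 0 [i] x) m"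
  "x \<in> bcells X n 0 \<Longrightarrow> i \<le> j \<Longrightarrow> j \<le> n \<Longrightarrow> hact X n m [i, j] (const_simplex (col n) x m) = const_simplex (col 1) (hact X n 0 [i, j] x) m"
  "x \<in> bcells X n 0 \<Longrightarrow> i \<le> j \<Longrightarrow> j \<le> k \<Longrightarrow> k \<le> n \<Longrightarrow> hact X n m [i, j, k] (const_simplex (col n) x m) = const_simplex (col 2) (hact X n 0 [i, j, k] x) m"
  by (simp_all add: h_const)

lemma facet_simps [simp]: "facet [a]" "facet [a, b] \<longleftrightarrow> a < b" "facet [a, b, c] \<longleftrightarrow> a < b \<and> b < c"
  by (auto simp: facet_def)

lemma glueable_insertI:
  assumes "glueable n m P" "facet e" "set e \<subseteq> {..n}" "x \<in> bcells X (dm e) m" "\<And>e' x'. (e', x') \<in> P \<Longrightarrow> agree m e x e' x'"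
  shows "glueable n m (insert (e, x) P)"
  using assms agree_self[OF assms(2)] agree_sym[OF assms(5)] unfolding glueable_def by auto

lemma glueable_empty: "glueable n m {}" unfolding glueable_def by simp

lemma h_edge [simp]: "hact X n m [0, 1] x = x" if "x \<in> bcells X 1 m" "n = 1"
  using h_id[OF that(1)] that(2) by (simp add: idop_def One_nat_def)

section \<open>Matching conditions for data on subcomplexes of the 2- and 3-simplex\<close>

lemma glue_spine2:
  assumes "f \<in> bcells X 1 m" "g \<in> bcells X 1 m" "hact X 1 m [1] f = hact X 1 m [0] g"
  shows "glueable 2 m {([0,1], f), ([1,2], g)}"
proof -
  have "agree m [0,1] f [1,2] g" by (rule agreeI[where \<alpha>="[1]" and \<alpha>'="[0]" and l=0]) (use assms in auto)
  then show ?thesis using assms by (intro glueable_insertI glueable_empty) auto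
qed

lemma glue_corolla2:
  assumes "f \<in> bcells X 1 m" "h \<in> bcells X 1 m" "hact X 1 m [0] f = hact X 1 m [0] h"
  shows "glueable 2 m {([0,1], f), ([0,2], h)}"
proof -
  have "agree m [0,1] f [0,2] h" by (rule agreeI[where \<alpha>="[0]" and \<alpha>'="[0]" and l=0]) (use assms in auto)
  then show ?thesis using assms by (intro glueable_insertI glueable_empty) auto
qed

lemma glue_boundary2:
  assumes "f \<in> bcells X 1 m" "g \<in> bcells X 1 m" "h \<in> bcells X 1 m"
    "hact X 1 m [1] f = hact X 1 m [0] g" "hact X 1 m [0] f = hact X 1 m [0] h" "hact X 1 m [1] g = hact X 1 m [1] h"
  shows "glueable 2 m {([0,1], f), ([1,2], g), ([0,2], h)}"
proof -
  have "agree m [0,1] f [1,2] g" by (rule agreeI[where \<alpha>="[1]" and \<alpha>'="[0]" and l=0]) (use assms in auto)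
  moreover have "agree m [0,1] f [0,2] h" by (rule agreeI[where \<alpha>="[0]" and \<alpha>'="[0]" and l=0]) (use assms in auto)
  moreover have "agree m [1,2] g [0,2] h" by (rule agreeI[where \<alpha>="[1]" and \<alpha>'="[1]" and l=0]) (use assms in auto)
  ultimately show ?thesis using assms by (intro glueable_insertI glueable_empty) auto
qed

lemma glue_spine3:
  assumes "f \<in> bcells X 1 m" "g \<in> bcells X 1 m" "h \<in> bcells X 1 m"
    "hact X 1 m [1] f = hact X 1 m [0] g" "hact X 1 m [1] g = hact X 1 m [0] h"
  shows "glueable 3 m {([0,1], f), ([1,2], g), ([2,3], h)}"
proof -
  have "agree m [0,1] f [1,2] g" by (rule agreeI[where \<alpha>="[1]" and \<alpha>'="[0]" and l=0]) (use assms in auto)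
  moreover have "agree m [0,1] f [2,3] h" by (rule agree_disjoint) auto
  moreover have "agree m [1,2] g [2,3] h" by (rule agreeI[where \<alpha>="[1]" and \<alpha>'="[0]" and l=0]) (use assms in auto)
  ultimately show ?thesis using assms by (intro glueable_insertI glueable_empty) auto
qed

lemma agree_012_023: "t \<in> bcells X 2 m \<Longrightarrow> r \<in> bcells X 2 m \<Longrightarrow> hact X 2 m [0,2] t = hact X 2 m [0,1] r \<Longrightarrow> agree m [0,1,2] t [0,2,3] r"
  by (rule agreeI[where \<alpha>="[0,2]" and \<alpha>'="[0,1]" and l=1]) auto
lemma agree_012_123: "t \<in> bcells X 2 m \<Longrightarrow> r \<in> bcells X 2 m \<Longrightarrow> hact X 2 m [1,2] t = hact X 2 m [0,1] r \<Longrightarrow> agree m [0,1,2] t [1,2,3] r"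
  by (rule agreeI[where \<alpha>="[1,2]" and \<alpha>'="[0,1]" and l=1]) auto
lemma agree_023_123: "t \<in> bcells X 2 m \<Longrightarrow> r \<in> bcells X 2 m \<Longrightarrow> hact X 2 m [1,2] t = hact X 2 m [1,2] r \<Longrightarrow> agree m [0,2,3] t [1,2,3] r"
  by (rule agreeI[where \<alpha>="[1,2]" and \<alpha>'="[1,2]" and l=1]) auto
lemma agree_012_013: "t \<in> bcells X 2 m \<Longrightarrow> r \<in> bcells X 2 m \<Longrightarrow> hact X 2 m [0,1] t = hact X 2 m [0,1] r \<Longrightarrow> agree m [0,1,2] t [0,1,3] r"
  by (rule agreeI[where \<alpha>="[0,1]" and \<alpha>'="[0,1]" and l=1]) auto
lemma agree_123_013: "t \<in> bcells X 2 m \<Longrightarrow> r \<in> bcells X 2 m \<Longrightarrow> hact X 2 m [0,2] t = hact X 2 m [1,2] r \<Longrightarrow> agree m [1,2,3] t [0,1,3] r"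
  by (rule agreeI[where \<alpha>="[0,2]" and \<alpha>'="[1,2]" and l=1]) auto
lemma agree_013_023: "t \<in> bcells X 2 m \<Longrightarrow> r \<in> bcells X 2 m \<Longrightarrow> hact X 2 m [0,2] t = hact X 2 m [0,2] r \<Longrightarrow> agree m [0,1,3] t [0,2,3] r"
  by (rule agreeI[where \<alpha>="[0,2]" and \<alpha>'="[0,2]" and l=1]) auto

lemma glue_012_023:
  assumes "t \<in> bcells X 2 m" "r \<in> bcells X 2 m" "hact X 2 m [0,2] t = hact X 2 m [0,1] r"
  shows "glueable 3 m {([0,1,2], t), ([0,2,3], r)}"
  using assms agree_012_023 by (intro glueable_insertI glueable_empty) auto

lemma glue_013_023:
  assumes "t \<in> bcells X 2 m" "r \<in> bcells X 2 m" "hact X 2 m [0,2] t = hact X 2 m [0,2] r"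
  shows "glueable 3 m {([0,1,3], t), ([0,2,3], r)}"
  using assms agree_013_023 by (intro glueable_insertI glueable_empty) auto

lemma glue_horn2:
  assumes "t \<in> bcells X 2 m" "r \<in> bcells X 2 m" "x \<in> bcells X 2 m"
    "hact X 2 m [0,2] t = hact X 2 m [0,1] r" "hact X 2 m [1,2] t = hact X 2 m [0,1] x" "hact X 2 m [1,2] r = hact X 2 m [1,2] x"
  shows "glueable 3 m {([0,1,2], t), ([0,2,3], r), ([1,2,3], x)}"
  using assms agree_012_023 agree_012_123 agree_023_123 by (intro glueable_insertI glueable_empty) auto

lemma glue_horn1:
  assumes "t \<in> bcells X 2 m" "x \<in> bcells X 2 m" "s \<in> bcells X 2 m"
    "hact X 2 m [1,2] t = hact X 2 m [0,1] x" "hact X 2 m [0,1] t = hact X 2 m [0,1] s" "hact X 2 m [0,2] x = hact X 2 m [1,2] s"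
  shows "glueable 3 m {([0,1,2], t), ([1,2,3], x), ([0,1,3], s)}"
  using assms agree_012_123 agree_012_013 agree_123_013 by (intro glueable_insertI glueable_empty) auto

end

context vf begin

text \<open>Homotopy extension: a path starts at \<open>x\<close>, since $d_1$ of an edge is its
  source, and follows prescribed paths on the facets. Its end is free.\<close>

lemma kan_lift_edge:
  assumes P: "finite P" "glueable n 1 P" and x: "x \<in> bcells X n 0"
    and e: "\<And>e z. (e, z) \<in> P \<Longrightarrow> hact X n 0 e x = face (col (dm e)) 1 1 z"
  obtains y where "y \<in> bcells X n 1" "face (col n) 1 1 y = x" "\<And>e z. (e, z) \<in> P \<Longrightarrow> hact X n 1 e y = z"
proof -
  have c: "compat (col n) 0 ({..Suc 0} - {0}) (\<lambda>_. x)" by (rule compatI) (use x in auto)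
  obtain y where y: "y \<in> bcells X n (Suc 0)" "\<And>i. i \<le> Suc 0 \<Longrightarrow> i \<noteq> 0 \<Longrightarrow> face (col n) (Suc 0) i y = x" "\<And>e z. (e, z) \<in> P \<Longrightarrow> hact X n (Suc 0) e y = z"
  proof (rule kan_lift[OF P(1) P(2)[unfolded One_nat_def] c])
    show "hact X n 0 e' x = face (col (dm e')) (Suc 0) i z" if "(e', z) \<in> P" "i \<le> Suc 0" "i \<noteq> 0" for e' z i
    proof -
      have "i = 1" using that by auto
      then show ?thesis using e[OF that(1)] by (simp add: One_nat_def)
    qed
  qed auto
  show thesis by (rule that) (use y(1) y(2)[of 1] y(3) in \<open>auto simp: One_nat_def\<close>)
qed

lemma acyclic_lift_edge:
  assumes A: "acyclic_incl (facet_cx P) (cx {{..n}})" and P: "glueable n 1 P" and x: "x \<in> bcells X n 0" "x' \<in> bcells X n 0"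
    and e: "\<And>e z. (e, z) \<in> P \<Longrightarrow> hact X n 0 e x = face (col (dm e)) 1 1 z" "\<And>e z. (e, z) \<in> P \<Longrightarrow> hact X n 0 e x' = face (col (dm e)) 1 0 z"
  obtains y where "y \<in> bcells X n 1" "face (col n) 1 1 y = x" "face (col n) 1 0 y = x'" "\<And>e z. (e, z) \<in> P \<Longrightarrow> hact X n 1 e y = z"
proof -
  let ?w = "\<lambda>i::nat. if i = 0 then x' else x"
  have c: "compat (col n) 0 {..Suc 0} ?w" by (rule compatI) (use x in auto)
  obtain y where y: "y \<in> bcells X n (Suc 0)" "\<And>i. i \<le> Suc 0 \<Longrightarrow> face (col n) (Suc 0) i y = ?w i" "\<And>e z. (e, z) \<in> P \<Longrightarrow> hact X n (Suc 0) e y = z"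
  proof (rule acyclic_lift[OF A P(1)[unfolded One_nat_def] c])
    show "hact X n 0 e' (?w i) = face (col (dm e')) (Suc 0) i z" if "(e', z) \<in> P" "i \<le> Suc 0" for e' z i
    proof -
      have "i = 0 \<or> i = 1" using that by auto
      then show ?thesis using e[OF that(1)] by (auto simp: One_nat_def)
    qed
  qed auto
  show thesis by (rule that) (use y(1) y(2)[of 1] y(2)[of 0] y(3) in \<open>auto simp: One_nat_def\<close>)
qed

lemmas col_c_in = ss.const_in[OF ss_col, simplified]
lemmas col_c0 = ss.const_0[OF ss_col, simplified]

lemma col_const_face: 
  assumes "x \<in> bcells X n 0" shows "face (col n) 1 1 (const_simplex (col n) x 1) = x" "face (col n) 1 0 (const_simplex (col n) x 1) = x"
  using ss.face_const[OF ss_col, of x n _ 0] assms col_c0 by (auto simp: One_nat_def)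

lemma facet_cx_spine2: "facet_cx {([0,1], f), ([1,2], g)} = spine_cx 2"
proof -
  have "(\<lambda>i. {i, Suc i}) ` {..<2} = {{0, 1}, {1, 2::nat}}" by (auto simp: numeral_2_eq_2 lessThan_Suc)
  then show ?thesis by (simp add: spine_cx_def facet_cx_def)
qed

section \<open>Mapping spaces and homotopy classes of arrows\<close>

lemma cells_MS: "e \<in> cells (mapping_space X x y) m \<longleftrightarrow>
    e \<in> bcells X 1 m \<and> hact X 1 m [0] e = const_simplex (col 0) x m \<and> hact X 1 m [1] e = const_simplex (col 0) y m"
  by (simp add: mapping_space_def hface_def hact_def)

lemma act_MS [simp]: "act (mapping_space X x y) = act (col 1)" by (simp add: mapping_space_def)
lemma face_MS [simp]: "face (mapping_space X x y) = face (col 1)" by (simp add: face_def fun_eq_iff)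

lemma ss_MS: 
  assumes x: "x \<in> bcells X 0 0" "y \<in> bcells X 0 0" shows "ss (mapping_space X x y)"
proof
  show "act (mapping_space X x y) n \<theta> e \<in> cells (mapping_space X x y) m" if t: "\<theta> \<in> ops m n" and e: "e \<in> cells (mapping_space X x y) n" for m n \<theta> e
    using e ss.act_const[OF ss_col, of x 0 \<theta> m n] ss.act_const[OF ss_col, of y 0 \<theta> m n] x v_in[OF t] h_v[OF _ t, of "[0]" 0 1 e] h_v[OF _ t, of "[1]" 0 1 e] t
    by (simp add: cells_MS act_col)
  show "act (mapping_space X x y) n (idop n) e = e" if "e \<in> cells (mapping_space X x y) n" for n e
    using that by (simp add: cells_MS act_col v_id)
  show "act (mapping_space X x y) m \<phi> (act (mapping_space X x y) n \<theta> e) = act (mapping_space X x y) n (ocomp \<theta> \<phi>) e"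
    if "\<phi> \<in> ops l m" "\<theta> \<in> ops m n" "e \<in> cells (mapping_space X x y) n" for l m n \<phi> \<theta> e
    using that by (simp add: cells_MS act_col v_v)
qed

text \<open>The mapping space is a fibre of X_1 over its two end vertices. Horns are lifted with
  constant values prescribed at both ends, which keeps the filler in the fibre. Consequently
  homotopy of arrows is witnessed by one edge (\<open>hom_rel_iff\<close>).\<close>

lemma kan_complex_MS:
  assumes x: "x \<in> bcells X 0 0" "y \<in> bcells X 0 0" shows "kan_complex (mapping_space X x y)"
  unfolding kan_complex_def
proof (intro allI impI)
  let ?M = "mapping_space X x y"
  fix p k w assume k: "k \<le> Suc p" and w: "compat ?M p ({..Suc p} - {k}) w"
  let ?P = "{([0], const_simplex (col 0) x (Suc p)), ([1], const_simplex (col 0) y (Suc p))}"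
  have wi: "w i \<in> cells ?M p" if "i \<in> {..Suc p} - {k}" for i using compat_in[OF w that] .
  have c: "compat (col 1) p ({..Suc p} - {k}) w" using w unfolding compat_def by (auto simp: cells_MS)
  have "agree (Suc p) [0] (const_simplex (col 0) x (Suc p)) [1] (const_simplex (col 0) y (Suc p))" by (rule agree_disjoint) auto
  then have P: "glueable 1 (Suc p) ?P" using col_c_in x by (intro glueable_insertI glueable_empty) auto
  obtain e where e: "e \<in> bcells X 1 (Suc p)" "\<And>i. i \<le> Suc p \<Longrightarrow> i \<noteq> k \<Longrightarrow> face (col 1) (Suc p) i e = w i"
    "\<And>e' z. (e', z) \<in> ?P \<Longrightarrow> hact X 1 (Suc p) e' e = z"
  proof (rule kan_lift[OF _ P c k])
    fix e' :: "nat list" and z i assume "(e', z) \<in> ?P" "i \<le> Suc p" "i \<noteq> k"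
    then show "hact X 1 p e' (w i) = face (col (dm e')) (Suc p) i z"
      using wi[of i] ss.face_const[OF ss_col, of x 0 i p] ss.face_const[OF ss_col, of y 0 i p] x by (auto simp: cells_MS)
  qed auto
  then show "\<exists>e\<in>cells ?M (Suc p). \<forall>i\<in>{..Suc p} - {k}. face ?M (Suc p) i e = w i"
    by (intro bexI[of _ e]) (auto simp: cells_MS)
qed

definition arr_htpy :: "'a \<Rightarrow> 'a \<Rightarrow> 'a \<Rightarrow> 'a \<Rightarrow> 'a \<Rightarrow> bool" where
  "arr_htpy x y f g h \<longleftrightarrow> h \<in> bcells X 1 1 \<and> hact X 1 1 [0] h = const_simplex (col 0) x 1 \<and> hact X 1 1 [1] h = const_simplex (col 0) y 1 \<and>
     face (col 1) 1 1 h = f \<and> face (col 1) 1 0 h = g"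

abbreviation hom_rel :: "'a \<Rightarrow> 'a \<Rightarrow> ('a \<times> 'a) set" where "hom_rel x y \<equiv> pi0_rel (mapping_space X x y)"

lemma hom_rel_iff: "x \<in> bcells X 0 0 \<Longrightarrow> y \<in> bcells X 0 0 \<Longrightarrow> (f, g) \<in> hom_rel x y \<longleftrightarrow> (\<exists>h. arr_htpy x y f g h)"
  unfolding ss.pi0_kan[OF ss_MS kan_complex_MS] edge_rel_def arr_htpy_def by (auto simp: cells_MS)

definition arr :: "'a \<Rightarrow> 'a \<Rightarrow> 'a \<Rightarrow> bool" where
  "arr x y f \<longleftrightarrow> f \<in> bcells X 1 0 \<and> hact X 1 0 [0] f = x \<and> hact X 1 0 [1] f = y \<and> x \<in> bcells X 0 0 \<and> y \<in> bcells X 0 0"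

lemma arrI: "f \<in> bcells X 1 0 \<Longrightarrow> arr (hact X 1 0 [0] f) (hact X 1 0 [1] f) f"
  unfolding arr_def using h_in[of _ 0 1] by auto

lemma arr_MS: "x \<in> bcells X 0 0 \<Longrightarrow> y \<in> bcells X 0 0 \<Longrightarrow> f \<in> cells (mapping_space X x y) 0 \<longleftrightarrow> arr x y f"
  by (auto simp: cells_MS arr_def col_c0)

lemma hom_rel_arr:
  assumes "x \<in> bcells X 0 0" "y \<in> bcells X 0 0" "(f, g) \<in> hom_rel x y" shows "arr x y f" "arr x y g"
  using assms(3) arr_MS[OF assms(1,2)] unfolding pi0_rel_edge by auto

lemma hom_equiv: 
  assumes "x \<in> bcells X 0 0" "y \<in> bcells X 0 0" shows "equiv {f. arr x y f} (hom_rel x y)"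
proof -
  have "{f. arr x y f} = cells (mapping_space X x y) 0" using arr_MS[OF assms] by blast
  then show ?thesis using pi0_equiv[of "mapping_space X x y"] by simp
qed

lemma hom_rel_refl: "arr x y f \<Longrightarrow> (f, f) \<in> hom_rel x y"
  by (rule refl_onD[OF equivE[OF hom_equiv]]) (auto simp: arr_def)

text \<open>\<open>tri f g h s\<close>: the 2-simplex \<open>s\<close> exhibits \<open>h\<close> as a composite of \<open>f\<close> and then \<open>g\<close>.\<close>

definition tri :: "'a \<Rightarrow> 'a \<Rightarrow> 'a \<Rightarrow> 'a \<Rightarrow> bool" where
  "tri f g h s \<longleftrightarrow> s \<in> bcells X 2 0 \<and> hact X 2 0 [0,1] s = f \<and> hact X 2 0 [1,2] s = g \<and> hact X 2 0 [0,2] s = h"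

lemma tri_arr: assumes "tri f g h s" "arr x y f" "arr y' z g" shows "y' = y" "arr x z h"
proof -
  have s: "s \<in> bcells X 2 0" using assms by (simp add: tri_def)
  have "hact X 1 0 [1] f = hact X 2 0 [1] s" "hact X 1 0 [0] g = hact X 2 0 [1] s"
    "hact X 1 0 [0] h = hact X 2 0 [0] s" "hact X 1 0 [0] f = hact X 2 0 [0] s"
    "hact X 1 0 [1] h = hact X 2 0 [2] s" "hact X 1 0 [1] g = hact X 2 0 [2] s" "h \<in> bcells X 1 0"
    using assms(1) s by (auto simp: tri_def)
  then show "y' = y" "arr x z h" using assms(2,3) by (auto simp: arr_def)
qed

text \<open>The homotopy from \<open>h\<close> to \<open>h'\<close>, with \<open>f\<close> and
  \<open>g\<close> kept constant, is a path of boundaries starting at that of \<open>s\<close>.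
  Lifting it to a path from \<open>s\<close> in X_2 ends at a 2-simplex with the new edge on the
  nose.\<close>

lemma tri_strictify:
  assumes s: "tri f g h s" and f: "arr x y f" and g: "arr y z g" and h: "(h, h') \<in> hom_rel x z"
  obtains s' where "tri f g h' s'"
proof -
  have xyz: "x \<in> bcells X 0 0" "y \<in> bcells X 0 0" "z \<in> bcells X 0 0" using f g by (auto simp: arr_def)
  obtain H where H: "arr_htpy x z h h' H" using h hom_rel_iff[OF xyz(1,3)] by blast
  let ?c = "\<lambda>f. const_simplex (col 1) f 1"
  have fc: "f \<in> bcells X 1 0" "g \<in> bcells X 1 0" using f g by (auto simp: arr_def)
  have P: "glueable 2 1 {([0,1], ?c f), ([1,2], ?c g), ([0,2], H)}"
    by (rule glue_boundary2) (use fc col_c_in f g H in \<open>auto simp: arr_def arr_htpy_def\<close>)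
  obtain y where y: "y \<in> bcells X 2 1" "face (col 2) 1 1 y = s"
    "\<And>e z. (e, z) \<in> {([0,1], ?c f), ([1,2], ?c g), ([0,2], H)} \<Longrightarrow> hact X 2 1 e y = z"
  proof (rule kan_lift_edge[OF _ P, of s])
    show "s \<in> bcells X 2 0" using s by (simp add: tri_def)
    fix e :: "nat list" and z assume "(e, z) \<in> {([0,1], ?c f), ([1,2], ?c g), ([0,2], H)}"
    then show "hact X 2 0 e s = face (col (dm e)) 1 1 z" using s fc H col_const_face by (auto simp: tri_def arr_htpy_def)
  qed auto
  let ?s = "face (col 2) 1 0 y"
  have f0: "hact X 2 0 e ?s = face (col 1) 1 0 (hact X 2 1 e y)" if "e \<in> ops 1 2" for e
    using h_face[OF that, of 0 0 y] y(1) by (simp add: One_nat_def)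
  have "?s \<in> bcells X 2 0" using ss.face_in[OF ss_col, of 0 0 y 2] y(1) by (simp add: One_nat_def)
  then have "tri f g h' ?s" using f0 y(3) col_const_face fc H by (auto simp: tri_def arr_htpy_def)
  then show thesis by (rule that)
qed

end

section \<open>The homotopy category of a Segal space\<close>

context bss begin

lemma h_id0 [simp]: "x \<in> bcells X 0 m \<Longrightarrow> hact X 0 m [0] x = x"
  using h_id[of x 0 m] by (simp add: idop_def)

lemma face_col_in: "x \<in> bcells X n 1 \<Longrightarrow> i \<le> 1 \<Longrightarrow> face (col n) 1 i x \<in> bcells X n 0"
  using ss.face_in[OF ss_col, of i 0 x n] by (simp add: One_nat_def)

lemma h_face_list [simp]:
  "x \<in> bcells X n 1 \<Longrightarrow> i \<le> n \<Longrightarrow> c \<le> 1 \<Longrightarrow> hact X n 0 [i] (face (col n) 1 c x) = face (col 0) 1 c (hact X n 1 [i] x)"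
  "x \<in> bcells X n 1 \<Longrightarrow> i \<le> j \<Longrightarrow> j \<le> n \<Longrightarrow> c \<le> 1 \<Longrightarrow> hact X n 0 [i, j] (face (col n) 1 c x) = face (col 1) 1 c (hact X n 1 [i, j] x)"
  "x \<in> bcells X n 1 \<Longrightarrow> i \<le> j \<Longrightarrow> j \<le> k \<Longrightarrow> k \<le> n \<Longrightarrow> c \<le> 1 \<Longrightarrow> hact X n 0 [i, j, k] (face (col n) 1 c x) = face (col 2) 1 c (hact X n 1 [i, j, k] x)"
  using h_face[of "[i]" 0 n c 0 x, folded One_nat_def] h_face[of "[i, j]" 1 n c 0 x, folded One_nat_def]
    h_face[of "[i, j, k]" 2 n c 0 x, folded One_nat_def] by simp_all

lemma cells_sp: "(f, g) \<in> cells (segal_product X) m \<longleftrightarrow> f \<in> bcells X 1 m \<and> g \<in> bcells X 1 m \<and> hact X 1 m [1] f = hact X 1 m [0] g"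
  by (simp add: segal_product_def hface_def hact_def)

lemma act_sp: "act (segal_product X) m \<phi> (f, g) = (vact X 1 m \<phi> f, vact X 1 m \<phi> g)"
  by (simp add: segal_product_def act_col)

lemma ss_sp: "ss (segal_product X)"
proof
  fix m n \<theta> p assume t: "\<theta> \<in> ops m n" and p: "p \<in> cells (segal_product X) n"
  obtain f g where "p = (f, g)" by (cases p)
  then show "act (segal_product X) n \<theta> p \<in> cells (segal_product X) m"
    using p t v_in[OF t] h_v[OF _ t, of "[1]" 0 1 f] h_v[OF _ t, of "[0]" 0 1 g] by (simp add: act_sp cells_sp)
next
  fix n p assume p: "p \<in> cells (segal_product X) n"
  obtain f g where "p = (f, g)" by (cases p)
  then show "act (segal_product X) n (idop n) p = p" using p v_id by (simp add: act_sp cells_sp)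
next
  fix l m n \<phi> \<theta> p assume t: "\<phi> \<in> ops l m" "\<theta> \<in> ops m n" and p: "p \<in> cells (segal_product X) n"
  obtain f g where "p = (f, g)" by (cases p)
  then show "act (segal_product X) m \<phi> (act (segal_product X) n \<theta> p) = act (segal_product X) n (ocomp \<theta> \<phi>) p"
    using p v_v[OF t(2,1)] by (simp add: act_sp cells_sp)
qed

lemma xi2_eq: "s \<in> bcells X 2 m \<Longrightarrow> xi2 X m s = (hact X 2 m [0,1] s, hact X 2 m [1,2] s)"
  by (simp add: xi2_def hface_def hact_def)

lemma smap_xi2: "smap (col 2) (segal_product X) (xi2 X)"
  unfolding smap_def
proof (intro conjI allI ballI)
  fix n s assume "s \<in> cells (col 2) n"
  then show "xi2 X n s \<in> cells (segal_product X) n" by (simp add: xi2_eq cells_sp)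
next
  fix m n \<theta> s assume t: "\<theta> \<in> ops m n" and s: "s \<in> cells (col 2) n"
  then show "xi2 X m (act (col 2) n \<theta> s) = act (segal_product X) n \<theta> (xi2 X n s)"
    using v_in[OF t] h_v[OF _ t, of "[0,1]" 1 2 s] h_v[OF _ t, of "[1,2]" 1 2 s] by (simp add: xi2_eq act_sp act_col)
qed

end

context segal begin

lemma acyclic_incl_spine2: "acyclic_incl (facet_cx {([0,1], f), ([1,2], g)}) (cx {{..2}})"
  unfolding facet_cx_spine2 by (rule segal) simp

text \<open>A simplex of the Segal product is the same datum as values on the facets 01 and 12 of
  the spine, so lifting against the spine inclusion applies.\<close>

lemma acyclic_fib_xi2: "acyclic_fib (col 2) (segal_product X) (xi2 X)"
  unfolding acyclic_fib_def
proof (intro conjI allI)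
  show "surj_vertices (col 2) (segal_product X) (xi2 X)" unfolding surj_vertices_def
  proof
    fix p assume p: "p \<in> cells (segal_product X) 0"
    obtain f g where fg: "p = (f, g)" by (cases p)
    have "glueable 2 0 {([0,1], f), ([1,2], g)}" by (rule glue_spine2) (use p fg in \<open>auto simp: cells_sp\<close>)
    then obtain s where "s \<in> bcells X 2 0" "\<And>e x. (e, x) \<in> {([0,1], f), ([1,2], g)} \<Longrightarrow> hact X 2 0 e s = x"
      by (rule acyclic_lift_vertex[OF acyclic_incl_spine2]) auto
    then show "\<exists>s\<in>cells (col 2) 0. xi2 X 0 s = p" using fg xi2_eq by (intro bexI[of _ s]) auto
  qed
  fix p show "lift (col 2) (segal_product X) (xi2 X) p {..Suc p}"
  proof (rule liftI)
    fix w v assume w: "compat (col 2) p {..Suc p} w" and v: "v \<in> cells (segal_product X) (Suc p)"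
      and fw: "\<And>i. i \<in> {..Suc p} \<Longrightarrow> xi2 X p (w i) = face (segal_product X) (Suc p) i v"
    obtain f g where fg: "v = (f, g)" by (cases v)
    have G: "glueable 2 (Suc p) {([0,1], f), ([1,2], g)}" by (rule glue_spine2) (use v fg in \<open>auto simp: cells_sp\<close>)
    have wf: "hact X 2 p [0,1] (w i) = face (col 1) (Suc p) i f \<and> hact X 2 p [1,2] (w i) = face (col 1) (Suc p) i g" if "i \<le> Suc p" for i
      using fw[of i] compat_in[OF w, of i] that by (simp add: xi2_eq face_def fg act_sp act_col)
    obtain s where "s \<in> bcells X 2 (Suc p)" "\<And>i. i \<le> Suc p \<Longrightarrow> face (col 2) (Suc p) i s = w i"
       "\<And>e x. (e, x) \<in> {([0,1], f), ([1,2], g)} \<Longrightarrow> hact X 2 (Suc p) e s = x"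
      by (rule acyclic_lift[OF acyclic_incl_spine2 G w]) (use wf in auto)
    then show "\<exists>s\<in>cells (col 2) (Suc p). xi2 X (Suc p) s = v \<and> (\<forall>i\<in>{..Suc p}. face (col 2) (Suc p) i s = w i)"
      using fg xi2_eq by (intro bexI[of _ s]) auto
  qed
qed (rule smap_xi2)

lemma eta2_section: "xi2_section X (eta2 X)"
proof -
  obtain g where "g \<in> sset_hom (segal_product X) (col 2)" "\<And>n b. b \<in> cells (segal_product X) n \<Longrightarrow> xi2 X n (g n b) = b"
    by (rule acyclic_fib_section[OF acyclic_fib_xi2 ss_col ss_sp]) auto
  then have "xi2_section X g" unfolding xi2_section_def by simp
  then show ?thesis unfolding eta2_def by (rule someI[of "xi2_section X"])
qed

text \<open>Arguments are in diagrammatic order: first \<open>f\<close>, then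
  \<open>g\<close>.\<close>

abbreviation cmp :: "'a \<Rightarrow> 'a \<Rightarrow> 'a" where "cmp f g \<equiv> hface X 2 1 0 (eta2 X 0 (f, g))"

lemma tri_cmp:
  assumes f: "arr x y f" and g: "arr y z g"
  shows "tri f g (cmp f g) (eta2 X 0 (f, g))"
proof -
  have p: "(f, g) \<in> cells (segal_product X) 0" using f g by (simp add: cells_sp arr_def)
  have s: "eta2 X 0 (f, g) \<in> bcells X 2 0" "xi2 X 0 (eta2 X 0 (f, g)) = (f, g)"
    using smap_in[OF sset_hom_smap p, of "eta2 X" "col 2"] eta2_section p unfolding xi2_section_def by auto
  then show ?thesis using xi2_eq[OF s(1)] by (simp add: tri_def hface_def hact_def)
qed

text \<open>The homotopies \<open>F\<close> and \<open>G\<close> form an edge over the spine. By the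
  Segal condition it lifts to an edge of X_2 from \<open>s\<close> to \<open>s'\<close>, whose
  02-edge is a homotopy from \<open>h\<close> to \<open>h'\<close>.\<close>

lemma tri_homotopy:
  assumes f: "(f, f') \<in> hom_rel x y" and g: "(g, g') \<in> hom_rel y z" and xyz: "x \<in> bcells X 0 0" "y \<in> bcells X 0 0" "z \<in> bcells X 0 0"
    and s: "tri f g h s" "tri f' g' h' s'"
  shows "(h, h') \<in> hom_rel x z"
proof -
  obtain F G where F: "arr_htpy x y f f' F" and G: "arr_htpy y z g g' G" using f g hom_rel_iff xyz by metis
  have gl: "glueable 2 1 {([0,1], F), ([1,2], G)}" by (rule glue_spine2) (use F G in \<open>auto simp: arr_htpy_def\<close>)
  obtain S where S: "S \<in> bcells X 2 1" "face (col 2) 1 1 S = s" "face (col 2) 1 0 S = s'"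
    "\<And>e z. (e, z) \<in> {([0,1], F), ([1,2], G)} \<Longrightarrow> hact X 2 1 e S = z"
  proof (rule acyclic_lift_edge[OF acyclic_incl_spine2 gl])
    fix e :: "nat list" and z assume e: "(e, z) \<in> {([0,1], F), ([1,2], G)}"
    show "hact X 2 0 e s = face (col (dm e)) 1 1 z" "hact X 2 0 e s' = face (col (dm e)) 1 0 z"
      using e s F G by (auto simp: tri_def arr_htpy_def)
  qed (use s in \<open>auto simp: tri_def\<close>)
  have FS: "F = hact X 2 1 [0,1] S" "G = hact X 2 1 [1,2] S" using S(4) by auto
  have "arr_htpy x z h h' (hact X 2 1 [0,2] S)"
    using F G S(1,2,3) s unfolding arr_htpy_def tri_def FS by (auto simp flip: h_face_list(2))
  then show ?thesis using hom_rel_iff xyz by blast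
qed

abbreviation cls :: "'a \<Rightarrow> 'a \<Rightarrow> 'a \<Rightarrow> 'a set" where "cls x y f \<equiv> hom_rel x y `` {f}"

lemma cls_eq: "(f, g) \<in> hom_rel x y \<Longrightarrow> x \<in> bcells X 0 0 \<Longrightarrow> y \<in> bcells X 0 0 \<Longrightarrow> cls x y f = cls x y g"
  by (rule equiv_class_eq[OF hom_equiv])

lemma cls_eqD: "cls x y f = cls x y g \<Longrightarrow> arr x y g \<Longrightarrow> (f, g) \<in> hom_rel x y"
  using eq_equiv_class[OF _ hom_equiv, of x y f g] by (auto simp: arr_def)

lemma Hom_Ho: "Hom (Ho X) x y = pi0 (mapping_space X x y)" and Obj_Ho: "Obj (Ho X) = bcells X 0 0"
  by (simp_all add: Ho_def)

lemma Hom_HoE: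
  assumes "F \<in> Hom (Ho X) x y" "x \<in> bcells X 0 0" "y \<in> bcells X 0 0"
  obtains f where "arr x y f" "F = cls x y f"
  using assms arr_MS[OF assms(2,3)] unfolding Hom_Ho pi0_def by (auto elim!: quotientE)

lemma Hom_HoI: "arr x y f \<Longrightarrow> cls x y f \<in> Hom (Ho X) x y"
  unfolding Hom_Ho pi0_def by (rule quotientI) (use arr_MS in \<open>auto simp: arr_def\<close>)

text \<open>Every 2-simplex on \<open>f\<close> and \<open>g\<close> computes the composite, not
  only the one selected by \<open>eta2\<close>. The union in \<open>Comp\<close> collapses because
  all representatives give homotopic results.\<close>

lemma Comp_Ho:
  assumes f: "arr x y f" and g: "arr y z g" and s: "tri f g h s"
  shows "Comp (Ho X) x y z (cls y z g) (cls x y f) = cls x z h"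
proof -
  have xyz: "x \<in> bcells X 0 0" "y \<in> bcells X 0 0" "z \<in> bcells X 0 0" using f g by (auto simp: arr_def)
  have "hom_rel x z `` {cmp f' g'} = cls x z h" if "f' \<in> cls x y f" "g' \<in> cls y z g" for f' g'
  proof -
    have f': "(f, f') \<in> hom_rel x y" and g': "(g, g') \<in> hom_rel y z" using that by auto
    have "(h, cmp f' g') \<in> hom_rel x z"
      by (rule tri_homotopy[OF f' g' xyz s tri_cmp[OF hom_rel_arr(2)[OF xyz(1,2) f'] hom_rel_arr(2)[OF xyz(2,3) g']]])
    then show ?thesis using cls_eq[OF _ xyz(1,3)] by blast
  qed
  moreover have "f \<in> cls x y f" "g \<in> cls y z g" using hom_rel_refl f g by auto
  ultimately have "(\<Union>f'\<in>cls x y f. \<Union>g'\<in>cls y z g. hom_rel x z `` {cmp f' g'}) = cls x z h" by blast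
  then show ?thesis by (simp add: Ho_def)
qed

abbreviation unit_arr :: "'a \<Rightarrow> 'a" where "unit_arr x \<equiv> hact X 0 0 [0, 0] x"

lemma Ident_Ho: "Ident (Ho X) x = cls x x (unit_arr x)"
  by (simp add: Ho_def unit_arrow_def hact_def)

lemma arr_un: "x \<in> bcells X 0 0 \<Longrightarrow> arr x x (unit_arr x)"
  by (simp add: arr_def)

lemma tri_un_left: "arr x y f \<Longrightarrow> tri (unit_arr x) f f (hact X 1 0 [0,0,1] f)"
  by (auto simp: tri_def arr_def)
lemma tri_un_right: "arr x y f \<Longrightarrow> tri f (unit_arr y) f (hact X 1 0 [0,1,1] f)"
  by (auto simp: tri_def arr_def)

text \<open>The four triangles of a 3-simplex over the spine \<open>f\<close>, \<open>g\<close>,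
  \<open>h\<close> exhibit both bracketings with the same composite \<open>k\<close>.\<close>

lemma tri_assoc:
  assumes f: "arr w x f" and g: "arr x y g" and h: "arr y z h"
  obtains fg gh k s1 s2 s3 s4 where "tri f g fg s1" "tri g h gh s2" "tri fg h k s3" "tri f gh k s4"
proof -
  let ?P = "{([0,1], f), ([1,2], g), ([2,3], h)}"
  have gl: "glueable 3 0 ?P" by (rule glue_spine3) (use f g h in \<open>auto simp: arr_def\<close>)
  have "facet_cx ?P = spine_cx 3" unfolding spine3 by (simp add: facet_cx_def)
  then have A: "acyclic_incl (facet_cx ?P) (cx {{..3}})" using segal[of 3] by simp
  obtain T where T: "T \<in> bcells X 3 0" "\<And>e x. (e, x) \<in> ?P \<Longrightarrow> hact X 3 0 e T = x" by (rule acyclic_lift_vertex[OF A gl]) auto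
  then have "tri f g (hact X 3 0 [0,2] T) (hact X 3 0 [0,1,2] T)" "tri g h (hact X 3 0 [1,3] T) (hact X 3 0 [1,2,3] T)"
    "tri (hact X 3 0 [0,2] T) h (hact X 3 0 [0,3] T) (hact X 3 0 [0,2,3] T)"
    "tri f (hact X 3 0 [1,3] T) (hact X 3 0 [0,3] T) (hact X 3 0 [0,1,3] T)" by (auto simp: tri_def)
  then show thesis by (rule that)
qed

theorem category_Ho: "category (Ho X)"
  unfolding category_def Obj_Ho
proof (intro conjI ballI)
  fix x assume "x \<in> bcells X 0 0" then show "Ident (Ho X) x \<in> Hom (Ho X) x x" unfolding Ident_Ho by (intro Hom_HoI arr_un)
next
  fix x y z F G assume o: "x \<in> bcells X 0 0" "y \<in> bcells X 0 0" "z \<in> bcells X 0 0" and F: "F \<in> Hom (Ho X) x y" and G: "G \<in> Hom (Ho X) y z"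
  obtain f where f: "arr x y f" "F = cls x y f" by (rule Hom_HoE[OF F o(1,2)])
  obtain g where g: "arr y z g" "G = cls y z g" by (rule Hom_HoE[OF G o(2,3)])
  show "Comp (Ho X) x y z G F \<in> Hom (Ho X) x z"
    unfolding f(2) g(2) Comp_Ho[OF f(1) g(1) tri_cmp[OF f(1) g(1)]]
    by (rule Hom_HoI[OF tri_arr(2)[OF tri_cmp[OF f(1) g(1)] f(1) g(1)]])
next
  fix x y F assume o: "x \<in> bcells X 0 0" "y \<in> bcells X 0 0" and F: "F \<in> Hom (Ho X) x y"
  obtain f where f: "arr x y f" "F = cls x y f" by (rule Hom_HoE[OF F o(1,2)])
  show "Comp (Ho X) x x y F (Ident (Ho X) x) = F" "Comp (Ho X) x y y (Ident (Ho X) y) F = F"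
    unfolding f(2) Ident_Ho Comp_Ho[OF arr_un[OF o(1)] f(1) tri_un_left[OF f(1)]] Comp_Ho[OF f(1) arr_un[OF o(2)] tri_un_right[OF f(1)]]
    by (rule refl)+
next
  fix w x y z F G H assume o: "w \<in> bcells X 0 0" "x \<in> bcells X 0 0" "y \<in> bcells X 0 0" "z \<in> bcells X 0 0"
    and F: "F \<in> Hom (Ho X) w x" and G: "G \<in> Hom (Ho X) x y" and H: "H \<in> Hom (Ho X) y z"
  obtain f where f: "arr w x f" "F = cls w x f" by (rule Hom_HoE[OF F o(1,2)])
  obtain g where g: "arr x y g" "G = cls x y g" by (rule Hom_HoE[OF G o(2,3)])
  obtain h where h: "arr y z h" "H = cls y z h" by (rule Hom_HoE[OF H o(3,4)])
  obtain fg gh k s1 s2 s3 s4 where t: "tri f g fg s1" "tri g h gh s2" "tri fg h k s3" "tri f gh k s4"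
    by (rule tri_assoc[OF f(1) g(1) h(1)])
  note fg = tri_arr(2)[OF t(1) f(1) g(1)] and gh = tri_arr(2)[OF t(2) g(1) h(1)]
  show "Comp (Ho X) w y z H (Comp (Ho X) w x y G F) = Comp (Ho X) w x z (Comp (Ho X) x y z H G) F"
    unfolding f(2) g(2) h(2) Comp_Ho[OF f(1) g(1) t(1)] Comp_Ho[OF g(1) h(1) t(2)] Comp_Ho[OF fg h(1) t(3)] Comp_Ho[OF f(1) gh t(4)]
    by (rule refl)
qed

lemma Ho_assoc:
  "w \<in> bcells X 0 0 \<Longrightarrow> x \<in> bcells X 0 0 \<Longrightarrow> y \<in> bcells X 0 0 \<Longrightarrow> z \<in> bcells X 0 0 \<Longrightarrow>
   F \<in> Hom (Ho X) w x \<Longrightarrow> G \<in> Hom (Ho X) x y \<Longrightarrow> H \<in> Hom (Ho X) y z \<Longrightarrow>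
   Comp (Ho X) w y z H (Comp (Ho X) w x y G F) = Comp (Ho X) w x z (Comp (Ho X) x y z H G) F"
  using category_Ho unfolding category_def Obj_Ho by simp
lemma Ho_id:
  "x \<in> bcells X 0 0 \<Longrightarrow> y \<in> bcells X 0 0 \<Longrightarrow> F \<in> Hom (Ho X) x y \<Longrightarrow> Comp (Ho X) x x y F (Ident (Ho X) x) = F"
  "x \<in> bcells X 0 0 \<Longrightarrow> y \<in> bcells X 0 0 \<Longrightarrow> F \<in> Hom (Ho X) x y \<Longrightarrow> Comp (Ho X) x y y (Ident (Ho X) y) F = F"
  using category_Ho unfolding category_def Obj_Ho by simp_all

text \<open>Left inverses suffice, as a left inverse of a left inverse of \<open>f\<close> equals \<open>f\<close>.\<close>

lemma groupoid_if_left_inverses: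
  assumes "\<And>x y f. arr x y f \<Longrightarrow> \<exists>g s. arr y x g \<and> tri f g (unit_arr x) s"
  shows "groupoid (Ho X)"
proof -
  have L: "\<exists>G\<in>Hom (Ho X) y x. Comp (Ho X) x y x G F = Ident (Ho X) x"
    if o: "x \<in> bcells X 0 0" "y \<in> bcells X 0 0" and F: "F \<in> Hom (Ho X) x y" for x y F
  proof -
    obtain f where f: "arr x y f" "F = cls x y f" by (rule Hom_HoE[OF F o])
    obtain g s where g: "arr y x g" "tri f g (unit_arr x) s" using assms[OF f(1)] by blast
    show ?thesis using Comp_Ho[OF f(1) g] Hom_HoI[OF g(1)] unfolding f(2) Ident_Ho by blast
  qed
  show ?thesis unfolding groupoid_def Obj_Ho
  proof (intro conjI ballI category_Ho)
    fix x y F assume o: "x \<in> bcells X 0 0" "y \<in> bcells X 0 0" and F: "F \<in> Hom (Ho X) x y"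
    obtain G where G: "G \<in> Hom (Ho X) y x" "Comp (Ho X) x y x G F = Ident (Ho X) x" using L[OF o F] by blast
    obtain K where K: "K \<in> Hom (Ho X) x y" "Comp (Ho X) y x y K G = Ident (Ho X) y" using L[OF o(2,1) G(1)] by blast
    have "K = F" using Ho_assoc[OF o o F G(1) K(1)] Ho_id(1)[OF o K(1)] Ho_id(2)[OF o F] G(2) K(2) by simp
    then show "\<exists>G\<in>Hom (Ho X) y x. Comp (Ho X) x y x G F = Ident (Ho X) x \<and> Comp (Ho X) y x y F G = Ident (Ho X) y"
      using G K by blast
  qed
qed

lemma facet_cx_corolla2: "facet_cx {([0,1], f), ([0,2], h)} = corolla_cx 2"
  unfolding corolla2 by (simp add: facet_cx_def)

theorem groupoid_if_corolla:
  assumes C: "acyclic_incl (corolla_cx 2) (cx {{..2}})"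
  shows "groupoid (Ho X)"
proof (rule groupoid_if_left_inverses)
  fix x y f assume f: "arr x y f"
  then have x: "x \<in> bcells X 0 0" by (simp add: arr_def)
  have gl: "glueable 2 0 {([0,1], f), ([0,2], unit_arr x)}" by (rule glue_corolla2) (use f arr_un[OF x] in \<open>auto simp: arr_def\<close>)
  obtain s where s: "s \<in> bcells X 2 0" "\<And>e z. (e, z) \<in> {([0,1], f), ([0,2], unit_arr x)} \<Longrightarrow> hact X 2 0 e s = z"
    by (rule acyclic_lift_vertex[OF _ gl]) (use C in \<open>auto simp: facet_cx_corolla2\<close>)
  have fs: "f = hact X 2 0 [0,1] s" "unit_arr x = hact X 2 0 [0,2] s" using s(2) by auto
  have "arr y x (hact X 2 0 [1,2] s)" using f arr_un[OF x] s(1) unfolding arr_def fs by auto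
  moreover have "tri f (hact X 2 0 [1,2] s) (unit_arr x) s" using s by (auto simp: tri_def)
  ultimately show "\<exists>g s. arr y x g \<and> tri f g (unit_arr x) s" by blast
qed

text \<open>An equation in Ho(X) only yields a homotopy from \<open>cmp f g\<close> to
  \<open>h\<close>; \<open>tri_strictify\<close> absorbs it into the 2-simplex.\<close>

lemma tri_from_Comp:
  assumes f: "arr x y f" and g: "arr y z g" and h: "arr x z h" and eq: "Comp (Ho X) x y z (cls y z g) (cls x y f) = cls x z h"
  obtains s where "tri f g h s"
proof -
  have "(cmp f g, h) \<in> hom_rel x z" using eq Comp_Ho[OF f g tri_cmp[OF f g]] cls_eqD[OF _ h] by simp
  from tri_strictify[OF tri_cmp[OF f g] f g this] that show thesis by blast
qed

section \<open>Inverses and division when Ho(X) is a groupoid\<close>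

context
  assumes G: "groupoid (Ho X)"
begin

lemma inverse_arr:
  assumes f: "arr x y f"
  obtains g s s' where "arr y x g" "tri f g (unit_arr x) s" "tri g f (unit_arr y) s'"
proof -
  have o: "x \<in> bcells X 0 0" "y \<in> bcells X 0 0" using f by (auto simp: arr_def)
  obtain K where K: "K \<in> Hom (Ho X) y x" "Comp (Ho X) x y x K (cls x y f) = Ident (Ho X) x" "Comp (Ho X) y x y (cls x y f) K = Ident (Ho X) y"
    using G o Hom_HoI[OF f] unfolding groupoid_def Obj_Ho by blast
  obtain g where g: "arr y x g" "K = cls y x g" by (rule Hom_HoE[OF K(1) o(2,1)])
  obtain s where "tri f g (unit_arr x) s" using tri_from_Comp[OF f g(1) arr_un[OF o(1)]] K(2) unfolding g(2) Ident_Ho by blast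
  moreover obtain s' where "tri g f (unit_arr y) s'" using tri_from_Comp[OF g(1) f arr_un[OF o(2)]] K(3) unfolding g(2) Ident_Ho by blast
  ultimately show thesis using that g(1) by blast
qed

text \<open>The quotient \<open>g\<close> is the inverse of \<open>f\<close> followed by
  \<open>h\<close>. This is lifting of vertices along beta_2, and it requires the edge
  \<open>h\<close> itself, not merely an arrow in its class.\<close>

lemma tri_divide:
  assumes f: "arr x y f" and h: "arr x z h"
  obtains g s where "arr y z g" "tri f g h s"
proof -
  have o: "x \<in> bcells X 0 0" "y \<in> bcells X 0 0" "z \<in> bcells X 0 0" using f h by (auto simp: arr_def)
  obtain k s s' where k: "arr y x k" "tri f k (unit_arr x) s" "tri k f (unit_arr y) s'" by (rule inverse_arr[OF f])
  let ?g = "cmp k h"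
  note t = tri_cmp[OF k(1) h]
  have g: "arr y z ?g" by (rule tri_arr(2)[OF t k(1) h])
  have "Comp (Ho X) x y z (cls y z ?g) (cls x y f) = cls x z h"
    using Ho_assoc[OF o(1,2,1,3) Hom_HoI[OF f] Hom_HoI[OF k(1)] Hom_HoI[OF h]] Comp_Ho[OF k(1) h t] Comp_Ho[OF f k(1,2)]
      Ho_id(1)[OF o(1,3) Hom_HoI[OF h]] by (simp add: Ident_Ho)
  from tri_from_Comp[OF f g h this] that g show thesis by blast
qed

end

end

section \<open>Segal spaces with invertible arrows\<close>

text \<open>Such a family is the boundary of a homotopy from the constant simplex to
  \<open>x\<close>, so its compatibility is an instance of \<open>compat_htpy_faces\<close>.\<close>

lemma (in ss) compat_last:
  assumes x: "x \<in> cells A p" and a: "a \<in> cells A 0" and bd: "\<And>i. 0 < p \<Longrightarrow> i \<le> p \<Longrightarrow> face A p i x = const_simplex A a (p - 1)"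
  shows "compat A p {..Suc p} (\<lambda>i. if i = Suc p then x else const_simplex A a p)"
proof -
  let ?c = "const_simplex A a p"
  have c: "?c \<in> cells A p" by (rule const_in[OF a])
  have "htpy_faces A p ?c x i = (if i = Suc p then x else ?c)" if "i \<le> Suc p" for i
  proof (cases "i = Suc p")
    case False
    have "htpy_faces A p ?c x i = htpy_faces A p ?c ?c i" using False that by (auto simp: htpy_faces_def)
    also have "\<dots> = face A (Suc p) i (const_simplex A a (Suc p))" using htpy_faces_deg[OF c that] deg_const[OF a order.refl] by simp
    also have "\<dots> = ?c" using face_const[OF a that] .
    finally show ?thesis using False by simp
  qed (simp add: htpy_faces_def)
  moreover have "face A p i ?c = face A p i x" if "0 < p" "i \<le> p" for i
    using bd[OF that] face_const[OF a, of i "p - 1"] that by simp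
  ultimately show ?thesis
    by (intro iffD1[OF compat_cong compat_htpy_faces[OF c x]]) simp_all
qed

lemma (in ss) compat_const:
  assumes a: "a \<in> cells A 0" shows "compat A p {..Suc p} (\<lambda>_. const_simplex A a p)"
proof (rule compatI)
  fix i j assume ij: "i \<in> {..Suc p}" "j \<in> {..Suc p}" "i < j" "0 < p"
  then obtain q where "p = Suc q" by (cases p) auto
  then show "face A p i (const_simplex A a p) = face A p (j - 1) (const_simplex A a p)"
    using face_const[OF a, of i q] face_const[OF a, of "j - 1" q] ij by simp
qed (rule const_in[OF a])

context bss begin

lemma face_Mc: "e \<in> A \<Longrightarrow> face (Mc X A) (Suc p) i v e = face (col (dm e)) (Suc p) i (v e)"
  by (simp add: face_def act_Mc act_col)
lemma const_Mc: "e \<in> A \<Longrightarrow> const_simplex (Mc X A) v m e = const_simplex (col (dm e)) (v e) m"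
  by (simp add: const_simplex_def act_Mc act_col)

lemma h_face_gen:
  "x \<in> bcells X n (Suc p) \<Longrightarrow> i \<le> j \<Longrightarrow> j \<le> n \<Longrightarrow> c \<le> Suc p \<Longrightarrow> hact X n p [i, j] (face (col n) (Suc p) c x) = face (col 1) (Suc p) c (hact X n (Suc p) [i, j] x)"
  "x \<in> bcells X n (Suc p) \<Longrightarrow> i \<le> j \<Longrightarrow> j \<le> k \<Longrightarrow> k \<le> n \<Longrightarrow> c \<le> Suc p \<Longrightarrow> hact X n p [i, j, k] (face (col n) (Suc p) c x) = face (col 2) (Suc p) c (hact X n (Suc p) [i, j, k] x)"
  using h_face[of "[i, j]" 1 n c p x] h_face[of "[i, j, k]" 2 n c p x] by simp_all

lemmas col_dc = ss.face_const[OF ss_col, simplified]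

end

context vf begin

text \<open>Spheres prescribed on the facets, based at the faces of \<open>T\<close>, extend to a
  sphere based at \<open>T\<close>. The case \<open>p = 0\<close> is separate because a
  0-dimensional sphere has no boundary to prescribe.\<close>

lemma acyclic_incl_const_boundary:
  assumes A: "acyclic_incl (facet_cx P) (cx {{..n}})" and P: "glueable n p P" and T: "T \<in> bcells X n 0"
    and bd: "\<And>e x i. (e, x) \<in> P \<Longrightarrow> 0 < p \<Longrightarrow> i \<le> p \<Longrightarrow> face (col (dm e)) p i x = const_simplex (col (dm e)) (hact X n 0 e T) (p - 1)"
  obtains S where "S \<in> bcells X n p" "\<And>e x. (e, x) \<in> P \<Longrightarrow> hact X n p e S = x"
    "\<And>i. 0 < p \<Longrightarrow> i \<le> p \<Longrightarrow> face (col n) p i S = const_simplex (col n) T (p - 1)"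
proof (cases p)
  case 0
  with acyclic_lift_vertex[OF A] P that show thesis by (metis less_numeral_extra(3))
next
  case (Suc r)
  have c: "compat (col n) r {..Suc r} (\<lambda>_. const_simplex (col n) T r)" by (rule ss.compat_const[OF ss_col]) (simp add: T)
  have "glueable n (Suc r) P" using P Suc by simp
  then obtain S where "S \<in> bcells X n (Suc r)" "\<And>i. i \<le> Suc r \<Longrightarrow> face (col n) (Suc r) i S = const_simplex (col n) T r" "\<And>e x. (e, x) \<in> P \<Longrightarrow> hact X n (Suc r) e S = x"
  proof (rule acyclic_lift[OF A _ c])
    fix e x i assume e: "(e, x) \<in> P" "i \<le> Suc r"
    show "hact X n r e (const_simplex (col n) T r) = face (col (dm e)) (Suc r) i x"
      using bd[OF e(1), of i] e(2) h_const[OF glueableD(4)[OF P e(1)] T] Suc by simp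
  qed auto
  then show thesis using that Suc by simp
qed

end

context segal begin

text \<open>The Segal condition gives a path \<open>l\<close> from \<open>r\<close> to the
  degenerate simplex on the edge 12 of \<open>r\<close>, but edge 02 moves along it by a path
  \<open>q\<close> out of \<open>h\<close>. The degenerate path \<open>sq\<close> starts at the
  degenerate simplex on \<open>h\<close> and moves edge 02 by the same \<open>q\<close>. Following
  \<open>l\<close> by the reverse of \<open>sq\<close> therefore lets edge 02 be kept
  constant.\<close>

lemma path_to_degenerate:
  assumes r: "r \<in> bcells X 2 0" "hact X 2 0 [0,1] r = unit_arr x" "hact X 2 0 [0,2] r = h" and x: "x \<in> bcells X 0 0"
  obtains e where "e \<in> bcells X 2 1" "face (col 2) 1 1 e = r" "face (col 2) 1 0 e = hact X 1 0 [0,0,1] h"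
    "hact X 2 1 [0,1] e = const_simplex (col 1) (unit_arr x) 1" "hact X 2 1 [0,2] e = const_simplex (col 1) h 1"
proof -
  define k where "k = hact X 2 0 [1,2] r"
  have k: "k \<in> bcells X 1 0" and h: "h \<in> bcells X 1 0" and ux: "unit_arr x \<in> bcells X 1 0" unfolding k_def r(3)[symmetric] using r(1) x by auto
  have kx: "hact X 1 0 [0] k = x"
  proof -
    have "hact X 1 0 [0] k = hact X 1 0 [1] (hact X 2 0 [0,1] r)" unfolding k_def using r(1) by simp
    then show ?thesis using r(2) x by simp
  qed
  have sk: "hact X 1 0 [0,0] k = unit_arr x" using kx k by (metis h_h_list(1) zero_le)
  let ?c = "\<lambda>f m. const_simplex (col 1) f m"
  have gl: "glueable 2 1 {([0,1], ?c (unit_arr x) 1), ([1,2], ?c k 1)}"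
    by (rule glue_spine2) (use k kx x ux col_c_in in auto)
  obtain l where l: "l \<in> bcells X 2 1" "face (col 2) 1 1 l = r" "face (col 2) 1 0 l = hact X 1 0 [0,0,1] k"
    "\<And>e z. (e, z) \<in> {([0,1], ?c (unit_arr x) 1), ([1,2], ?c k 1)} \<Longrightarrow> hact X 2 1 e l = z"
  proof (rule acyclic_lift_edge[OF acyclic_incl_spine2 gl r(1)])
    show "hact X 1 0 [0, 0, 1] k \<in> bcells X 2 0" using k by simp
    fix e :: "nat list" and z assume e: "(e, z) \<in> {([0,1], ?c (unit_arr x) 1), ([1,2], ?c k 1)}"
    show "hact X 2 0 e r = face (col (dm e)) 1 1 z" using e r k ux col_const_face k_def by auto
    show "hact X 2 0 e (hact X 1 0 [0,0,1] k) = face (col (dm e)) 1 0 z" using e k ux sk col_const_face by auto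
  qed auto
  have l01: "hact X 2 1 [0,1] l = ?c (unit_arr x) 1" using l(4) by auto
  define q where "q = hact X 2 1 [0,2] l"
  have q: "q \<in> bcells X 1 1" unfolding q_def using l(1) by simp
  have q1: "face (col 1) 1 1 q = h" unfolding q_def using h_face_list(2)[OF l(1), of 0 2 1] l(2) r(3) by simp
  have q0: "face (col 1) 1 0 q = k" unfolding q_def using h_face_list(2)[OF l(1), of 0 2 0] l(3) k by simp
  have q_x: "hact X 1 1 [0] q = const_simplex (col 0) x 1"
  proof -
    have "hact X 1 1 [0] q = hact X 1 1 [0] (hact X 2 1 [0,1] l)" unfolding q_def using l(1) by simp
    then show ?thesis using l01 ux x by simp
  qed
  have q_xx: "hact X 1 1 [0,0] q = ?c (unit_arr x) 1"
  proof -
    have "hact X 1 1 [0,0] q = hact X 0 1 [0,0] (hact X 1 1 [0] q)" using q by simp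
    then show ?thesis using q_x x by simp
  qed
  define sq where "sq = hact X 1 1 [0,0,1] q"
  have sq: "sq \<in> bcells X 2 1" "hact X 2 1 [0,1] sq = ?c (unit_arr x) 1" "hact X 2 1 [0,2] sq = q"
    "face (col 2) 1 1 sq = hact X 1 0 [0,0,1] h" "face (col 2) 1 0 sq = hact X 1 0 [0,0,1] k"
    unfolding sq_def using q q_xx q1 q0 by (auto simp flip: h_face_list(3))
  let ?d = "deg (col 1) 1 0 q"
  have d: "?d \<in> bcells X 1 2" "face (col 1) 2 0 ?d = q" "face (col 1) 2 1 ?d = q" "face (col 1) 2 2 ?d = ?c h 1"
  proof -
    have qc: "q \<in> cells (col 1) 1" using q by simp
    show "?d \<in> bcells X 1 2" using ss.deg_in[OF ss_col _ qc, of 0] by (simp add: numeral_2_eq_2 One_nat_def)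
    show "face (col 1) 2 0 ?d = q" "face (col 1) 2 1 ?d = q" using ss.face_deg_eq[OF ss_col qc, of _ 0] by (auto simp: numeral_2_eq_2 One_nat_def)
    have "face (col 1) 2 2 ?d = deg (col 1) 0 0 (face (col 1) 1 1 q)"
      using ss.face_deg_gt[OF ss_col qc[unfolded One_nat_def], of 0 2] by (simp add: numeral_2_eq_2 One_nat_def)
    also have "\<dots> = deg (col 1) 0 0 (?c h 0)" using q1 h col_c0 by simp
    also have "\<dots> = ?c h 1" using ss.deg_const[OF ss_col, of h 1 0 0] h by (simp add: One_nat_def)
    finally show "face (col 1) 2 2 ?d = ?c h 1" .
  qed
  let ?P = "{([0,1], ?c (unit_arr x) 2), ([0,2], ?d)}"
  have "hact X 1 2 [0] ?d = const_simplex (col 0) x 2"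
  proof -
    have "hact X 1 (Suc 1) [0] ?d = deg (col 0) 1 0 (hact X 1 1 [0] q)" using h_deg[of "[0]" 0 1 0 1 q] q by simp
    also have "\<dots> = const_simplex (col 0) x (Suc 1)" unfolding q_x by (rule ss.deg_const[OF ss_col]) (use x in auto)
    finally show ?thesis by simp
  qed
  then have gl: "glueable 2 2 ?P" by (intro glue_corolla2) (use ux x d col_c_in in auto)
  \<comment> \<open>The horn with faces \<open>sq\<close> and \<open>l\<close> expresses
    \<open>l\<close> followed by the reverse of \<open>sq\<close>; prescribing \<open>?d\<close>, a
    degeneracy of \<open>q\<close>, on edge 02 makes that edge constant at \<open>h\<close> on the
    new face 2.\<close>
  have cp: "compat (col 2) 1 ({..Suc 1} - {2}) (\<lambda>i. if i = 0 then sq else l)"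
    by (rule compatI) (use sq l in \<open>auto simp: le_Suc_eq numeral_2_eq_2 One_nat_def\<close>)
  obtain t where t: "t \<in> bcells X 2 (Suc 1)" "\<And>i. i \<le> Suc 1 \<Longrightarrow> i \<noteq> 2 \<Longrightarrow> face (col 2) (Suc 1) i t = (if i = 0 then sq else l)"
    "\<And>e z. (e, z) \<in> ?P \<Longrightarrow> hact X 2 (Suc 1) e t = z"
  proof (rule kan_lift[OF _ _ cp])
    show "finite ?P" by simp
    show "glueable 2 (Suc 1) ?P" using gl by simp
    fix e :: "nat list" and z i assume e: "(e, z) \<in> ?P" "i \<le> Suc 1" "i \<noteq> 2"
    have "i = 0 \<or> i = 1" using e by auto
    then show "hact X 2 1 e (if i = 0 then sq else l) = face (col (dm e)) (Suc 1) i z"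
      using e(1) sq(2,3) l01 d(2,3) col_dc[OF ux, of i 1] q_def by auto
  qed auto
  have tc: "t \<in> cells (col 2) (Suc (Suc 0))" "t \<in> bcells X 2 2" using t(1) by (simp_all add: One_nat_def numeral_2_eq_2)
  let ?e = "face (col 2) 2 2 t"
  show thesis
  proof (rule that)
    show "?e \<in> bcells X 2 1" using ss.face_in[OF ss_col _ tc(1), of 2] by (simp add: numeral_2_eq_2 One_nat_def)
    show "face (col 2) 1 1 ?e = r" using ss.face_face[OF ss_col tc(1), of 1 2] t(2)[of 1] l(2) by (simp add: numeral_2_eq_2 One_nat_def)
    show "face (col 2) 1 0 ?e = hact X 1 0 [0,0,1] h" using ss.face_face[OF ss_col tc(1), of 0 2] t(2)[of 0] sq(4) by (simp add: numeral_2_eq_2 One_nat_def)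
    show "hact X 2 1 [0,1] ?e = ?c (unit_arr x) 1" using h_face_gen(1)[OF t(1), of 0 1 2] t(3)[of "[0,1]"] col_dc[OF ux, of 2 1] by simp
    show "hact X 2 1 [0,2] ?e = ?c h 1" using h_face_gen(1)[OF t(1), of 0 2 2] t(3)[of "[0,2]"] d(4) by simp
  qed
qed

lemma corolla2_complex: "complex (corolla_cx 2)" "corolla_cx 2 \<subseteq> cx {{..2}}"
proof -
  show "complex (corolla_cx 2)" unfolding corolla2 by simp
  show "corolla_cx 2 \<subseteq> cx {{..2}}" unfolding corolla2 by (rule cx_mono) auto
qed

lemma corolla2_edges: "[0,1] \<in> corolla_cx 2" "[0,2] \<in> corolla_cx 2"
  unfolding corolla2 cx_def by auto

lemma kan_incl_corolla2: "kan_incl (corolla_cx 2) (cx {{..2}})"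
  using corolla2_complex(2) unfolding corolla2 by (intro kan_incl_cx_sub) auto

section \<open>Contracting a sphere in the fibre of the Bousfield map\<close>

context
  fixes s f h g x y z
  assumes G: "groupoid (Ho X)" and s: "tri f g h s" and f: "arr x y f" and g: "arr y z g"
begin

abbreviation (input) c1 where "c1 a m \<equiv> const_simplex (col 1) a m"
abbreviation (input) c2 where "c2 a m \<equiv> const_simplex (col 2) a m"

lemma objs: "x \<in> bcells X 0 0" "y \<in> bcells X 0 0" "z \<in> bcells X 0 0" using f g by (auto simp: arr_def)
lemma harr: "arr x z h" by (rule tri_arr(2)[OF s f g])
lemma cell1: "f \<in> bcells X 1 0" "g \<in> bcells X 1 0" "h \<in> bcells X 1 0" "s \<in> bcells X 2 0"
  "hact X 2 0 [0,1] s = f" "hact X 2 0 [1,2] s = g" "hact X 2 0 [0,2] s = h"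
  "hact X 1 0 [0] f = x" "hact X 1 0 [1] f = y" "hact X 1 0 [0] g = y" "hact X 1 0 [1] g = z" "hact X 1 0 [0] h = x" "hact X 1 0 [1] h = z"
  using f g harr s by (auto simp: arr_def tri_def)

text \<open>Composing with an inverse of \<open>f\<close> turns the sphere \<open>v\<close> in the fibre of the Bousfield map into a
  sphere in a fibre of the Segal map.\<close>

lemma null_over_first_edge:
  assumes v: "v \<in> bcells X 2 p" "hact X 2 p [0,1] v = c1 f p" "hact X 2 p [0,2] v = c1 h p"
    and bd: "\<And>i. 0 < p \<Longrightarrow> i \<le> p \<Longrightarrow> face (col 2) p i v = c2 s (p - 1)"
  obtains w where "w \<in> bcells X 2 (Suc p)" "face (col 2) (Suc p) (Suc p) w = v" "\<And>i. i \<le> p \<Longrightarrow> face (col 2) (Suc p) i w = c2 s p"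
    "hact X 2 (Suc p) [0,1] w = c1 f (Suc p)"
proof -
  obtain f' t0 t where f': "arr y x f'" and t: "tri f' f (unit_arr y) t" by (rule inverse_arr[OF G f])
  have f'c: "f' \<in> bcells X 1 0" "hact X 1 0 [0] f' = y" "hact X 1 0 [1] f' = x" using f' by (auto simp: arr_def)
  have tc: "t \<in> bcells X 2 0" "hact X 2 0 [0,1] t = f'" "hact X 2 0 [1,2] t = f" "hact X 2 0 [0,2] t = unit_arr y" using t by (auto simp: tri_def)
  have A3: "acyclic_incl (facet_cx {([0,1,2], a), ([0,2,3], b), ([1,2,3], c)}) (cx {{..3}})" for a b c
    using acyclic_incl_3(3) by (simp add: facet_cx_def insert_commute)
  have gg: "hact X 1 0 [0,0] g = unit_arr y" using h_h_list(1)[OF cell1(2), of 0] cell1(10) by simp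
  \<comment> \<open>The base 3-simplex has vertices y, x, y, z. Its missing face 013 exhibits
    \<open>g\<close> as \<open>f'\<close> followed by \<open>h\<close>.\<close>
  let ?P0 = "{([0,1,2], t), ([0,2,3], hact X 1 0 [0,0,1] g), ([1,2,3], s)}"
  have gl0: "glueable 3 0 ?P0" by (rule glue_horn2) (use tc cell1 gg in auto)
  obtain T0 where T0: "T0 \<in> bcells X 3 0" "\<And>e z. (e, z) \<in> ?P0 \<Longrightarrow> hact X 3 0 e T0 = z" by (rule acyclic_lift_vertex[OF A3 gl0]) auto
  define u where "u = hact X 2 p [1,2] v"
  have u: "u \<in> bcells X 1 p" unfolding u_def using v(1) by simp
  have u0: "hact X 1 p [0] u = const_simplex (col 0) y p"
  proof -
    have "hact X 1 p [0] u = hact X 1 p [1] (hact X 2 p [0,1] v)" unfolding u_def using v(1) by simp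
    then show ?thesis using v(2) cell1 by simp
  qed
  have uu: "hact X 1 p [0,0] u = c1 (unit_arr y) p" using h_h_list(1)[OF u, of 0] u0 objs by simp
  \<comment> \<open>The same 3-simplex in dimension \<open>p\<close>, with the sphere
    \<open>v\<close> in place of \<open>s\<close> and its edge \<open>u\<close> in place of
    \<open>g\<close>. On face 013 the edges 01 and 12 are constant at \<open>f'\<close> and
    \<open>h\<close>, so the Segal condition contracts that face.\<close>
  let ?P = "{([0,1,2], c2 t p), ([0,2,3], hact X 1 p [0,0,1] u), ([1,2,3], v)}"
  have gl: "glueable 3 p ?P" by (rule glue_horn2) (use tc v u uu u_def col_c_in in auto)
  obtain T where T: "T \<in> bcells X 3 p" "\<And>e x. (e, x) \<in> ?P \<Longrightarrow> hact X 3 p e T = x"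
    "\<And>i. 0 < p \<Longrightarrow> i \<le> p \<Longrightarrow> face (col 3) p i T = const_simplex (col 3) T0 (p - 1)"
  proof (rule acyclic_incl_const_boundary[OF A3 gl T0(1)])
    fix e :: "nat list" and z i assume e: "(e, z) \<in> ?P" "0 < p" "i \<le> p"
    obtain r where p: "p = Suc r" using e(2) by (cases p) auto
    have b: "face (col 2) (Suc r) i v = c2 s r" using bd[of i] e p by simp
    have "face (col 2) (Suc r) i (hact X 1 (Suc r) [0,0,1] u) = hact X 1 r [0,0,1] (hact X 2 r [1,2] (face (col 2) (Suc r) i v))"
      using h_face_gen(2)[of u 1 r 0 0 1 i] h_face_gen(1)[of v 2 r 1 2 i] u v(1) e p u_def by simp
    also have "\<dots> = c2 (hact X 1 0 [0,0,1] g) r" unfolding b using cell1 by simp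
    finally show "face (col (dm e)) p i z = const_simplex (col (dm e)) (hact X 3 0 e T0) (p - 1)"
      using e b T0(2) col_dc[OF tc(1), of i r] p by auto
  qed auto
  have T012: "hact X 3 p [0,1,2] T = c2 t p" and T023: "hact X 3 p [0,2,3] T = hact X 1 p [0,0,1] u" and T123: "hact X 3 p [1,2,3] T = v" using T(2) by auto
  have T0s: "hact X 3 0 [0,1,2] T0 = t" "hact X 3 0 [0,2,3] T0 = hact X 1 0 [0,0,1] g" "hact X 3 0 [1,2,3] T0 = s" using T0(2) by auto
  define R where "R = hact X 3 p [0,1,3] T"
  define R0 where "R0 = hact X 3 0 [0,1,3] T0"
  have R: "R \<in> bcells X 2 p" "R0 \<in> bcells X 2 0" unfolding R_def R0_def using T(1) T0(1) by auto
  have R01: "hact X 2 p [0,1] R = c1 f' p" 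
  proof -
    have "hact X 2 p [0,1] R = hact X 2 p [0,1] (hact X 3 p [0,1,2] T)" unfolding R_def using T(1) by simp
    then show ?thesis using T012 tc by simp
  qed
  have R12: "hact X 2 p [1,2] R = c1 h p" 
  proof -
    have "hact X 2 p [1,2] R = hact X 2 p [0,2] (hact X 3 p [1,2,3] T)" unfolding R_def using T(1) by simp
    then show ?thesis using T123 v(3) by simp
  qed
  have R02: "hact X 2 p [0,2] R = u" 
  proof -
    have "hact X 2 p [0,2] R = hact X 2 p [0,2] (hact X 3 p [0,2,3] T)" unfolding R_def using T(1) by simp
    then show ?thesis using T023 u by simp
  qed
  have R0_01: "hact X 2 0 [0,1] R0 = f'" 
  proof -
    have "hact X 2 0 [0,1] R0 = hact X 2 0 [0,1] (hact X 3 0 [0,1,2] T0)" unfolding R0_def using T0(1) by simp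
    then show ?thesis using T0s tc by simp
  qed
  have R0_12: "hact X 2 0 [1,2] R0 = h" 
  proof -
    have "hact X 2 0 [1,2] R0 = hact X 2 0 [0,2] (hact X 3 0 [1,2,3] T0)" unfolding R0_def using T0(1) by simp
    then show ?thesis using T0s cell1 by simp
  qed
  have R0_02: "hact X 2 0 [0,2] R0 = g" 
  proof -
    have "hact X 2 0 [0,2] R0 = hact X 2 0 [0,2] (hact X 3 0 [0,2,3] T0)" unfolding R0_def using T0(1) by simp
    then show ?thesis using T0s cell1 by simp
  qed
  have Rbd: "face (col 2) p i R = c2 R0 (p - 1)" if i: "0 < p" "i \<le> p" for i
  proof -
    obtain r where p: "p = Suc r" using i by (cases p) auto
    show ?thesis using h_face_gen(2)[of T 3 r 0 1 3 i] T(1) T(3)[OF i] T0(1) i unfolding R_def R0_def p by simp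
  qed
  let ?w = "\<lambda>i. if i = Suc p then R else c2 R0 p"
  have cw: "compat (col 2) p {..Suc p} ?w" by (rule ss.compat_last[OF ss_col]) (use R Rbd in auto)
  let ?Q = "{([0,1], c1 f' (Suc p)), ([1,2], c1 h (Suc p))}"
  have glQ: "glueable 2 (Suc p) ?Q" by (rule glue_spine2) (use f'c cell1 col_c_in in auto)
  obtain N where N: "N \<in> bcells X 2 (Suc p)" "\<And>i. i \<le> Suc p \<Longrightarrow> face (col 2) (Suc p) i N = ?w i" "\<And>e x. (e, x) \<in> ?Q \<Longrightarrow> hact X 2 (Suc p) e N = x"
  proof (rule acyclic_lift[OF acyclic_incl_spine2 glQ cw])
    fix e :: "nat list" and z i assume "(e, z) \<in> ?Q" "i \<le> Suc p"
    then show "hact X 2 p e (?w i) = face (col (dm e)) (Suc p) i z"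
      using R01 R12 R0_01 R0_12 R col_dc[OF f'c(1)] col_dc[OF cell1(3)] by auto
  qed auto
  \<comment> \<open>The 02-edge of the contraction \<open>N\<close> is a null-homotopy of
    \<open>u\<close>. Lifting it along the Segal map together with constant \<open>f\<close> gives a
    null-homotopy of \<open>v\<close>.\<close>
  define k where "k = hact X 2 (Suc p) [0,2] N"
  have k: "k \<in> bcells X 1 (Suc p)" unfolding k_def using N(1) by simp
  have kf: "face (col 1) (Suc p) i k = (if i = Suc p then u else c1 g p)" if "i \<le> Suc p" for i
    unfolding k_def using h_face_gen(1)[OF N(1), of 0 2 i, symmetric] N(2)[OF that] that R02 R0_02 R by simp
  have k0: "hact X 1 (Suc p) [0] k = const_simplex (col 0) y (Suc p)"
  proof -
    have "hact X 1 (Suc p) [0] k = hact X 1 (Suc p) [0] (hact X 2 (Suc p) [0,1] N)" unfolding k_def using N(1) by simp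
    then show ?thesis using N(3)[of "[0,1]"] f'c by simp
  qed
  let ?Z = "{([0,1], c1 f (Suc p)), ([1,2], k)}"
  have glZ: "glueable 2 (Suc p) ?Z" by (rule glue_spine2) (use cell1 k k0 col_c_in in auto)
  let ?w' = "\<lambda>i. if i = Suc p then v else c2 s p"
  have cw': "compat (col 2) p {..Suc p} ?w'" by (rule ss.compat_last[OF ss_col]) (use v cell1 bd in auto)
  obtain w where w: "w \<in> bcells X 2 (Suc p)" "\<And>i. i \<le> Suc p \<Longrightarrow> face (col 2) (Suc p) i w = ?w' i" "\<And>e x. (e, x) \<in> ?Z \<Longrightarrow> hact X 2 (Suc p) e w = x"
  proof (rule acyclic_lift[OF acyclic_incl_spine2 glZ cw'])
    fix e :: "nat list" and z i assume "(e, z) \<in> ?Z" "i \<le> Suc p"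
    then show "hact X 2 p e (?w' i) = face (col (dm e)) (Suc p) i z"
      using v(2) kf cell1 col_dc[OF cell1(1)] u_def by auto
  qed auto
  show thesis by (rule that) (use w in auto)
qed

text \<open>An inverse of \<open>f\<close> gives a 3-simplex on \<open>s\<close> whose face $\{0,2\}$ is an identity; moving its
  face 023 to a degenerate one makes the sphere liftable by the Segal condition.\<close>

lemma lift_sphere_along_second_edge:
  assumes K: "K \<in> bcells X 1 (Suc p)" "\<And>i. i \<le> Suc p \<Longrightarrow> face (col 1) (Suc p) i K = c1 h p" "hact X 1 (Suc p) [0] K = const_simplex (col 0) x (Suc p)"
  obtains w where "w \<in> bcells X 2 (Suc p)" "\<And>i. i \<le> Suc p \<Longrightarrow> face (col 2) (Suc p) i w = c2 s p"
    "hact X 2 (Suc p) [0,1] w = c1 f (Suc p)" "hact X 2 (Suc p) [0,2] w = K"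
proof -
  obtain f' t t0 where f': "arr y x f'" and t: "tri f f' (unit_arr x) t" by (rule inverse_arr[OF G f])
  obtain k' q where q: "tri f' k' g q" by (rule tri_divide[OF G f' g])
  have f'c: "f' \<in> bcells X 1 0" using f' by (auto simp: arr_def)
  have tc: "t \<in> bcells X 2 0" "hact X 2 0 [0,1] t = f" "hact X 2 0 [1,2] t = f'" "hact X 2 0 [0,2] t = unit_arr x" using t by (auto simp: tri_def)
  have qc: "q \<in> bcells X 2 0" "hact X 2 0 [0,1] q = f'" "hact X 2 0 [0,2] q = g" using q by (auto simp: tri_def)
  \<comment> \<open>This 3-simplex has vertices x, y, x, z. The arrow \<open>k'\<close> was chosen
    by division so that 123 fits with \<open>s\<close> on 013; the missing face 023 has a unit as
    edge 01 and \<open>h\<close> as edge 02.\<close>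
  let ?P0 = "{([0,1,2], t), ([1,2,3], q), ([0,1,3], s)}"
  have A0: "acyclic_incl (facet_cx ?P0) (cx {{..3}})" using acyclic_incl_3(4) by (simp add: facet_cx_def insert_commute)
  have gl0: "glueable 3 0 ?P0" by (rule glue_horn1) (use tc qc cell1 in auto)
  obtain T0 where T0: "T0 \<in> bcells X 3 0" "\<And>e z. (e, z) \<in> ?P0 \<Longrightarrow> hact X 3 0 e T0 = z" by (rule acyclic_lift_vertex[OF A0 gl0]) auto
  have T0s: "hact X 3 0 [0,1,2] T0 = t" "hact X 3 0 [0,1,3] T0 = s" using T0(2) by auto
  define r where "r = hact X 3 0 [0,2,3] T0"
  have rc: "r \<in> bcells X 2 0" unfolding r_def using T0(1) by simp
  have r01: "hact X 2 0 [0,1] r = unit_arr x"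
  proof -
    have "hact X 2 0 [0,1] r = hact X 2 0 [0,2] (hact X 3 0 [0,1,2] T0)" unfolding r_def using T0(1) by simp
    then show ?thesis using T0s tc by simp
  qed
  have r02: "hact X 2 0 [0,2] r = h"
  proof -
    have "hact X 2 0 [0,2] r = hact X 2 0 [0,2] (hact X 3 0 [0,1,3] T0)" unfolding r_def using T0(1) by simp
    then show ?thesis using T0s cell1 by simp
  qed
  obtain e where e: "e \<in> bcells X 2 1" "face (col 2) 1 1 e = r" "face (col 2) 1 0 e = hact X 1 0 [0,0,1] h"
    "hact X 2 1 [0,1] e = c1 (unit_arr x) 1" "hact X 2 1 [0,2] e = c1 h 1"
    by (rule path_to_degenerate[OF rc r01 r02 objs(1)])
  \<comment> \<open>Face 023 moves along \<open>e\<close> while 013 remains \<open>s\<close>. At the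
    end \<open>T1\<close> of this motion face 023 is the degenerate simplex on \<open>h\<close>,
    over which the degenerate simplex on \<open>K\<close> is a sphere.\<close>
  let ?P1 = "{([0,1,3], c2 s 1), ([0,2,3], e)}"
  have gl1: "glueable 3 1 ?P1" by (rule glue_013_023) (use e cell1 col_c_in in auto)
  obtain Y where Y: "Y \<in> bcells X 3 1" "\<And>e z. (e, z) \<in> ?P1 \<Longrightarrow> hact X 3 1 e Y = z"
  proof (rule kan_lift_edge[OF _ gl1 T0(1)])
    fix e' :: "nat list" and z assume "(e', z) \<in> ?P1"
    then show "hact X 3 0 e' T0 = face (col (dm e')) 1 1 z" using T0s e(2) r_def col_const_face cell1 by auto
  qed auto
  have Ys: "hact X 3 1 [0,1,3] Y = c2 s 1" "hact X 3 1 [0,2,3] Y = e" using Y(2) by auto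
  define T1 where "T1 = face (col 3) 1 0 Y"
  have T1: "T1 \<in> bcells X 3 0" unfolding T1_def using face_col_in[OF Y(1)] by simp
  have T1s: "hact X 3 0 [0,1,3] T1 = s" "hact X 3 0 [0,2,3] T1 = hact X 1 0 [0,0,1] h"
    unfolding T1_def using Y(1) Ys e(3) col_const_face cell1 by auto
  define t1 where "t1 = hact X 3 0 [0,1,2] T1"
  have t1: "t1 \<in> bcells X 2 0" unfolding t1_def using T1 by simp
  have hh: "hact X 1 0 [0,0] h = unit_arr x" using h_h_list(1)[OF cell1(3), of 0] cell1 by simp
  have t1_02: "hact X 2 0 [0,2] t1 = unit_arr x"
  proof -
    have "hact X 2 0 [0,2] t1 = hact X 2 0 [0,1] (hact X 3 0 [0,2,3] T1)" unfolding t1_def using T1 by simp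
    then show ?thesis using T1s cell1 hh by simp
  qed
  have t1_01: "hact X 2 0 [0,1] t1 = f"
  proof -
    have "hact X 2 0 [0,1] t1 = hact X 2 0 [0,1] (hact X 3 0 [0,1,3] T1)" unfolding t1_def using T1 by simp
    then show ?thesis using T1s cell1 by simp
  qed
  have KK: "hact X 1 (Suc p) [0,0] K = c1 (unit_arr x) (Suc p)" using h_h_list(1)[OF K(1), of 0] K(3) objs by simp
  \<comment> \<open>The degenerate face 023 places \<open>K\<close> on edge 03, and the constant
    face 012 places \<open>f\<close> on edge 01. Face 013 of the lift then has the two edges
    required, and its base point is \<open>s\<close>.\<close>
  let ?P = "{([0,1,2], c2 t1 (Suc p)), ([0,2,3], hact X 1 (Suc p) [0,0,1] K)}"
  have A: "acyclic_incl (facet_cx ?P) (cx {{..3}})" using acyclic_incl_3(2) by (simp add: facet_cx_def insert_commute)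
  have gl: "glueable 3 (Suc p) ?P" by (rule glue_012_023) (use t1 t1_02 K KK col_c_in in auto)
  obtain T where T: "T \<in> bcells X 3 (Suc p)" "\<And>e x. (e, x) \<in> ?P \<Longrightarrow> hact X 3 (Suc p) e T = x"
    "\<And>i. 0 < Suc p \<Longrightarrow> i \<le> Suc p \<Longrightarrow> face (col 3) (Suc p) i T = const_simplex (col 3) T1 (Suc p - 1)"
  proof (rule acyclic_incl_const_boundary[OF A gl T1])
    fix e :: "nat list" and z i assume e: "(e, z) \<in> ?P" "i \<le> Suc p"
    show "face (col (dm e)) (Suc p) i z = const_simplex (col (dm e)) (hact X 3 0 e T1) (Suc p - 1)"
      using e col_dc[OF t1, of i p] T1s(2) t1_def h_face_gen(2)[OF K(1), of 0 0 1 i, symmetric] K(2)[of i] cell1 by auto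
  qed auto
  have T012: "hact X 3 (Suc p) [0,1,2] T = c2 t1 (Suc p)" and T023: "hact X 3 (Suc p) [0,2,3] T = hact X 1 (Suc p) [0,0,1] K" using T(2) by auto
  define w where "w = hact X 3 (Suc p) [0,1,3] T"
  show thesis
  proof (rule that)
    show "w \<in> bcells X 2 (Suc p)" unfolding w_def using T(1) by simp
    show "face (col 2) (Suc p) i w = c2 s p" if "i \<le> Suc p" for i
      unfolding w_def using h_face_gen(2)[OF T(1), of 0 1 3 i, symmetric] T(3)[OF _ that] T1 T1s that by simp
    have "hact X 2 (Suc p) [0,1] w = hact X 2 (Suc p) [0,1] (hact X 3 (Suc p) [0,1,2] T)" unfolding w_def using T(1) by simp
    then show "hact X 2 (Suc p) [0,1] w = c1 f (Suc p)" using T012 t1 t1_01 by simp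
    have "hact X 2 (Suc p) [0,2] w = hact X 2 (Suc p) [0,2] (hact X 3 (Suc p) [0,2,3] T)" unfolding w_def using T(1) by simp
    then show "hact X 2 (Suc p) [0,2] w = K" using T023 K(1) by simp
  qed
qed

text \<open>The contraction \<open>w\<close> of \<open>v\<close> keeps edge 01 constant, and its
  edge 02 is a sphere \<open>k\<close> at \<open>h\<close>. The sphere \<open>y'\<close> at
  \<open>s\<close> has exactly these two edges, so \<open>w\<close> minus \<open>y'\<close> still
  bounds \<open>v\<close> and is constant on the corolla.\<close>

lemma sphere_null:
  assumes v: "v \<in> bcells X 2 p" "hact X 2 p [0,1] v = c1 f p" "hact X 2 p [0,2] v = c1 h p"
    and bd: "\<And>i. 0 < p \<Longrightarrow> i \<le> p \<Longrightarrow> face (col 2) p i v = c2 s (p - 1)"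
  obtains u where "u \<in> bcells X 2 (Suc p)" "col_res (corolla_cx 2) 2 (Suc p) u = const_simplex (Mc X (corolla_cx 2)) (col_res (corolla_cx 2) 2 0 s) (Suc p)"
    "face (col 2) (Suc p) (Suc p) u = v" "\<And>i. i \<le> p \<Longrightarrow> face (col 2) (Suc p) i u = c2 s p"
proof -
  let ?A = "corolla_cx 2" let ?B = "Mc X ?A" and ?q = "col_res ?A 2"
  let ?P = "{([0,1], c1 f (Suc (Suc p))), ([0,2], c1 h (Suc (Suc p)))}"
  have AP: "?A = facet_cx P'" if "P' = {([0,1], a), ([0,2], b)}" for P' a b using that facet_cx_corolla2 by simp
  note A = corolla2_complex and e = corolla2_edges and K = kan_fib_cr[OF corolla2_complex kan_incl_corolla2]
  have eqI: "F = F'" if "F \<in> cells ?B m" "F' \<in> cells ?B m" "F [0,1] = F' [0,1]" "F [0,2] = F' [0,2]" for F F' m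
    by (rule Mc_facet_eqI[of F "{([0,1], f), ([0,2], f)}" m]) (use that AP[OF refl, of f f] in auto)
  have qe: "?q m b [0,1] = hact X 2 m [0,1] b" "?q m b [0,2] = hact X 2 m [0,2] b" for m b using e by (simp_all add: col_res_def)
  have qin: "b \<in> bcells X 2 m \<Longrightarrow> ?q m b \<in> cells ?B m" for b m by (rule cr_in[OF A])
  note ssB = ss_Mc[OF A(1)]
  have q0: "?q 0 s \<in> cells ?B 0" by (rule qin[OF cell1(4)])
  obtain w where w: "w \<in> bcells X 2 (Suc p)" "face (col 2) (Suc p) (Suc p) w = v" "\<And>i. i \<le> p \<Longrightarrow> face (col 2) (Suc p) i w = c2 s p"
    "hact X 2 (Suc p) [0,1] w = c1 f (Suc p)" by (rule null_over_first_edge[OF v bd]) blast+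
  define k where "k = hact X 2 (Suc p) [0,2] w"
  have k: "k \<in> bcells X 1 (Suc p)" unfolding k_def using w(1) by simp
  have kf: "face (col 1) (Suc p) i k = c1 h p" if "i \<le> Suc p" for i
    unfolding k_def using h_face_gen(1)[OF w(1), of 0 2 i, symmetric] w(2) w(3)[of i] v(3) cell1 that by (cases "i = Suc p") auto
  have k0: "hact X 1 (Suc p) [0] k = const_simplex (col 0) x (Suc p)"
  proof -
    have "hact X 1 (Suc p) [0] k = hact X 1 (Suc p) [0] (hact X 2 (Suc p) [0,1] w)" unfolding k_def using w(1) by simp
    then show ?thesis using w(4) cell1 by simp
  qed
  obtain y' where y': "y' \<in> bcells X 2 (Suc p)" "\<And>i. i \<le> Suc p \<Longrightarrow> face (col 2) (Suc p) i y' = c2 s p"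
    "hact X 2 (Suc p) [0,1] y' = c1 f (Suc p)" "hact X 2 (Suc p) [0,2] y' = k"
    by (rule lift_sphere_along_second_edge[OF k kf k0]) auto
  have kc: "k \<in> cells (col 1) (Suc p)" using k by simp
  \<comment> \<open>The degeneracy \<open>?d\<close> has \<open>k\<close> as its faces
    \<open>p\<close> and \<open>Suc p\<close> and is constant at \<open>h\<close> on the others: it
    witnesses that \<open>k\<close> minus \<open>k\<close> is trivial. Paired with constant
    \<open>f\<close>, it is the simplex over which \<open>sphere_subtract\<close> lifts.\<close>
  let ?d = "deg (col 1) (Suc p) p k"
  have d: "?d \<in> bcells X 1 (Suc (Suc p))" using ss.deg_in[OF ss_col _ kc, of p] by simp
  have d1: "face (col 1) (Suc (Suc p)) p ?d = k" "face (col 1) (Suc (Suc p)) (Suc p) ?d = k"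
    using ss.face_deg_eq[OF ss_col kc, of _ p] by auto
  have hc: "h \<in> cells (col 1) 0" using cell1 by simp
  have d2: "face (col 1) (Suc (Suc p)) (Suc (Suc p)) ?d = c1 h (Suc p)"
    using ss.face_deg_gt[OF ss_col kc, of p "Suc (Suc p)"] kf[of "Suc p"] ss.deg_const[OF ss_col hc, of p p] by simp
  have d3: "face (col 1) (Suc (Suc p)) i ?d = c1 h (Suc p)" if "i < p" for i
    using ss.face_deg_lt[OF ss_col kc that] kf[of i] ss.deg_const[OF ss_col hc, of "p - 1" p] that by simp
  have d0: "hact X 1 (Suc (Suc p)) [0] ?d = const_simplex (col 0) x (Suc (Suc p))"
    using h_deg[of "[0]" 0 1 p "Suc p" k] k k0 ss.deg_const[OF ss_col, of x 0 p "Suc p"] objs(1) by simp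
  have agr: "glueable 2 (Suc (Suc p)) {([0,1], c1 f (Suc (Suc p))), ([0,2], ?d)}"
    by (rule glue_corolla2) (use cell1 d d0 col_c_in in auto)
  obtain H where H: "H \<in> cells (Mc X (facet_cx {([0,1], c1 f (Suc (Suc p))), ([0,2], ?d)})) (Suc (Suc p))"
    "\<And>e x. (e, x) \<in> {([0,1], c1 f (Suc (Suc p))), ([0,2], ?d)} \<Longrightarrow> H e = x"
    by (rule Mc_glue_facets[of "{([0,1], c1 f (Suc (Suc p))), ([0,2], ?d)}" "Suc (Suc p)"]) (use agr in \<open>auto simp: glueable_def\<close>)
  have HB: "H \<in> cells ?B (Suc (Suc p))" using H(1) facet_cx_corolla2 by simp
  have He: "H [0,1] = c1 f (Suc (Suc p))" "H [0,2] = ?d" using H(2) by auto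
  have Hf: "face ?B (Suc (Suc p)) i H \<in> cells ?B (Suc p)" "face ?B (Suc (Suc p)) i H [0,1] = c1 f (Suc p)"
    "face ?B (Suc (Suc p)) i H [0,2] = face (col 1) (Suc (Suc p)) i ?d" if "i \<le> Suc (Suc p)" for i
    using ss.face_in[OF ssB that HB] face_Mc[OF e(1), of "Suc p" i H] face_Mc[OF e(2), of "Suc p" i H] He col_dc[OF cell1(1) that] by auto
  have cB: "const_simplex ?B (?q 0 s) m \<in> cells ?B m" "const_simplex ?B (?q 0 s) m [0,1] = c1 f m" "const_simplex ?B (?q 0 s) m [0,2] = c1 h m" for m
    using ss.const_in[OF ssB q0] const_Mc[OF e(1)] const_Mc[OF e(2)] qe cell1 by auto
  have sc: "s \<in> cells (col 2) 0" using cell1 by simp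
  have ysp: "y' \<in> spheres (Suc p) (col 2) s" using y' by (auto simp: spheres_def)
  obtain u where u: "u \<in> cells (col 2) (Suc p)" "?q (Suc p) u = face ?B (Suc (Suc p)) (Suc (Suc p)) H"
    "face (col 2) (Suc p) (Suc p) u = face (col 2) (Suc p) (Suc p) w" "\<And>i. i \<le> p \<Longrightarrow> face (col 2) (Suc p) i u = c2 s p"
  proof (rule sphere_subtract[OF K ss_col sc ysp, of w H])
    show "w \<in> cells (col 2) (Suc p)" using w(1) by simp
    show "face (col 2) (Suc p) i w = c2 s p" if "i \<le> p" for i using w(3)[OF that] .
    show "H \<in> cells ?B (Suc (Suc p))" by (rule HB)
    show "face ?B (Suc (Suc p)) i H = const_simplex ?B (?q 0 s) (Suc p)" if "i < p" for i
      by (rule eqI[OF Hf(1) cB(1)]) (use that Hf cB d3 in auto)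
    show "face ?B (Suc (Suc p)) p H = ?q (Suc p) y'"
      by (rule eqI[OF Hf(1) qin[OF y'(1)]]) (use Hf qe y' d1 in auto)
    show "face ?B (Suc (Suc p)) (Suc p) H = ?q (Suc p) w"
      by (rule eqI[OF Hf(1) qin[OF w(1)]]) (use Hf qe w k_def d1 in auto)
  qed blast+
  have "face ?B (Suc (Suc p)) (Suc (Suc p)) H = const_simplex ?B (?q 0 s) (Suc p)"
    by (rule eqI[OF Hf(1) cB(1)]) (use Hf cB d2 in auto)
  then show thesis using that u w(2) by simp
qed

end

text \<open>On vertices the lift is division by \<open>f\<close>. In higher dimensions only a sphere
  at a vertex \<open>s\<close> of X_2 has to be contracted, and \<open>sphere_null\<close> does so
  with inverses of the edge 01 of \<open>s\<close>.\<close>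

theorem corolla_if_groupoid:
  assumes G: "groupoid (Ho X)"
  shows "acyclic_incl (corolla_cx 2) (cx {{..2}})"
proof -
  let ?A = "corolla_cx 2" let ?B = "Mc X ?A" and ?q = "col_res ?A 2"
  note A = corolla2_complex and e = corolla2_edges and K = kan_fib_cr[OF corolla2_complex kan_incl_corolla2]
  note ssB = ss_Mc[OF A(1)]
  have qe: "?q m b [0,1] = hact X 2 m [0,1] b" "?q m b [0,2] = hact X 2 m [0,2] b" for m b using e by (simp_all add: col_res_def)
  have "surj_vertices (col 2) ?B ?q" unfolding surj_vertices_def
  proof
    fix v assume v: "v \<in> cells ?B 0"
    have v1: "v [0,1] \<in> bcells X 1 0" "v [0,2] \<in> bcells X 1 0" using Mc_in[OF v e(1)] Mc_in[OF v e(2)] by auto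
    have "hact X 1 0 [0] (v [0,1]) = hact X 1 0 [0] (v [0,2])"
      using Mc_nat[OF v e(1), of "[0]" 0] Mc_nat[OF v e(2), of "[0]" 0] by simp
    then obtain g s where s: "tri (v [0,1]) g (v [0,2]) s"
      using tri_divide[OF G arrI[OF v1(1)], of _ "v [0,2]"] arrI[OF v1(2)] by metis
    then have sc: "s \<in> bcells X 2 0" by (simp add: tri_def)
    have "?q 0 s = v"
    proof (rule Mc_facet_eqI[of _ "{([0,1], g), ([0,2], g)}" 0])
      show "?q 0 s \<in> cells (Mc X (facet_cx {([0,1], g), ([0,2], g)})) 0" using cr_in[OF A sc] facet_cx_corolla2 by simp
      show "v \<in> cells (Mc X (facet_cx {([0,1], g), ([0,2], g)})) 0" using v facet_cx_corolla2 by simp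
    qed (use s qe in \<open>auto simp: tri_def\<close>)
    then show "\<exists>s\<in>cells (col 2) 0. ?q 0 s = v" using sc by auto
  qed
  moreover have "spheres_null (col 2) ?B ?q p" for p unfolding spheres_null_def
  proof (intro ballI impI)
    fix s v assume sc: "s \<in> cells (col 2) 0" and v: "v \<in> cells (col 2) p"
      and bd: "0 < p \<longrightarrow> (\<forall>i\<le>p. face (col 2) p i v = const_simplex (col 2) s (p - 1))"
      and qv: "?q p v = const_simplex ?B (?q 0 s) p"
    have s: "s \<in> bcells X 2 0" using sc by simp
    have v1: "hact X 2 p [0,1] v = const_simplex (col 1) (hact X 2 0 [0,1] s) p" "hact X 2 p [0,2] v = const_simplex (col 1) (hact X 2 0 [0,2] s) p"
      using fun_cong[OF qv, of "[0,1]"] fun_cong[OF qv, of "[0,2]"] const_Mc[OF e(1)] const_Mc[OF e(2)] qe by auto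
    have t: "tri (hact X 2 0 [0,1] s) (hact X 2 0 [1,2] s) (hact X 2 0 [0,2] s) s" using s by (simp add: tri_def)
    have f: "arr (hact X 2 0 [0] s) (hact X 2 0 [1] s) (hact X 2 0 [0,1] s)" "arr (hact X 2 0 [1] s) (hact X 2 0 [2] s) (hact X 2 0 [1,2] s)"
      using s by (auto simp: arr_def)
    obtain u where "u \<in> bcells X 2 (Suc p)" "?q (Suc p) u = const_simplex ?B (?q 0 s) (Suc p)"
      "face (col 2) (Suc p) (Suc p) u = v" "\<And>i. i \<le> p \<Longrightarrow> face (col 2) (Suc p) i u = const_simplex (col 2) s p"
      by (rule sphere_null[OF G t f _ v1]) (use v bd in auto)
    then show "\<exists>z\<in>cells (col 2) (Suc p). ?q (Suc p) z = const_simplex ?B (?q 0 s) (Suc p) \<and> face (col 2) (Suc p) (Suc p) z = v \<and>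
        (\<forall>i\<le>p. face (col 2) (Suc p) i z = const_simplex (col 2) s p)" by auto
  qed
  ultimately have "acyclic_fib (col 2) ?B ?q" using acyclic_fib_if_spheres_null[OF K _ _ ss_col ssB] by blast
  \<comment> \<open>The map out of X_2 is transported to restriction out of
    \<open>cx {{..2}}\<close>, the form used by \<open>acyclic_incl\<close>.\<close>
  moreover have "pullback_square (Mc X (cx {{..2}})) ?B (res ?A) (col 2) ?B ?q
     (\<lambda>n. the_inv_into (cells (col 2) n) (col_res (cx {{..2}}) 2 n)) (\<lambda>n. the_inv_into (cells ?B n) (\<lambda>x. x))"
  proof (rule sset_iso_pullback'[OF sset_iso_cr _ smap_col_res[OF A] smap_res[OF A(2,1)] _ ss_col ssB])
    show "sset_iso ?B ?B (\<lambda>n x. x)" unfolding sset_iso_def using smap_id by (auto intro: bij_betw_imageI)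
    show "res ?A n (col_res (cx {{..2}}) 2 n b) = col_res ?A 2 n b" for n b
      unfolding res_def col_res_def by (rule extensionalityI[of _ ?A]) (use A(2) in auto)
  qed
  ultimately show ?thesis unfolding acyclic_incl_def using acyclic_fib_pullback ss_Mc[OF complex_cx] by blast
qed

end

theorem corollary5p3:
  fixes X :: "'a bisset"
  assumes "segal_space X"
  shows "bousfield_segal_space X \<longleftrightarrow> groupoid (Ho X)"
proof -
  have v: "v_fibrant X" using assms by (simp add: segal_space_def)
  interpret bss X by unfold_locales (use v in \<open>simp add: v_fibrant_def\<close>)
  interpret vf X by unfold_locales (rule v)
  interpret segal X by unfold_locales (use assms spine_acyclic_incl in \<open>simp add: segal_space_def\<close>)
  have "bousfield_segal_space X \<longleftrightarrow> (\<forall>n\<ge>2. acyclic_incl (corolla_cx n) (cx {{..n}}))"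
    unfolding bousfield_segal_space_def corolla_acyclic_incl using v by simp
  also have "\<dots> \<longleftrightarrow> acyclic_incl (corolla_cx 2) (cx {{..2}})" using acyclic_incl_corolla by blast
  also have "\<dots> \<longleftrightarrow> groupoid (Ho X)" using groupoid_if_corolla corolla_if_groupoid by blast
  finally show ?thesis .
qed

end
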